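(* Let $n\ge 2$ be an integer. Let $\Gamma\subset \mathrm{SL}^{\pm}(n+1,\mathbb{R})$ be a polyhedral projective reflection group dividing a strictly convex open domain $\Omega\subset\mathbb{S}^n$. Let $\Delta$ be any subgroup of finite index in $\Gamma$. Then for an integrally closed Noetherian ring $\mathbb{A}\subset\mathbb{R}$ the following properties are equivalent: (a) $\Gamma$ is definable over $\mathbb{A}$; (a$'$) $\mathbb{A}$ contains all the simple cyclic products of the Cartan matrix of $\Gamma$; (b) $\Delta$ is definable over $\mathbb{A}$.
   Context: $\mathrm{SL}^{\pm}(n+1,\mathbb{R})=\{A\in \mathrm{GL}(n+1,\mathbb{R}) : \det A=\pm1\}$. $\mathbb{S}^n=(\mathbb{R}^{n+1}\setminus\{O\})/\sim$ with $\vec v\sim\vec w$ iff $\vec v=r\vec w$ for some $r>0$; $\mathrm{SL}^{\pm}(n+1,\mathbb{R})$ acts on it. Great circles, hyperspheres and closed hemispheres are images of 2-dimensional subspaces, hyperplanes and closed linear half-spaces. A segment is a proper connected subset of a great circle; it is convex if it contains no antipodal pair except possibly its endpoints. A subset of $\mathbb{S}^n$ is convex if any two of its points are joined by a convex segment in it; it is properly convex if it is convex and its closure contains no pair of antipodal points; a properly convex domain is strictly convex if its boundary contains no nontrivial segment. A (properly) convex polytope $P\subset\mathbb{S}^n$ is a properly convex set that is the image of a closed convex cone with nonempty interior bounded by finitely many hyperplanes; its sides are its codimension-one faces. A reflection is an element of order 2 of $\mathrm{SL}^{\pm}(n+1,\mathbb{R})$ that is the identity on a hyperplane; it has the form $\sigma=I-\alpha\otimes\vec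 v$, i.e. $\vec x\mapsto \vec x-\alpha(\vec x)\vec v$, with $\alpha$ in the dual space, $\vec v$ a vector and $\alpha(\vec v)=2$. A polyhedral projective reflection group is a group generated by reflections $\sigma_s=I-\alpha_s\otimes\vec v_s$, one for each side $s$ of an $n$-dimensional convex polytope $P\subset\mathbb{S}^n$, where $\sigma_s$ fixes the side $s$ pointwise and the signs are chosen so that $P$ is defined by the inequalities $\alpha_s\le 0$. The Cartan matrix of $\Gamma$ is $C=(c_{s,t})$ with $c_{s,t}=\alpha_s(\vec v_t)$ (well defined up to conjugation by positive diagonal matrices). A cyclic product is $c_{i_1i_2}c_{i_2i_3}\cdots c_{i_ki_1}$; it is simple if the indices $i_1,\dots,i_k$ are distinct. Cyclic products do not change under conjugation of $C$ by positive diagonal matrices. A discrete group $\Gamma\subset \mathrm{SL}^{\pm}(n+1,\mathbb{R})$ divides a properly convex open domain $\Omega\subset\mathbb{S}^n$ if it preserves $\Omega$, acts on it properly discontinuously, and $\Omega/\Gamma$ is compact (and Hausdorff). For a subring $\mathbb{A}$ of $\mathbb{R}$, an $\mathbb{A}$-lattice in $V=\mathbb{R}^{n+1}$ is a finitely generated $\mathbb{A}$-submodule $L\subset V$ such that the natural map $\mathbb{R}\otimes_{\mathbb{A}}L\to V$ is an isomorphism. A group of linear automorphisms of $V$ is definable over $\mathbb{A}$ if $V$ contains an $\mathbb{A}$-lattice invariant under it. *)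

theory Defs
  imports "HOL-Algebra.Free_Abelian_Groups" "HOL-Algebra.Algebraic_Closure_Type"
    "HOL-Analysis.Analysis"
begin

section \<open>The projective sphere\<close>

text \<open>The space \<open>\<real>\<^sup>n\<^sup>+\<^sup>1\<close> is rendered as \<open>real ^ 'd\<close> with \<open>CARD('d) = n + 1\<close>.\<close>

definition same_ray :: "real ^ 'd \<Rightarrow> real ^ 'd \<Rightarrow> bool" where
  "same_ray v w \<longleftrightarrow> v \<noteq> 0 \<and> w \<noteq> 0 \<and> (\<exists>r>0. v = r *\<^sub>R w)"

lemma part_equivp_same_ray: "part_equivp (same_ray :: real ^ 'd::finite \<Rightarrow> _)"
proof (rule part_equivpI)
  show "\<exists>x :: real ^ 'd. same_ray x x"
    by (rule exI[of _ 1]) (auto simp: same_ray_def intro: exI[of _ 1])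
  show "symp (same_ray :: real ^ 'd \<Rightarrow> _)"
  proof (rule sympI)
    fix x y :: "real ^ 'd" assume "same_ray x y"
    then obtain r where r: "x \<noteq> 0" "y \<noteq> 0" "r > 0" "x = r *\<^sub>R y"
      by (auto simp: same_ray_def)
    then have "y = inverse r *\<^sub>R x" by simp
    with r show "same_ray y x" unfolding same_ray_def
      using positive_imp_inverse_positive by blast
  qed
  show "transp (same_ray :: real ^ 'd \<Rightarrow> _)"
    by (rule transpI) (auto simp: same_ray_def intro: mult_pos_pos)
qed

text \<open>The points of the sphere are the classes \<open>ray v\<close> with \<open>v \<noteq> 0\<close>; the value \<open>ray 0\<close> is
  irrelevant and never used.\<close>

quotient_type (overloaded) 'd psphere = "real ^ 'd::finite" / partial: same_ray
  morphisms rep_ray ray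
  by (rule part_equivp_same_ray)

lemma rep_ray_nonzero: "rep_ray p \<noteq> 0"
  using Quotient_rep_reflp[OF Quotient_psphere] by (auto simp: same_ray_def)

lemma ray_rep_ray: "ray (rep_ray p) = p"
  by (rule Quotient_abs_rep[OF Quotient_psphere])

lemma ray_eq_iff: "v \<noteq> 0 \<Longrightarrow> w \<noteq> 0 \<Longrightarrow> ray v = ray w \<longleftrightarrow> (\<exists>r>0. v = r *\<^sub>R w)"
proof -
  assume "v \<noteq> 0" "w \<noteq> 0"
  moreover from this have "same_ray v v" "same_ray w w"
    by (auto simp: same_ray_def intro: exI[of _ 1])
  ultimately show ?thesis
    using Quotient_rel[OF Quotient_psphere, of v w] by (auto simp: same_ray_def)
qed

text \<open>The quotient topology of \<open>\<real>\<^sup>n\<^sup>+\<^sup>1 - {0}\<close>.\<close>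

instantiation psphere :: (finite) topological_space
begin

definition open_psphere :: "'a psphere set \<Rightarrow> bool" where
  "open_psphere U \<longleftrightarrow> open {v. v \<noteq> 0 \<and> ray v \<in> U}"

instance
proof
  show "open (UNIV :: 'a psphere set)"
    by (simp add: open_psphere_def open_Collect_neq)
next
  fix S T :: "'a psphere set" assume "open S" "open T"
  then have "open ({v. v \<noteq> 0 \<and> ray v \<in> S} \<inter> {v. v \<noteq> 0 \<and> ray v \<in> T})"
    by (auto simp: open_psphere_def)
  moreover have "{v. v \<noteq> 0 \<and> ray v \<in> S} \<inter> {v. v \<noteq> 0 \<and> ray v \<in> T} =
      {v. v \<noteq> 0 \<and> ray v \<in> S \<inter> T}" by auto
  ultimately show "open (S \<inter> T)"
    by (simp only: open_psphere_def)
next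
  fix K :: "'a psphere set set" assume "\<forall>S\<in>K. open S"
  then have "open (\<Union>S\<in>K. {v. v \<noteq> 0 \<and> ray v \<in> S})"
    by (auto simp: open_psphere_def)
  moreover have "(\<Union>S\<in>K. {v. v \<noteq> 0 \<and> ray v \<in> S}) = {v. v \<noteq> 0 \<and> ray v \<in> \<Union>K}"
    by auto
  ultimately show "open (\<Union>K)"
    by (simp only: open_psphere_def)
qed

end

definition sphere_image :: "(real ^ 'd::finite) set \<Rightarrow> 'd psphere set" where
  "sphere_image S = ray ` (S - {0})"

definition cone_over :: "'d::finite psphere set \<Rightarrow> (real ^ 'd) set" where
  "cone_over S = {v. v = 0 \<or> ray v \<in> S}"

definition antipode :: "'d::finite psphere \<Rightarrow> 'd psphere" where
  "antipode p = ray (- rep_ray p)"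

section \<open>Segments and convexity\<close>

definition great_circle :: "'d::finite psphere set \<Rightarrow> bool" where
  "great_circle C \<longleftrightarrow> (\<exists>W. subspace W \<and> dim W = 2 \<and> C = sphere_image W)"

definition segment_of :: "'d::finite psphere set \<Rightarrow> 'd psphere set \<Rightarrow> bool" where
  "segment_of C S \<longleftrightarrow> great_circle C \<and> S \<subset> C \<and> connected S"

text \<open>The endpoints of an arc are its boundary points relative to the great circle.\<close>

definition endpoints :: "'d::finite psphere set \<Rightarrow> 'd psphere set \<Rightarrow> 'd psphere set" where
  "endpoints C S = (top_of_set C) frontier_of S"

definition convex_segment_of :: "'d::finite psphere set \<Rightarrow> 'd psphere set \<Rightarrow> bool" where
  "convex_segment_of C S \<longleftrightarrow> segment_of C S \<and>
     (\<forall>p\<in>S. antipode p \<in> S \<longrightarrow> {p, antipode p} \<subseteq> endpoints C S)"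

definition sphere_convex :: "'d::finite psphere set \<Rightarrow> bool" where
  "sphere_convex S \<longleftrightarrow> (\<forall>p\<in>S. \<forall>q\<in>S. \<exists>C T.
     convex_segment_of C T \<and> T \<subseteq> S \<and> {p, q} \<subseteq> T \<and> endpoints C T = {p, q})"

definition properly_convex :: "'d::finite psphere set \<Rightarrow> bool" where
  "properly_convex S \<longleftrightarrow> sphere_convex S \<and> \<not> (\<exists>p. p \<in> closure S \<and> antipode p \<in> closure S)"

definition properly_convex_domain :: "'d::finite psphere set \<Rightarrow> bool" where
  "properly_convex_domain \<Omega> \<longleftrightarrow> open \<Omega> \<and> \<Omega> \<noteq> {} \<and> properly_convex \<Omega>"

definition strictly_convex_domain :: "'d::finite psphere set \<Rightarrow> bool" where
  "strictly_convex_domain \<Omega> \<longleftrightarrow> properly_convex_domain \<Omega> \<and>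
     \<not> (\<exists>C S. segment_of C S \<and> S \<subseteq> frontier \<Omega> \<and> (\<exists>p\<in>S. \<exists>q\<in>S. p \<noteq> q))"

text \<open>The elements of \<open>H\<close> are the normal vectors of the hyperplanes bounding the cone.\<close>

definition convex_polytope :: "'d::finite psphere set \<Rightarrow> bool" where
  "convex_polytope P \<longleftrightarrow> properly_convex P \<and>
     (\<exists>K H. finite H \<and> 0 \<notin> H \<and> K = {x. \<forall>a\<in>H. a \<bullet> x \<le> 0} \<and> interior K \<noteq> {} \<and>
            P = sphere_image K)"

definition sides :: "'d::finite psphere set \<Rightarrow> 'd psphere set set" where
  "sides P = {sphere_image F | F. F facet_of cone_over P}"

section \<open>The group of matrices of determinant one or minus one, and its action\<close>

definition SLpm :: "(real ^ 'd ^ 'd::finite) monoid" where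
  "SLpm = \<lparr>carrier = {A. det A = 1 \<or> det A = -1}, monoid.mult = (**), one = mat 1\<rparr>"

lemma group_SLpm: "group (SLpm :: (real ^ 'd ^ 'd::finite) monoid)"
proof (rule groupI)
  fix x :: "real ^ 'd ^ 'd" assume x: "x \<in> carrier SLpm"
  then have "invertible x"
    by (auto simp: SLpm_def invertible_det_nz)
  then obtain y where y: "y ** x = mat 1"
    by (auto simp: invertible_def)
  then have "det y * det x = 1"
    by (metis det_I det_mul)
  with x y show "\<exists>y\<in>carrier SLpm. y \<otimes>\<^bsub>SLpm\<^esub> x = \<one>\<^bsub>SLpm\<^esub>"
    by (intro bexI[of _ y]) (auto simp: SLpm_def)
qed (auto simp: SLpm_def det_mul matrix_mul_assoc)

definition act :: "real ^ 'd ^ 'd \<Rightarrow> 'd::finite psphere \<Rightarrow> 'd psphere" where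
  "act A p = ray (A *v rep_ray p)"

lemma act_ray:
  assumes "A \<in> carrier SLpm" "v \<noteq> 0"
  shows "act A (ray v) = ray (A *v v)"
proof -
  have "ray (rep_ray (ray v)) = ray v" by (rule ray_rep_ray)
  then obtain r where r: "r > 0" "rep_ray (ray v) = r *\<^sub>R v"
    using assms(2) by (auto simp: ray_eq_iff rep_ray_nonzero)
  have "inj ((*v) A)"
    using assms(1) by (auto simp: SLpm_def inj_matrix_vector_mult invertible_det_nz)
  then have nz: "A *v v \<noteq> 0"
    using assms(2) by (metis injD matrix_vector_mult_0_right)
  show ?thesis
    using r nz by (simp add: act_def ray_eq_iff matrix_vector_mult_scaleR)
qed

definition orbit_of :: "(real ^ 'd ^ 'd) set \<Rightarrow> 'd::finite psphere \<Rightarrow> 'd psphere set" where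
  "orbit_of \<Gamma> p = (\<lambda>\<gamma>. act \<gamma> p) ` \<Gamma>"

definition orbit_space_open ::
    "(real ^ 'd ^ 'd) set \<Rightarrow> 'd::finite psphere set \<Rightarrow> 'd psphere set set \<Rightarrow> bool" where
  "orbit_space_open \<Gamma> \<Omega> U \<longleftrightarrow>
     U \<subseteq> orbit_of \<Gamma> ` \<Omega> \<and> openin (top_of_set \<Omega>) {p \<in> \<Omega>. orbit_of \<Gamma> p \<in> U}"

lemma istopology_orbit_space_open: "istopology (orbit_space_open \<Gamma> \<Omega>)"
  unfolding istopology_def
proof safe
  fix S T assume "orbit_space_open \<Gamma> \<Omega> S" "orbit_space_open \<Gamma> \<Omega> T"
  moreover have "{p \<in> \<Omega>. orbit_of \<Gamma> p \<in> S \<inter> T} =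
      {p \<in> \<Omega>. orbit_of \<Gamma> p \<in> S} \<inter> {p \<in> \<Omega>. orbit_of \<Gamma> p \<in> T}" by auto
  ultimately show "orbit_space_open \<Gamma> \<Omega> (S \<inter> T)"
    by (auto simp only: orbit_space_open_def openin_Int)
next
  fix K assume K: "\<forall>S\<in>K. orbit_space_open \<Gamma> \<Omega> S"
  have "{p \<in> \<Omega>. orbit_of \<Gamma> p \<in> \<Union>K} = (\<Union>S\<in>K. {p \<in> \<Omega>. orbit_of \<Gamma> p \<in> S})" by auto
  moreover have "openin (top_of_set \<Omega>) (\<Union>S\<in>K. {p \<in> \<Omega>. orbit_of \<Gamma> p \<in> S})"
    using K unfolding orbit_space_open_def by blast
  ultimately show "orbit_space_open \<Gamma> \<Omega> (\<Union>K)"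
    using K by (auto simp: orbit_space_open_def)
qed

definition orbit_space ::
    "(real ^ 'd ^ 'd) set \<Rightarrow> 'd::finite psphere set \<Rightarrow> 'd psphere set topology" where
  "orbit_space \<Gamma> \<Omega> = topology (orbit_space_open \<Gamma> \<Omega>)"

definition properly_discontinuous ::
    "(real ^ 'd ^ 'd) set \<Rightarrow> 'd::finite psphere set \<Rightarrow> bool" where
  "properly_discontinuous \<Gamma> \<Omega> \<longleftrightarrow>
     (\<forall>K. compact K \<and> K \<subseteq> \<Omega> \<longrightarrow> finite {\<gamma> \<in> \<Gamma>. act \<gamma> ` K \<inter> K \<noteq> {}})"

definition divides_domain :: "(real ^ 'd ^ 'd) set \<Rightarrow> 'd::finite psphere set \<Rightarrow> bool" where
  "divides_domain \<Gamma> \<Omega> \<longleftrightarrow> subgroup \<Gamma> SLpm \<and> discrete \<Gamma> \<and> properly_convex_domain \<Omega> \<and>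
     (\<forall>\<gamma>\<in>\<Gamma>. act \<gamma> ` \<Omega> = \<Omega>) \<and> properly_discontinuous \<Gamma> \<Omega> \<and>
     compact_space (orbit_space \<Gamma> \<Omega>) \<and> Hausdorff_space (orbit_space \<Gamma> \<Omega>)"

section \<open>Polyhedral projective reflection groups\<close>

definition reflection :: "real ^ 'd ^ 'd::finite \<Rightarrow> bool" where
  "reflection \<sigma> \<longleftrightarrow> \<sigma> \<in> carrier SLpm \<and> \<sigma> \<noteq> mat 1 \<and> \<sigma> ** \<sigma> = mat 1 \<and>
     (\<exists>W. subspace W \<and> dim W = CARD('d) - 1 \<and> (\<forall>x\<in>W. \<sigma> *v x = x))"

definition reflection_matrix :: "(real ^ 'd \<Rightarrow> real) \<Rightarrow> real ^ 'd \<Rightarrow> real ^ 'd ^ 'd::finite" where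
  "reflection_matrix \<alpha> v = matrix (\<lambda>x. x - \<alpha> x *\<^sub>R v)"

text \<open>The families \<open>\<alpha>\<close> (of linear forms) and \<open>v\<close> (of vectors) are indexed by the sides of \<open>P\<close>;
  their values at other arguments are irrelevant.\<close>

definition polyhedral_reflection_group ::
    "(real ^ 'd ^ 'd) set \<Rightarrow> 'd psphere set \<Rightarrow> ('d psphere set \<Rightarrow> real ^ 'd \<Rightarrow> real) \<Rightarrow>
     ('d psphere set \<Rightarrow> real ^ 'd::finite) \<Rightarrow> bool" where
  "polyhedral_reflection_group \<Gamma> P \<alpha> v \<longleftrightarrow>
     convex_polytope P \<and>
     (\<forall>s\<in>sides P. linear (\<alpha> s) \<and> \<alpha> s (v s) = 2 \<and>
        reflection (reflection_matrix (\<alpha> s) (v s)) \<and>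
        (\<forall>p\<in>s. act (reflection_matrix (\<alpha> s) (v s)) p = p)) \<and>
     P = sphere_image {x. \<forall>s\<in>sides P. \<alpha> s x \<le> 0} \<and>
     \<Gamma> = generate SLpm ((\<lambda>s. reflection_matrix (\<alpha> s) (v s)) ` sides P)"

definition cartan_matrix ::
    "('i \<Rightarrow> 'v \<Rightarrow> real) \<Rightarrow> ('i \<Rightarrow> 'v) \<Rightarrow> 'i \<Rightarrow> 'i \<Rightarrow> real" where
  "cartan_matrix \<alpha> v s t = \<alpha> s (v t)"

definition cyclic_product :: "('i \<Rightarrow> 'i \<Rightarrow> real) \<Rightarrow> 'i list \<Rightarrow> real" where
  "cyclic_product c is = (\<Prod>j<length is. c (is ! j) (is ! (Suc j mod length is)))"

definition simple_cyclic_products :: "'i set \<Rightarrow> ('i \<Rightarrow> 'i \<Rightarrow> real) \<Rightarrow> real set" where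
  "simple_cyclic_products I c =
     {cyclic_product c is | is. is \<noteq> [] \<and> distinct is \<and> set is \<subseteq> I}"

section \<open>Integrally closed Noetherian subrings of the reals\<close>

definition real_subring :: "real set \<Rightarrow> bool" where
  "real_subring A \<longleftrightarrow> subring A ring_of_type_algebra"

definition noetherian_subring :: "real set \<Rightarrow> bool" where
  "noetherian_subring A \<longleftrightarrow> noetherian_ring (ring_of_type_algebra\<lparr>carrier := A\<rparr>)"

definition integral_over :: "real set \<Rightarrow> real \<Rightarrow> bool" where
  "integral_over A x \<longleftrightarrow>
     (\<exists>p :: real poly. lead_coeff p = 1 \<and> (\<forall>i. poly.coeff p i \<in> A) \<and> poly p x = 0)"

text \<open>Integrally closed means: in the field of fractions, not in \<open>\<real>\<close>.\<close>

definition integrally_closed :: "real set \<Rightarrow> bool" where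
  "integrally_closed A \<longleftrightarrow>
     (\<forall>a\<in>A. \<forall>b\<in>A. b \<noteq> 0 \<longrightarrow> integral_over A (a / b) \<longrightarrow> a / b \<in> A)"

section \<open>Lattices and rings of definition\<close>

definition fin_gen_submodule :: "real set \<Rightarrow> 'v::real_vector set \<Rightarrow> bool" where
  "fin_gen_submodule A L \<longleftrightarrow>
     (\<exists>B. finite B \<and> L = {\<Sum>b\<in>B. c b *\<^sub>R b | c. \<forall>b\<in>B. c b \<in> A})"

text \<open>The tensor product \<open>\<real> \<otimes>\<^sub>A L\<close> as the free abelian group on \<open>\<real> \<times> L\<close> modulo the bilinearity and
  balancing relations; \<open>frag_of (r, x)\<close> represents \<open>r \<otimes> x\<close>.\<close>

definition tensor_free :: "'v::real_vector set \<Rightarrow> ((real \<times> 'v) \<Rightarrow>\<^sub>0 int) monoid" where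
  "tensor_free L = free_Abelian_group (UNIV \<times> L)"

definition tensor_relations :: "real set \<Rightarrow> 'v::real_vector set \<Rightarrow> ((real \<times> 'v) \<Rightarrow>\<^sub>0 int) set" where
  "tensor_relations A L =
     {frag_of (r + r', x) - frag_of (r, x) - frag_of (r', x) | r r' x. x \<in> L} \<union>
     {frag_of (r, x + x') - frag_of (r, x) - frag_of (r, x') | r x x'. x \<in> L \<and> x' \<in> L} \<union>
     {frag_of (r * a, x) - frag_of (r, a *\<^sub>R x) | r a x. a \<in> A \<and> x \<in> L}"

definition tensor_product ::
    "real set \<Rightarrow> 'v::real_vector set \<Rightarrow> ((real \<times> 'v) \<Rightarrow>\<^sub>0 int) set monoid" where
  "tensor_product A L = tensor_free L Mod generate (tensor_free L) (tensor_relations A L)"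

definition tensor_eval :: "((real \<times> 'v::real_vector) \<Rightarrow>\<^sub>0 int) \<Rightarrow> 'v" where
  "tensor_eval c =
     (\<Sum>p\<in>Poly_Mapping.keys c. of_int (Poly_Mapping.lookup c p) *\<^sub>R (fst p *\<^sub>R snd p))"

text \<open>\<open>tensor_eval\<close> is constant on each coset (\<open>natural_map_coset\<close> below), and this constant is the
  value of the natural map \<open>r \<otimes> x \<mapsto> r x\<close>.\<close>

definition natural_map :: "((real \<times> 'v::real_vector) \<Rightarrow>\<^sub>0 int) set \<Rightarrow> 'v" where
  "natural_map S = the_elem (tensor_eval ` S)"

lemma tensor_eval_superset:
  assumes "finite B" "Poly_Mapping.keys c \<subseteq> B"
  shows "tensor_eval c =
    (\<Sum>p\<in>B. of_int (Poly_Mapping.lookup c p) *\<^sub>R (fst p *\<^sub>R snd p))"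
  unfolding tensor_eval_def using assms
  by (intro sum.mono_neutral_left) (auto simp: in_keys_iff)

lemma tensor_eval_add: "tensor_eval (c + d) = tensor_eval c + tensor_eval d"
proof -
  let ?B = "Poly_Mapping.keys c \<union> Poly_Mapping.keys d"
  have "Poly_Mapping.keys (c + d) \<subseteq> ?B" by (rule Poly_Mapping.keys_add)
  then show ?thesis
    by (simp add: tensor_eval_superset[of ?B] lookup_add distrib_right scaleR_add_left sum.distrib)
qed

lemma tensor_eval_uminus: "tensor_eval (- c) = - tensor_eval c"
  by (simp add: tensor_eval_def sum_negf)

lemma tensor_eval_diff: "tensor_eval (c - d) = tensor_eval c - tensor_eval d"
  using tensor_eval_add[of c "- d"] by (simp add: tensor_eval_uminus)

lemma tensor_eval_frag_of: "tensor_eval (frag_of (r, x)) = r *\<^sub>R x"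
  by (simp add: tensor_eval_def)

lemma tensor_relations_subset:
  assumes "fin_gen_submodule A L" "real_subring A"
  shows "tensor_relations A L \<subseteq> carrier (tensor_free L)"
proof -
  have A: "a + b \<in> A" "a * b \<in> A" if "a \<in> A" "b \<in> A" for a b
    using assms(2) that subgroup.m_closed[of A "add_monoid ring_of_type_algebra" a b]
      submonoid.m_closed[of A ring_of_type_algebra a b]
    by (auto simp: real_subring_def subring_def ring_of_type_algebra_def)
  obtain B where B: "finite B" "L = {\<Sum>b\<in>B. c b *\<^sub>R b | c. \<forall>b\<in>B. c b \<in> A}"
    using assms(1) by (auto simp: fin_gen_submodule_def)
  have add: "x + y \<in> L" if xy: "x \<in> L" "y \<in> L" for x y
  proof -
    obtain c d where "\<forall>b\<in>B. c b \<in> A" "x = (\<Sum>b\<in>B. c b *\<^sub>R b)"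
      "\<forall>b\<in>B. d b \<in> A" "y = (\<Sum>b\<in>B. d b *\<^sub>R b)"
      using xy B by auto
    then show ?thesis unfolding B
      by (auto intro!: exI[of _ "\<lambda>b. c b + d b"] simp: A scaleR_add_left sum.distrib)
  qed
  have mul: "a *\<^sub>R x \<in> L" if ax: "a \<in> A" "x \<in> L" for a x
  proof -
    obtain c where "\<forall>b\<in>B. c b \<in> A" "x = (\<Sum>b\<in>B. c b *\<^sub>R b)"
      using ax B by auto
    then show ?thesis unfolding B
      by (auto intro!: exI[of _ "\<lambda>b. a * c b"] simp: A ax scaleR_sum_right)
  qed
  show ?thesis
    unfolding tensor_relations_def tensor_free_def free_Abelian_group_def
    using add mul by (auto dest!: subsetD[OF keys_diff])
qed

lemma natural_map_coset:
  assumes "fin_gen_submodule A L" "real_subring A"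
  shows "natural_map (generate (tensor_free L) (tensor_relations A L) #>\<^bsub>tensor_free L\<^esub> c) =
    tensor_eval c"
proof -
  let ?N = "generate (tensor_free L) (tensor_relations A L)"
  have ev: "tensor_eval c = 0" if "c \<in> tensor_relations A L" for c
    using that unfolding tensor_relations_def
    by (auto simp: tensor_eval_diff tensor_eval_frag_of scaleR_add_left scaleR_add_right)
  have N: "tensor_eval d = 0" if "d \<in> ?N" for d
    using that
  proof (induction rule: generate.induct)
    case (inv h)
    then have "h \<in> carrier (tensor_free L)"
      using tensor_relations_subset[OF assms] by blast
    then show ?case
      using ev[OF inv] by (simp add: tensor_free_def tensor_eval_uminus)
  qed (auto simp: ev tensor_free_def tensor_eval_add tensor_eval_def[of 0])
  have "0 \<in> ?N"
    using generate.one[of "tensor_free L"] by (simp add: tensor_free_def)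
  then have "tensor_eval ` (?N #>\<^bsub>tensor_free L\<^esub> c) = {tensor_eval c}"
    using N by (force simp: r_coset_def tensor_free_def tensor_eval_add)
  then show ?thesis by (simp add: natural_map_def)
qed

definition additive_group :: "'v::real_vector monoid" where
  "additive_group = \<lparr>carrier = UNIV, monoid.mult = (+), one = 0\<rparr>"

text \<open>The natural map is \<open>\<real>\<close>-linear, so being an isomorphism of vector spaces and of additive
  groups is the same.\<close>

definition A_lattice :: "real set \<Rightarrow> 'v::real_vector set \<Rightarrow> bool" where
  "A_lattice A L \<longleftrightarrow> fin_gen_submodule A L \<and>
     natural_map \<in> iso (tensor_product A L) additive_group"

definition definable_over :: "(real ^ 'd ^ 'd) set \<Rightarrow> real set \<Rightarrow> bool" where
  "definable_over G A \<longleftrightarrow>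
     (\<exists>L :: (real ^ 'd::finite) set. A_lattice A L \<and> (\<forall>g\<in>G. (*v) g ` L = L))"

end

theory Submission
  imports Defs
begin

text \<open>
  Let \<open>K\<close> be the field of fractions of \<open>A\<close>. An \<open>A\<close>-lattice is a finitely generated \<open>A\<close>-module spanning
  \<open>V\<close> inside the \<open>K\<close>-span of some real basis.

  If \<open>\<Gamma>\<close> preserves a lattice \<open>L\<close>, a product of the maps \<open>1 - \<sigma>\<^sub>s\<close> has rank one, preserves \<open>L\<close> and has a
  cyclic product \<open>c\<close> as its trace; evaluating its powers on \<open>L\<close> shows \<open>q c\<^sup>m \<in> A\<close> for all \<open>m\<close> and some
  \<open>q \<noteq> 0\<close>, so \<open>c \<in> A\<close>. Conversely the vectors \<open>c\<^bsub>i j\<^esub> \<cdots> c\<^bsub>l i0\<^esub> v\<^sub>i\<close> along paths ending in a fixed side \<open>i0\<close>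
  generate an invariant \<open>A\<close>-module, on which the analogous functionals along paths starting in \<open>i0\<close>
  take values in \<open>A\<close>; irreducibility of \<open>\<Gamma>\<close> makes it a lattice.

  Irreducibility, even of a normal subgroup \<open>N\<close> of finite index, comes from dynamics: as \<open>\<Omega>\<close> is strictly
  convex and \<open>N\<close> acts cocompactly, every boundary point \<open>x\<close> spans the image of a rank one limit of
  rescaled elements of \<open>N\<close>. Hence a proper invariant subspace contains a unique boundary
  point, which is fixed by \<open>\<Gamma>\<close>, so lies in the kernel of all \<open>\<alpha>\<^sub>s\<close>, which is impossible. The same limits
  give \<open>End\<^sub>N(V) = \<real>\<close>.

  If \<open>N\<close> preserves a \<open>K\<close>-form \<open>V\<^sub>K\<close>, then \<open>\<sigma>\<^sub>s V\<^sub>K\<close> is another one, and Schur's lemma gives \<open>\<sigma>\<^sub>s V\<^sub>K = c V\<^sub>K\<close>.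
  Since \<open>tr \<sigma>\<^sub>s = n - 1 \<noteq> 0\<close>, the scalar lies in \<open>K\<close>. So \<open>\<Gamma>\<close> preserves \<open>V\<^sub>K\<close>, and the sum of the finitely
  many translates of an \<open>N\<close>-invariant lattice is a \<open>\<Gamma>\<close>-invariant one.\<close>

section \<open>Modules over subrings of the reals\<close>

text \<open>Scalars are a set rather than a type, so that \<open>A\<close> and its field of
  fractions can act on the same real vector space.\<close>

definition submodule_over :: "real set \<Rightarrow> 'v::real_vector set \<Rightarrow> bool" where
  "submodule_over F S \<longleftrightarrow>
     0 \<in> S \<and> (\<forall>x\<in>S. \<forall>y\<in>S. x + y \<in> S) \<and> (\<forall>k\<in>F. \<forall>x\<in>S. k *\<^sub>R x \<in> S)"

definition span_over :: "real set \<Rightarrow> 'v::real_vector set \<Rightarrow> 'v set" where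
  "span_over F B = submodule_over F hull B"

definition fractions :: "real set \<Rightarrow> real set" where
  "fractions A = {a / b | a b. a \<in> A \<and> b \<in> A \<and> b \<noteq> 0}"

lemma submodule_over_span_over: "submodule_over F (span_over F B)"
  unfolding span_over_def by (rule hull_in) (auto simp: submodule_over_def)

lemma submodule_over_0: "submodule_over F S \<Longrightarrow> 0 \<in> S"
  and submodule_over_add: "submodule_over F S \<Longrightarrow> x \<in> S \<Longrightarrow> y \<in> S \<Longrightarrow> x + y \<in> S"
  and submodule_over_scale: "submodule_over F S \<Longrightarrow> k \<in> F \<Longrightarrow> x \<in> S \<Longrightarrow> k *\<^sub>R x \<in> S"
  by (auto simp: submodule_over_def)

lemma submodule_over_sum:
  "submodule_over F S \<Longrightarrow> (\<And>i. i \<in> I \<Longrightarrow> f i \<in> S) \<Longrightarrow> sum f I \<in> S"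
  by (induction I rule: infinite_finite_induct)
     (auto simp: submodule_over_0 submodule_over_add)

lemma submodule_over_zero: "submodule_over F {0}"
  by (auto simp: submodule_over_def)

lemma submodule_over_if_subspace: "subspace S \<Longrightarrow> submodule_over F S"
  by (auto simp: submodule_over_def subspace_0 subspace_add subspace_scale)

lemma submodule_over_vimage:
  "linear f \<Longrightarrow> submodule_over F S \<Longrightarrow> submodule_over F (f -` S)"
  by (auto simp: submodule_over_def linear_0 linear_add linear_scale)

lemma span_over_superset: "B \<subseteq> span_over F B"
  unfolding span_over_def by (rule hull_subset)

lemma span_over_base: "b \<in> B \<Longrightarrow> b \<in> span_over F B"
  using span_over_superset by blast

lemma span_over_minimal: "submodule_over F S \<Longrightarrow> B \<subseteq> S \<Longrightarrow> span_over F B \<subseteq> S"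
  unfolding span_over_def by (rule hull_minimal)

lemma span_over_linear_image:
  assumes "linear f" "\<And>b. b \<in> B \<Longrightarrow> f b \<in> span_over F B'" "x \<in> span_over F B"
  shows "f x \<in> span_over F B'"
  using span_over_minimal[OF submodule_over_vimage[OF assms(1) submodule_over_span_over], of B F B'] assms
  by auto

lemma span_span_over: "span (span_over F B) = span B"
proof
  show "span (span_over F B) \<subseteq> span B"
    by (rule span_minimal[OF span_over_minimal])
       (auto intro: submodule_over_if_subspace subspace_span span_base)
qed (intro span_mono span_over_superset)

section \<open>Subrings of the reals and finitely generated modules over them\<close>

locale real_ring =
  fixes A :: "real set"
  assumes zero_mem: "0 \<in> A" and one_mem: "1 \<in> A"
    and add_mem: "a \<in> A \<Longrightarrow> b \<in> A \<Longrightarrow> a + b \<in> A"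
    and mult_mem: "a \<in> A \<Longrightarrow> b \<in> A \<Longrightarrow> a * b \<in> A"
    and uminus_mem: "a \<in> A \<Longrightarrow> - a \<in> A"
begin

lemma diff_mem: "a \<in> A \<Longrightarrow> b \<in> A \<Longrightarrow> a - b \<in> A"
  using add_mem[of a "- b"] uminus_mem by simp

lemma sum_mem: "(\<And>i. i \<in> I \<Longrightarrow> f i \<in> A) \<Longrightarrow> sum f I \<in> A"
  by (induction I rule: infinite_finite_induct) (auto simp: zero_mem add_mem)

lemma of_nat_mem: "of_nat n \<in> A"
  by (induction n) (auto simp: zero_mem one_mem add_mem)

lemma submodule_over_uminus: "submodule_over A S \<Longrightarrow> x \<in> S \<Longrightarrow> - x \<in> S"
  using submodule_over_scale[of A S "- 1" x] one_mem uminus_mem by auto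

lemma submodule_over_diff: "submodule_over A S \<Longrightarrow> x \<in> S \<Longrightarrow> y \<in> S \<Longrightarrow> x - y \<in> S"
  using submodule_over_add[of A S x "- y"] submodule_over_uminus by auto

lemma submodule_over_combinations:
  "submodule_over A {\<Sum>b\<in>B. c b *\<^sub>R b | c. \<forall>b\<in>B. c b \<in> A}"
  unfolding submodule_over_def
proof (intro conjI ballI)
  show "0 \<in> {\<Sum>b\<in>B. c b *\<^sub>R b | c. \<forall>b\<in>B. c b \<in> A}"
    by (auto intro!: exI[of _ "\<lambda>_. 0"] simp: zero_mem)
next
  fix x y
  assume "x \<in> {\<Sum>b\<in>B. c b *\<^sub>R b | c. \<forall>b\<in>B. c b \<in> A}"
    and "y \<in> {\<Sum>b\<in>B. c b *\<^sub>R b | c. \<forall>b\<in>B. c b \<in> A}"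
  then obtain c d where "\<forall>b\<in>B. c b \<in> A" "x = (\<Sum>b\<in>B. c b *\<^sub>R b)"
    "\<forall>b\<in>B. d b \<in> A" "y = (\<Sum>b\<in>B. d b *\<^sub>R b)" by blast
  then show "x + y \<in> {\<Sum>b\<in>B. c b *\<^sub>R b | c. \<forall>b\<in>B. c b \<in> A}"
    by (auto intro!: exI[of _ "\<lambda>b. c b + d b"] simp: add_mem scaleR_add_left sum.distrib)
next
  fix k x
  assume "k \<in> A" "x \<in> {\<Sum>b\<in>B. c b *\<^sub>R b | c. \<forall>b\<in>B. c b \<in> A}"
  moreover then obtain c where "\<forall>b\<in>B. c b \<in> A" "x = (\<Sum>b\<in>B. c b *\<^sub>R b)" by blast
  ultimately show "k *\<^sub>R x \<in> {\<Sum>b\<in>B. c b *\<^sub>R b | c. \<forall>b\<in>B. c b \<in> A}"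
    by (auto intro!: exI[of _ "\<lambda>b. k * c b"] simp: mult_mem scaleR_sum_right)
qed

lemma span_over_finite:
  assumes "finite B"
  shows "span_over A B = {\<Sum>b\<in>B. c b *\<^sub>R b | c. \<forall>b\<in>B. c b \<in> A}" (is "_ = ?S")
proof
  have "b \<in> ?S" if "b \<in> B" for b
  proof -
    have "(\<Sum>b'\<in>B. (if b' = b then 1 else 0) *\<^sub>R b') = (\<Sum>b'\<in>B. if b' = b then b' else 0)"
      by (rule sum.cong) auto
    also have "\<dots> = b" using that assms by simp
    finally have "b = (\<Sum>b'\<in>B. (if b' = b then 1 else 0) *\<^sub>R b')" ..
    moreover have "\<forall>b'\<in>B. (if b' = b then 1 else 0) \<in> A" by (simp add: zero_mem one_mem)
    ultimately show ?thesis by (intro CollectI exI conjI)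
  qed
  then show "span_over A B \<subseteq> ?S"
    by (intro span_over_minimal submodule_over_combinations) auto
  show "?S \<subseteq> span_over A B"
  proof clarify
    fix c assume "\<forall>b\<in>B. c b \<in> A"
    then show "(\<Sum>b\<in>B. c b *\<^sub>R b) \<in> span_over A B"
      by (intro submodule_over_sum[OF submodule_over_span_over]
          submodule_over_scale[OF submodule_over_span_over] span_over_base) auto
  qed
qed

lemma fin_gen_submodule_iff: "fin_gen_submodule A L \<longleftrightarrow> (\<exists>B. finite B \<and> L = span_over A B)"
  by (simp add: fin_gen_submodule_def span_over_finite cong: conj_cong)

end

lemma real_ring_if_subring:
  assumes "real_subring A"
  shows "real_ring A"
proof -
  interpret s: subring A "ring_of_type_algebra :: real ring"
    using assms by (simp add: real_subring_def)
  interpret r: ring "ring_of_type_algebra :: real ring" by (rule ring_from_type_algebra)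
  have um: "\<ominus>\<^bsub>ring_of_type_algebra\<^esub> a = - a" for a :: real
    by (rule r.minus_equality[symmetric, symmetric]) (auto simp: ring_of_type_algebra_def)
  show ?thesis
  proof
    fix a assume "a \<in> A"
    then show "- a \<in> A" using s.m_inv_closed[of a] um by (simp add: a_inv_def)
  qed (use subringE[OF s.subring_axioms] in
        \<open>auto simp: ring_of_type_algebra_def\<close>)
qed

section \<open>Linear algebra over a subfield of the reals\<close>

locale real_field = real_ring A for A +
  assumes inverse_mem: "a \<in> A \<Longrightarrow> inverse a \<in> A"
begin

lemma divide_mem: "a \<in> A \<Longrightarrow> b \<in> A \<Longrightarrow> a / b \<in> A"
  by (simp add: divide_inverse inverse_mem mult_mem)

lemma submodule_over_add_line:
  assumes "submodule_over A H"
  shows "submodule_over A {h + k *\<^sub>R y | h k. h \<in> H \<and> k \<in> A}"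
  unfolding submodule_over_def
proof (intro conjI ballI)
  show "0 \<in> {h + k *\<^sub>R y | h k. h \<in> H \<and> k \<in> A}"
    using submodule_over_0[OF assms] zero_mem by force
next
  fix u v assume "u \<in> {h + k *\<^sub>R y | h k. h \<in> H \<and> k \<in> A}" "v \<in> {h + k *\<^sub>R y | h k. h \<in> H \<and> k \<in> A}"
  then obtain h k h' k' where "u = h + k *\<^sub>R y" "v = h' + k' *\<^sub>R y" "h \<in> H" "h' \<in> H" "k \<in> A" "k' \<in> A"
    by blast
  then show "u + v \<in> {h + k *\<^sub>R y | h k. h \<in> H \<and> k \<in> A}"
    using submodule_over_add[OF assms] add_mem
    by (auto intro!: exI[of _ "h + h'"] exI[of _ "k + k'"] simp: algebra_simps)
next
  fix a u assume "a \<in> A" "u \<in> {h + k *\<^sub>R y | h k. h \<in> H \<and> k \<in> A}"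
  moreover then obtain h k where "u = h + k *\<^sub>R y" "h \<in> H" "k \<in> A" by blast
  ultimately show "a *\<^sub>R u \<in> {h + k *\<^sub>R y | h k. h \<in> H \<and> k \<in> A}"
    using submodule_over_scale[OF assms] mult_mem
    by (auto intro!: exI[of _ "a *\<^sub>R h"] exI[of _ "a * k"] simp: algebra_simps)
qed

text \<open>Zorn's lemma: a submodule maximal among those containing \<open>H\<close> but not
  \<open>x\<close> is a complement of the line through \<open>x\<close>, and \<open>l\<close> is the
  resulting coordinate along \<open>x\<close>. A real vector space may be infinite-dimensional over
  \<open>A\<close>, so no finite basis is available.\<close>

lemma functional_exists:
  assumes H: "submodule_over A H" and x: "x \<notin> H"
  obtains l :: "'v::real_vector \<Rightarrow> real" where
    "\<And>u v. l (u + v) = l u + l v" "\<And>k u. k \<in> A \<Longrightarrow> l (k *\<^sub>R u) = k * l u"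
    "\<And>u. l u \<in> A" "\<And>h. h \<in> H \<Longrightarrow> l h = 0" "l x = 1"
proof -
  define F where "F = {M. submodule_over A M \<and> H \<subseteq> M \<and> x \<notin> M}"
  have "\<exists>M\<in>F. \<forall>Q\<in>F. M \<subseteq> Q \<longrightarrow> Q = M"
  proof (rule subset_Zorn_nonempty)
    show "F \<noteq> {}" using assms by (auto simp: F_def)
    fix C assume C: "C \<noteq> {}" "subset.chain F C"
    then have CF: "C \<subseteq> F" and ch: "\<And>Q Y. Q \<in> C \<Longrightarrow> Y \<in> C \<Longrightarrow> Q \<subseteq> Y \<or> Y \<subseteq> Q"
      by (auto simp: subset.chain_def)
    have "submodule_over A (\<Union>C)"
      unfolding submodule_over_def
    proof (intro conjI ballI)
      show "0 \<in> \<Union>C" using C(1) CF by (auto simp: F_def submodule_over_def)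
      show "u + v \<in> \<Union>C" if uv: "u \<in> \<Union>C" "v \<in> \<Union>C" for u v
      proof -
        obtain Q Y where "Q \<in> C" "Y \<in> C" "u \<in> Q" "v \<in> Y" using uv by blast
        then obtain Z where "Z \<in> C" "u \<in> Z" "v \<in> Z" using ch by blast
        moreover have "submodule_over A Z" using \<open>Z \<in> C\<close> CF by (auto simp: F_def)
        ultimately show ?thesis using submodule_over_add by blast
      qed
      show "k *\<^sub>R u \<in> \<Union>C" if "k \<in> A" "u \<in> \<Union>C" for k u
        using that CF unfolding F_def submodule_over_def by blast
    qed
    then show "\<Union>C \<in> F" using C(1) CF unfolding F_def by blast
  qed
  then obtain M where "M \<in> F" and max: "\<And>Q. Q \<in> F \<Longrightarrow> M \<subseteq> Q \<Longrightarrow> Q = M" by blast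
  then have M: "submodule_over A M" "H \<subseteq> M" "x \<notin> M" by (auto simp: F_def)
  \<comment> \<open>If \<open>u\<close> is outside \<open>M\<close>, adjoining it captures
    \<open>x\<close> by maximality. The coefficient of \<open>u\<close> is nonzero because
    \<open>x\<close> is not in \<open>M\<close>, and it is inverted in the field
    \<open>A\<close>.\<close>
  have ex: "\<exists>k\<in>A. u - k *\<^sub>R x \<in> M" for u
  proof (cases "u \<in> M")
    case True
    then show ?thesis using zero_mem by force
  next
    case False
    let ?Q = "{h + k *\<^sub>R u | h k. h \<in> M \<and> k \<in> A}"
    have "u \<in> ?Q" using submodule_over_0[OF M(1)] one_mem by force
    moreover have "M \<subseteq> ?Q" using zero_mem by force
    ultimately have "?Q \<notin> F" using max[of ?Q] False by blast
    then have "x \<in> ?Q"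
      using submodule_over_add_line[OF M(1), of u] \<open>M \<subseteq> ?Q\<close> M(2) by (auto simp: F_def)
    then obtain h k where hk: "x = h + k *\<^sub>R u" "h \<in> M" "k \<in> A" by blast
    with M have "k \<noteq> 0" by auto
    then have "u - inverse k *\<^sub>R x = (- inverse k) *\<^sub>R h"
      by (simp add: hk(1) scaleR_add_right)
    also have "\<dots> \<in> M" using hk M(1) inverse_mem uminus_mem submodule_over_scale by metis
    finally show ?thesis using hk inverse_mem by blast
  qed
  \<comment> \<open>Two different coefficients would put a nonzero multiple of \<open>x\<close>,
    hence \<open>x\<close> itself, into \<open>M\<close>.\<close>
  have uniq: "k = k'" if "k \<in> A" "k' \<in> A" "u - k *\<^sub>R x \<in> M" "u - k' *\<^sub>R x \<in> M" for u k k'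
  proof (rule ccontr)
    assume "k \<noteq> k'"
    have "inverse (k' - k) *\<^sub>R ((u - k *\<^sub>R x) - (u - k' *\<^sub>R x)) \<in> M"
      using that submodule_over_diff[OF M(1)]
      by (intro submodule_over_scale[OF M(1)] inverse_mem diff_mem) blast+
    also have "inverse (k' - k) *\<^sub>R ((u - k *\<^sub>R x) - (u - k' *\<^sub>R x)) = inverse (k' - k) *\<^sub>R (k' - k) *\<^sub>R x"
      by (simp add: algebra_simps)
    also have "\<dots> = x" using \<open>k \<noteq> k'\<close> by simp
    finally show False using M by simp
  qed
  define l where "l u = (THE k. k \<in> A \<and> u - k *\<^sub>R x \<in> M)" for u
  have lk: "l u = k" if "k \<in> A" "u - k *\<^sub>R x \<in> M" for u k
    unfolding l_def using that uniq by blast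
  have l: "l u \<in> A" "u - l u *\<^sub>R x \<in> M" for u
    using ex[of u] lk by auto
  show ?thesis
  proof
    show "l (u + v) = l u + l v" for u v
      using submodule_over_add[OF M(1) l(2) l(2), of u v] add_mem[OF l(1) l(1)]
      by (intro lk) (auto simp: algebra_simps)
    show "l (k *\<^sub>R u) = k * l u" if "k \<in> A" for k u
      using submodule_over_scale[OF M(1) that l(2), of u] mult_mem[OF that l(1)]
      by (intro lk) (auto simp: algebra_simps)
    show "l h = 0" if "h \<in> H" for h
      using that M(2) zero_mem by (intro lk) auto
    show "l x = 1"
      using one_mem submodule_over_0[OF M(1)] by (intro lk) auto
  qed (rule l(1))
qed

text \<open>A generating subset of least cardinality has no redundant element. This is independence
  over \<open>A\<close> only; real independence needs further input from a lattice.\<close>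

lemma exists_minimal_spanning:
  assumes "finite B"
  obtains B' where "B' \<subseteq> B" "B \<subseteq> span_over A B'" "\<And>b. b \<in> B' \<Longrightarrow> b \<notin> span_over A (B' - {b})"
proof -
  have "\<exists>B'. (B' \<subseteq> B \<and> B \<subseteq> span_over A B') \<and>
      (\<forall>B''. B'' \<subseteq> B \<and> B \<subseteq> span_over A B'' \<longrightarrow> card B' \<le> card B'')"
    by (rule ex_has_least_nat[of "\<lambda>B'. B' \<subseteq> B \<and> B \<subseteq> span_over A B'" B card])
       (simp add: span_over_superset)
  then obtain B' where B': "B' \<subseteq> B \<and> B \<subseteq> span_over A B'"
    and min: "\<forall>B''. B'' \<subseteq> B \<and> B \<subseteq> span_over A B'' \<longrightarrow> card B' \<le> card B''"
    by (elim exE conjE) (rule that, simp_all)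
  have "b \<notin> span_over A (B' - {b})" if b: "b \<in> B'" for b
  proof
    assume "b \<in> span_over A (B' - {b})"
    then have "B' \<subseteq> span_over A (B' - {b})" using span_over_base[of _ "B' - {b}" A] by blast
    then have "span_over A B' \<subseteq> span_over A (B' - {b})"
      by (intro span_over_minimal submodule_over_span_over)
    then have "card B' \<le> card (B' - {b})" using B' min by (metis Diff_subset order_trans)
    moreover have "finite B'" using B' assms by (elim conjE) (rule finite_subset)
    ultimately show False using card_Diff1_less[OF _ b] by simp
  qed
  then show ?thesis using that B' by blast
qed

text \<open>The vectors whose \<open>e\<close>-coordinate lies in \<open>A\<close> form a submodule
  containing \<open>E\<close>.\<close>

lemma representation_mem:
  assumes "independent E" "x \<in> span_over A E"
  shows "representation E x e \<in> A"
proof -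
  let ?S = "{x \<in> span E. representation E x e \<in> A}"
  have "submodule_over A ?S"
    unfolding submodule_over_def
    by (auto simp: real_vector.representation_zero real_vector.representation_add
        real_vector.representation_scale assms(1) zero_mem add_mem mult_mem
        span_zero span_add span_scale)
  moreover have "E \<subseteq> ?S"
    by (auto simp: real_vector.representation_basis assms(1) zero_mem one_mem span_base)
  ultimately show ?thesis using span_over_minimal assms(2) by blast
qed

end

section \<open>The field of fractions and clearing denominators\<close>

context real_ring
begin

lemma fractionsI: "a \<in> A \<Longrightarrow> b \<in> A \<Longrightarrow> b \<noteq> 0 \<Longrightarrow> a / b \<in> fractions A"
  by (auto simp: fractions_def)

lemma subset_fractions: "A \<subseteq> fractions A"
  using fractionsI[OF _ one_mem] by force

lemma real_field_fractions: "real_field (fractions A)"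
proof
  show "0 \<in> fractions A" "1 \<in> fractions A"
    using subset_fractions zero_mem one_mem by auto
next
  fix x y assume "x \<in> fractions A" "y \<in> fractions A"
  then obtain a b c d where *: "x = a / b" "y = c / d" "a \<in> A" "b \<in> A" "b \<noteq> 0" "c \<in> A" "d \<in> A" "d \<noteq> 0"
    by (auto simp: fractions_def)
  have "x + y = (a * d + c * b) / (b * d)" "x * y = (a * c) / (b * d)"
    using * by (auto simp: field_simps)
  then show "x + y \<in> fractions A" "x * y \<in> fractions A"
    using * by (auto simp only: intro!: fractionsI add_mem mult_mem) auto
next
  fix x assume "x \<in> fractions A"
  then obtain a b where *: "x = a / b" "a \<in> A" "b \<in> A" "b \<noteq> 0"
    by (auto simp: fractions_def)
  then show "- x \<in> fractions A" using fractionsI[of "- a" b] uminus_mem by auto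
  show "inverse x \<in> fractions A"
    using * fractionsI[of b a] fractionsI[OF zero_mem one_mem] by (cases "a = 0") auto
qed

text \<open>The product of all denominators works; the induction multiplies the one found so far by
  the next.\<close>

lemma common_denominator:
  assumes "finite I" "\<And>i. i \<in> I \<Longrightarrow> f i \<in> fractions A"
  obtains d where "d \<in> A" "d \<noteq> 0" "\<And>i. i \<in> I \<Longrightarrow> d * f i \<in> A"
proof -
  have "\<exists>d\<in>A. d \<noteq> 0 \<and> (\<forall>i\<in>I. d * f i \<in> A)"
    using assms
  proof (induction I)
    case empty
    then show ?case using one_mem by force
  next
    case (insert i I)
    then obtain d where d: "d \<in> A" "d \<noteq> 0" "\<forall>i\<in>I. d * f i \<in> A" by auto
    obtain a b where ab: "f i = a / b" "a \<in> A" "b \<in> A" "b \<noteq> 0"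
      using insert.prems[of i] by (auto simp: fractions_def)
    have "b * d * f j \<in> A" if "j \<in> insert i I" for j
    proof (cases "j = i")
      case True
      have "b * d * f j = d * a" unfolding True ab(1) using ab(4) by simp
      then show ?thesis using d ab mult_mem by presburger
    next
      case False
      then show ?thesis using that d ab mult_mem[of b "d * f j"] by (simp add: mult.assoc)
    qed
    then show ?case using d ab mult_mem by (intro bexI[of _ "b * d"]) auto
  qed
  then show ?thesis using that by blast
qed

lemma span_over_le_fractions: "span_over A B \<subseteq> span_over (fractions A) B"
  using submodule_over_span_over[of "fractions A" B] subset_fractions
  by (intro span_over_minimal span_over_superset) (auto simp: submodule_over_def)

lemma mem_span_over_fractions:
  assumes "finite B" "x \<in> span_over (fractions A) B"
  obtains d where "d \<in> A" "d \<noteq> 0" "d *\<^sub>R x \<in> span_over A B"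
proof -
  interpret K: real_field "fractions A" by (rule real_field_fractions)
  obtain c where c: "x = (\<Sum>b\<in>B. c b *\<^sub>R b)" "\<forall>b\<in>B. c b \<in> fractions A"
    using assms by (auto simp: K.span_over_finite)
  obtain d where d: "d \<in> A" "d \<noteq> 0" "\<And>b. b \<in> B \<Longrightarrow> d * c b \<in> A"
    using common_denominator[OF assms(1), of c] c(2) by auto
  have "d *\<^sub>R x = (\<Sum>b\<in>B. (d * c b) *\<^sub>R b)" by (simp add: c scaleR_sum_right)
  then have "d *\<^sub>R x \<in> span_over A B"
    using d by (auto simp: span_over_finite[OF assms(1)])
  then show ?thesis using that d by blast
qed

end

section \<open>Lattices\<close>

locale subring_of_reals =
  fixes A :: "real set"
  assumes real_subring: "real_subring A"

sublocale subring_of_reals \<subseteq> real_ring A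
  using real_subring by (rule real_ring_if_subring)

text \<open>The prefix \<open>frac\<close> marks linear algebra over the field of fractions
  \<open>K\<close>.\<close>

sublocale subring_of_reals \<subseteq> frac: real_field "fractions A"
  by (rule real_field_fractions)

section \<open>The tensor product by generators and relations\<close>

lemma tensor_eval_zero: "tensor_eval 0 = 0"
  by (simp add: tensor_eval_def)

lemma tensor_eval_sum: "tensor_eval (sum f I) = (\<Sum>i\<in>I. tensor_eval (f i))"
  by (induction I rule: infinite_finite_induct) (auto simp: tensor_eval_add tensor_eval_zero)

lemma tensor_eval_in_span:
  assumes "c \<in> carrier (tensor_free L)"
  shows "tensor_eval c \<in> span L"
  using assms unfolding tensor_eval_def tensor_free_def
  by (intro span_sum span_scale span_base) auto

lemma tensor_free_sum_frag_of:
  "T \<subseteq> L \<Longrightarrow> (\<Sum>b\<in>T. frag_of (r b, b)) \<in> carrier (tensor_free L)"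
  unfolding tensor_free_def by (intro sum_closed_free_Abelian_group) auto

context subring_of_reals
begin

context
  fixes L :: "'v::real_vector set"
  assumes fg: "fin_gen_submodule A L"
begin

text \<open>Membership in this subgroup means being zero as a tensor.\<close>

abbreviation (input) "rels \<equiv> generate (tensor_free L) (tensor_relations A L)"

lemma comm_group_tensor_free: "comm_group (tensor_free L)"
  unfolding tensor_free_def by (rule abelian_free_Abelian_group)

lemma subgroup_rels: "subgroup rels (tensor_free L)"
  by (intro group.generate_is_subgroup tensor_relations_subset[OF fg real_subring]
      comm_group.axioms(2) comm_group_tensor_free)

lemma rels_zero: "0 \<in> rels"
  and rels_add: "c \<in> rels \<Longrightarrow> d \<in> rels \<Longrightarrow> c + d \<in> rels"
  and rels_uminus: "c \<in> rels \<Longrightarrow> - c \<in> rels"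
proof -
  show "0 \<in> rels"
    using subgroup.one_closed[OF subgroup_rels] by (simp add: tensor_free_def)
  show "c + d \<in> rels" if "c \<in> rels" "d \<in> rels"
    using subgroup.m_closed[OF subgroup_rels that] by (simp add: tensor_free_def)
  show "- c \<in> rels" if c: "c \<in> rels"
    using subgroup.m_inv_closed[OF subgroup_rels c] subgroup.mem_carrier[OF subgroup_rels c]
    by (simp add: tensor_free_def)
qed

lemma rels_diff: "c \<in> rels \<Longrightarrow> d \<in> rels \<Longrightarrow> c - d \<in> rels"
  using rels_add[of c "- d"] rels_uminus[of d] by simp

lemma rels_sum: "(\<And>i. i \<in> I \<Longrightarrow> f i \<in> rels) \<Longrightarrow> sum f I \<in> rels"
  by (induction I rule: infinite_finite_induct) (simp_all add: rels_zero rels_add)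

lemma rels_add_left: "x \<in> L \<Longrightarrow> frag_of (r + r', x) - frag_of (r, x) - frag_of (r', x) \<in> rels"
  and rels_add_right: "x \<in> L \<Longrightarrow> x' \<in> L \<Longrightarrow>
    frag_of (r, x + x') - frag_of (r, x) - frag_of (r, x') \<in> rels"
  and rels_balance: "a \<in> A \<Longrightarrow> x \<in> L \<Longrightarrow> frag_of (r * a, x) - frag_of (r, a *\<^sub>R x) \<in> rels"
  unfolding tensor_relations_def by (blast intro: generate.incl)+

lemma rcos_eq_iff:
  assumes "c \<in> carrier (tensor_free L)" "d \<in> carrier (tensor_free L)"
  shows "rels #>\<^bsub>tensor_free L\<^esub> c = rels #>\<^bsub>tensor_free L\<^esub> d \<longleftrightarrow> c - d \<in> rels"
proof -
  interpret F: comm_group "tensor_free L" by (rule comm_group_tensor_free)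
  have *: "rels #>\<^bsub>tensor_free L\<^esub> c = {n + c | n. n \<in> rels}" for c
    by (auto simp: r_coset_def tensor_free_def)
  show ?thesis
  proof
    assume "rels #>\<^bsub>tensor_free L\<^esub> c = rels #>\<^bsub>tensor_free L\<^esub> d"
    moreover have "c \<in> rels #>\<^bsub>tensor_free L\<^esub> c" using rels_zero unfolding * by force
    ultimately show "c - d \<in> rels" unfolding * by auto
  next
    assume cd: "c - d \<in> rels"
    have "n + c = (n + (c - d)) + d" "n + d = (n - (c - d)) + c" for n by simp_all
    then show "rels #>\<^bsub>tensor_free L\<^esub> c = rels #>\<^bsub>tensor_free L\<^esub> d"
      unfolding * using rels_add[OF _ cd] rels_diff[OF _ cd] by blast
  qed
qed

lemma natural_map_hom: "natural_map \<in> hom (tensor_product A L) additive_group"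
proof -
  interpret F: comm_group "tensor_free L" by (rule comm_group_tensor_free)
  interpret N: normal rels "tensor_free L"
    by (rule F.subgroup_imp_normal[OF subgroup_rels])
  show ?thesis
    by (rule homI)
       (auto simp: tensor_product_def additive_group_def FactGroup_def RCOSETS_def N.rcos_sum
         natural_map_coset[OF fg real_subring],
        simp add: tensor_free_def tensor_eval_add)
qed

text \<open>The image of the natural map is the real span of \<open>L\<close>, and its injectivity
  says that every formal sum evaluating to 0 already follows from the relations.\<close>

lemma A_lattice_iff:
  "A_lattice A L \<longleftrightarrow> span L = UNIV \<and>
    (\<forall>c\<in>carrier (tensor_free L). tensor_eval c = 0 \<longrightarrow> c \<in> rels)"
proof -
  interpret F: comm_group "tensor_free L" by (rule comm_group_tensor_free)
  have car: "carrier (tensor_product A L) = (\<lambda>c. rels #>\<^bsub>tensor_free L\<^esub> c) ` carrier (tensor_free L)"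
    by (auto simp: tensor_product_def FactGroup_def RCOSETS_def)
  have nm: "natural_map (rels #>\<^bsub>tensor_free L\<^esub> c) = tensor_eval c" for c
    by (rule natural_map_coset[OF fg real_subring])
  have "inj_on natural_map (carrier (tensor_product A L)) \<longleftrightarrow>
      (\<forall>c\<in>carrier (tensor_free L). \<forall>d\<in>carrier (tensor_free L).
         tensor_eval c = tensor_eval d \<longrightarrow> c - d \<in> rels)"
    unfolding car inj_on_def by (simp add: nm rcos_eq_iff)
  also have "\<dots> \<longleftrightarrow> (\<forall>c\<in>carrier (tensor_free L). tensor_eval c = 0 \<longrightarrow> c \<in> rels)"
  proof safe
    fix c assume *: "\<forall>c\<in>carrier (tensor_free L). \<forall>d\<in>carrier (tensor_free L).
         tensor_eval c = tensor_eval d \<longrightarrow> c - d \<in> rels"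
      "c \<in> carrier (tensor_free L)" "tensor_eval c = 0"
    moreover have "0 \<in> carrier (tensor_free L)" by (simp add: tensor_free_def)
    ultimately show "c \<in> rels" using tensor_eval_zero by (metis diff_zero)
  next
    fix c d assume *: "\<forall>c\<in>carrier (tensor_free L). tensor_eval c = 0 \<longrightarrow> c \<in> rels"
      "c \<in> carrier (tensor_free L)" "d \<in> carrier (tensor_free L)" "tensor_eval c = tensor_eval d"
    then have "c - d \<in> carrier (tensor_free L)"
      using keys_diff[of c d] by (auto simp: tensor_free_def)
    then show "c - d \<in> rels" using * by (simp add: tensor_eval_diff)
  qed
  finally have inj: "inj_on natural_map (carrier (tensor_product A L)) \<longleftrightarrow>
      (\<forall>c\<in>carrier (tensor_free L). tensor_eval c = 0 \<longrightarrow> c \<in> rels)" .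
  have "natural_map ` carrier (tensor_product A L) = tensor_eval ` carrier (tensor_free L)"
    unfolding car by (simp add: image_image nm)
  also have "\<dots> = span L"
  proof
    show "span L \<subseteq> tensor_eval ` carrier (tensor_free L)"
    proof
      fix x assume "x \<in> span L"
      then obtain T r where "T \<subseteq> L" "x = (\<Sum>b\<in>T. r b *\<^sub>R b)"
        unfolding span_explicit by blast
      then have "x = tensor_eval (\<Sum>b\<in>T. frag_of (r b, b))"
        by (simp add: tensor_eval_sum tensor_eval_frag_of)
      then show "x \<in> tensor_eval ` carrier (tensor_free L)"
        using tensor_free_sum_frag_of[OF \<open>T \<subseteq> L\<close>] by blast
    qed
  qed (use tensor_eval_in_span in auto)
  finally show ?thesis
    using inj natural_map_hom fg
    by (auto simp: A_lattice_def iso_def bij_betw_def additive_group_def)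
qed

text \<open>The map \<open>r \<otimes> x \<mapsto> r * l x\<close> is well defined on the tensor
  product: \<open>frag_extend\<close> applies \<open>l\<close> to the second components, and
  evaluation in the reals multiplies. So tensors can be tested with functionals that are linear over
  \<open>A\<close> only.\<close>

lemma rels_functional:
  fixes l :: "'v \<Rightarrow> real"
  assumes l: "\<And>u v. l (u + v) = l u + l v" "\<And>k u. k \<in> A \<Longrightarrow> l (k *\<^sub>R u) = k * l u"
    and c: "c \<in> rels"
  shows "tensor_eval (frag_extend (\<lambda>p. frag_of (fst p, l (snd p))) c) = 0"
proof -
  have rel: "tensor_eval (frag_extend (\<lambda>p. frag_of (fst p, l (snd p))) h) = 0"
    if "h \<in> tensor_relations A L" for h
    using that unfolding tensor_relations_def
    by (auto simp: frag_extend_diff tensor_eval_diff tensor_eval_frag_of l distrib_left distrib_right)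
  show ?thesis
    using c
  proof (induction rule: generate.induct)
    case one
    then show ?case by (simp add: tensor_free_def tensor_eval_zero)
  next
    case (incl h)
    then show ?case by (rule rel)
  next
    case (inv h)
    then have "h \<in> carrier (tensor_free L)"
      using tensor_relations_subset[OF fg real_subring] by blast
    then have "inv\<^bsub>tensor_free L\<^esub> h = - h" by (simp add: tensor_free_def)
    then show ?case using rel[OF inv] by (simp add: frag_extend_minus tensor_eval_uminus)
  next
    case (eng h1 h2)
    then show ?case by (simp add: tensor_free_def frag_extend_add tensor_eval_add)
  qed
qed

text \<open>A real relation among the elements of \<open>T\<close> is a tensor evaluating to 0,
  hence zero in the tensor product of a lattice. Testing it with a \<open>K\<close>-linear
  coordinate functional isolates each real coefficient.\<close>

lemma A_lattice_independent:
  assumes L: "A_lattice A L" and T: "finite T" "T \<subseteq> L"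
    and ind: "\<And>b. b \<in> T \<Longrightarrow> b \<notin> span_over (fractions A) (T - {b})"
  shows "independent T"
  unfolding independent_explicit_finite_subsets
proof (intro allI impI ballI)
  fix S r b0 assume S: "S \<subseteq> T" "finite S" and r: "(\<Sum>b\<in>S. r b *\<^sub>R b) = 0" and b0: "b0 \<in> S"
  let ?c = "\<Sum>b\<in>S. frag_of (r b, b)"
  have "tensor_eval ?c = 0"
    by (simp add: tensor_eval_sum tensor_eval_frag_of r)
  moreover have "?c \<in> carrier (tensor_free L)"
    using S T by (intro tensor_free_sum_frag_of) auto
  ultimately have c: "?c \<in> rels" using L A_lattice_iff by blast
  have "b0 \<in> T" using S b0 by blast
  \<comment> \<open>The coordinate at \<open>b0\<close>: it is 1 there and vanishes on the rest of
    \<open>T\<close>.\<close>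
  obtain l where l: "\<And>u v. l (u + v) = l u + l v" "\<And>k u. k \<in> fractions A \<Longrightarrow> l (k *\<^sub>R u) = k * l u"
    and l0: "\<And>h. h \<in> span_over (fractions A) (T - {b0}) \<Longrightarrow> l h = 0" "l b0 = 1"
    by (rule frac.functional_exists[OF submodule_over_span_over ind[OF \<open>b0 \<in> T\<close>]])
       (rule that; (assumption | blast))
  have "0 = tensor_eval (frag_extend (\<lambda>p. frag_of (fst p, l (snd p))) ?c)"
    using rels_functional[OF l(1) l(2) c] subset_fractions by auto
  also have "\<dots> = (\<Sum>b\<in>S. r b * l b)"
    using S by (simp add: frag_extend_sum tensor_eval_sum tensor_eval_frag_of)
  also have "\<dots> = (\<Sum>b\<in>S. if b = b0 then r b0 else 0)"
    using S l0 by (intro sum.cong) (auto intro!: l0(1) span_over_base)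
  also have "\<dots> = r b0" using S b0 by simp
  finally show "r b0 = 0" by simp
qed

text \<open>Generators of \<open>L\<close>, thinned out until none lies in the \<open>K\<close>-span
  of the others, are independent over the reals because \<open>L\<close> is a lattice.\<close>

lemma A_lattice_basis:
  assumes L: "A_lattice A L"
  obtains E where "E \<subseteq> L" "finite E" "independent E" "span E = UNIV"
    "L \<subseteq> span_over (fractions A) E"
proof -
  obtain B where B: "finite B" "L = span_over A B" using fg fin_gen_submodule_iff by blast
  obtain E where E: "E \<subseteq> B" "B \<subseteq> span_over (fractions A) E"
    "\<And>b. b \<in> E \<Longrightarrow> b \<notin> span_over (fractions A) (E - {b})"
    by (rule frac.exists_minimal_spanning[OF B(1)]) (rule that; (assumption | blast))
  have EL: "E \<subseteq> L" using order_trans[OF E(1) span_over_superset] unfolding B(2) .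
  have LE: "L \<subseteq> span_over (fractions A) E"
    using span_over_le_fractions[of B] span_over_minimal[OF submodule_over_span_over E(2)] B(2) by auto
  have "span L \<subseteq> span E"
    by (metis LE span_mono span_span_over)
  then have "span E = UNIV" using L A_lattice_iff by auto
  then show ?thesis
    using that[OF EL _ _ _ LE] A_lattice_independent[OF L _ EL E(3)] finite_subset[OF E(1) B(1)] by blast
qed

text \<open>A separating family of real functionals with values in \<open>K\<close> on
  \<open>L\<close> forces generators that are minimal over \<open>K\<close> to be independent over
  the reals. Every tensor is a real combination of these generators, so the natural map is
  injective.\<close>

lemma A_latticeI:
  fixes f :: "'i \<Rightarrow> 'v \<Rightarrow> real"
  assumes span: "span L = UNIV"
    and f: "\<And>i. i \<in> I \<Longrightarrow> linear (f i)" "\<And>i x. i \<in> I \<Longrightarrow> x \<in> L \<Longrightarrow> f i x \<in> fractions A"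
    and inj: "\<And>x. (\<And>i. i \<in> I \<Longrightarrow> f i x = 0) \<Longrightarrow> x = 0"
  shows "A_lattice A L"
proof -
  obtain B where B: "finite B" "L = span_over A B" using fg fin_gen_submodule_iff by blast
  obtain E where E: "E \<subseteq> B" "B \<subseteq> span_over (fractions A) E"
    "\<And>b. b \<in> E \<Longrightarrow> b \<notin> span_over (fractions A) (E - {b})"
    by (rule frac.exists_minimal_spanning[OF B(1)]) (rule that; (assumption | blast))
  have fE: "finite E" using E(1) B(1) finite_subset by blast
  have EL: "E \<subseteq> L" using order_trans[OF E(1) span_over_superset] unfolding B(2) .
  have LE: "L \<subseteq> span_over (fractions A) E"
    using span_over_le_fractions[of B] span_over_minimal[OF submodule_over_span_over E(2)] B(2) by auto
  have subL: "submodule_over A L" using B submodule_over_span_over by blast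
  \<comment> \<open>Real independence of \<open>E\<close>: a \<open>K\<close>-linear map
    \<open>l\<close> from the reals to \<open>K\<close> turns a real relation into one over
    \<open>K\<close> with coefficient 1 at \<open>b0\<close>, contradicting minimality.\<close>
  have ind: "r b0 = 0" if r: "(\<Sum>b\<in>E. r b *\<^sub>R b) = 0" and b0: "b0 \<in> E" for r b0
  proof (rule ccontr)
    assume "r b0 \<noteq> 0"
    then obtain l :: "real \<Rightarrow> real" where l: "\<And>u v. l (u + v) = l u + l v"
      "\<And>k u. k \<in> fractions A \<Longrightarrow> l (k *\<^sub>R u) = k * l u" "\<And>u. l u \<in> fractions A" "l (r b0) = 1"
      using frac.functional_exists[OF submodule_over_zero, of "r b0"] by (metis singletonD)
    have l0: "l 0 = 0" using l(1)[of 0 0] by simp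
    have lsum: "l (sum g S) = (\<Sum>s\<in>S. l (g s))" for g and S :: "'v set"
      by (induction S rule: infinite_finite_induct) (auto simp: l0 l(1))
    \<comment> \<open>The values \<open>f i b\<close> lie in \<open>K\<close>, so \<open>l\<close>
      can be pulled out of the sum, which leaves \<open>l\<close> of the original relation.\<close>
    have "f i (\<Sum>b\<in>E. l (r b) *\<^sub>R b) = 0" if i: "i \<in> I" for i
    proof -
      have "f i (\<Sum>b\<in>E. l (r b) *\<^sub>R b) = (\<Sum>b\<in>E. f i b * l (r b))"
        by (simp add: linear_sum[OF f(1)[OF i]] linear_scale[OF f(1)[OF i]] mult.commute)
      also have "\<dots> = l (\<Sum>b\<in>E. f i b * r b)"
        unfolding lsum using l(2)[OF f(2)[OF i]] EL by (intro sum.cong) auto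
      also have "(\<Sum>b\<in>E. f i b * r b) = f i (\<Sum>b\<in>E. r b *\<^sub>R b)"
        by (simp add: linear_sum[OF f(1)[OF i]] linear_scale[OF f(1)[OF i]] mult.commute)
      finally show ?thesis by (simp add: r l0 linear_0[OF f(1)[OF i]])
    qed
    then have "(\<Sum>b\<in>E. l (r b) *\<^sub>R b) = 0" by (rule inj)
    then have "b0 + (\<Sum>b\<in>E - {b0}. l (r b) *\<^sub>R b) = 0"
      using sum.remove[OF fE b0, of "\<lambda>b. l (r b) *\<^sub>R b"] l(4) by simp
    then have "b0 = - (\<Sum>b\<in>E - {b0}. l (r b) *\<^sub>R b)" by (rule eq_neg_iff_add_eq_0[THEN iffD2])
    also have "\<dots> \<in> span_over (fractions A) (E - {b0})"
      by (intro frac.submodule_over_uminus[OF submodule_over_span_over]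
          submodule_over_sum[OF submodule_over_span_over]
          submodule_over_scale[OF submodule_over_span_over] span_over_base l(3))
    finally show False using E(3)[OF b0] by simp
  qed
  \<comment> \<open>The second component is expanded and its coefficients from \<open>A\<close> are
    moved to the left factor.\<close>
  have frag_sum: "frag_of (r, \<Sum>b\<in>S. c b *\<^sub>R b) - (\<Sum>b\<in>S. frag_of (r * c b, b)) \<in> rels"
    if "finite S" "S \<subseteq> L" "\<forall>b\<in>S. c b \<in> A" for r c S
    using that
  proof (induction S)
    case empty
    \<comment> \<open>The tensor \<open>r \<otimes> 0\<close> vanishes, by additivity for
      \<open>0 + 0\<close>.\<close>
    have "- (frag_of (r, 0 + 0) - frag_of (r, 0) - frag_of (r, 0)) \<in> rels"
      using submodule_over_0[OF subL] by (intro rels_uminus rels_add_right) auto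
    then show ?case by simp
  next
    case (insert b S)
    let ?s = "\<Sum>b\<in>S. c b *\<^sub>R b"
    have s: "?s \<in> L" "c b *\<^sub>R b \<in> L"
      using insert.prems by (auto intro!: submodule_over_sum[OF subL] submodule_over_scale[OF subL])
    have "frag_of (r, ?s) - (\<Sum>b\<in>S. frag_of (r * c b, b)) \<in> rels"
      using insert by simp
    note * = rels_diff[OF rels_add[OF rels_add_right[OF s(2,1)] this] rels_balance]
    have "(frag_of (r, c b *\<^sub>R b + ?s) - frag_of (r, c b *\<^sub>R b) - frag_of (r, ?s))
        + (frag_of (r, ?s) - (\<Sum>b\<in>S. frag_of (r * c b, b)))
        - (frag_of (r * c b, b) - frag_of (r, c b *\<^sub>R b)) \<in> rels"
      by (rule *) (use insert.prems in auto)
    then show ?case using insert.hyps by (simp add: algebra_simps)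
  qed
  \<comment> \<open>Normal form: modulo the relations every formal sum becomes a sum over
    \<open>E\<close> with real coefficients.\<close>
  have red: "\<exists>\<rho>. c - (\<Sum>b\<in>E. frag_of (\<rho> b, b)) \<in> rels" if "Poly_Mapping.keys c \<subseteq> UNIV \<times> L" for c
    using that
  proof (induction c rule: frag_induction)
    case zero
    have "- (frag_of (0 + 0, b) - frag_of (0, b) - frag_of (0, b)) \<in> rels" if "b \<in> E" for b
      using that EL by (intro rels_uminus rels_add_left) auto
    then have "- (\<Sum>b\<in>E. frag_of (0, b)) \<in> rels"
      by (intro rels_uminus rels_sum) auto
    then show ?case by (auto intro!: exI[of _ "\<lambda>_. 0"])
  next
    case (one p)
    then obtain r x where p: "p = (r, x)" "x \<in> L" by auto
    obtain d where d: "d \<in> A" "d \<noteq> 0" "d *\<^sub>R x \<in> span_over A E"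
      using mem_span_over_fractions[OF fE] p(2) LE by blast
    obtain c where c: "\<forall>b\<in>E. c b \<in> A" "d *\<^sub>R x = (\<Sum>b\<in>E. c b *\<^sub>R b)"
      using d(3) span_over_finite[OF fE] by auto
    \<comment> \<open>Dividing the left factor by the denominator \<open>d\<close> compensates for
      replacing \<open>x\<close> by its multiple in the \<open>A\<close>-span of
      \<open>E\<close>.\<close>
    have "(frag_of (r / d * d, x) - frag_of (r / d, d *\<^sub>R x))
       + (frag_of (r / d, \<Sum>b\<in>E. c b *\<^sub>R b) - (\<Sum>b\<in>E. frag_of (r / d * c b, b))) \<in> rels"
      using d p by (intro rels_add rels_balance frag_sum fE EL c)
    then have "frag_of p - (\<Sum>b\<in>E. frag_of (r / d * c b, b)) \<in> rels"
      using d by (simp add: c(2)[symmetric] p)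
    then show ?case by (rule exI[of _ "\<lambda>b. r / d * c b"])
  next
    case (diff c d)
    then obtain \<rho> \<rho>' where \<rho>: "c - (\<Sum>b\<in>E. frag_of (\<rho> b, b)) \<in> rels"
      "d - (\<Sum>b\<in>E. frag_of (\<rho>' b, b)) \<in> rels" by blast
    have "(\<Sum>b\<in>E. frag_of ((\<rho> b - \<rho>' b) + \<rho>' b, b) - frag_of (\<rho> b - \<rho>' b, b) - frag_of (\<rho>' b, b)) \<in> rels"
      using EL by (intro rels_sum rels_add_left) auto
    then have "((\<Sum>b\<in>E. frag_of (\<rho> b, b)) - (\<Sum>b\<in>E. frag_of (\<rho> b - \<rho>' b, b)) - (\<Sum>b\<in>E. frag_of (\<rho>' b, b))) \<in> rels"
      by (simp add: sum_subtractf)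
    from rels_add[OF rels_diff[OF \<rho>] this]
    have "c - d - (\<Sum>b\<in>E. frag_of (\<rho> b - \<rho>' b, b)) \<in> rels" by (simp add: algebra_simps)
    then show ?case by (rule exI[of _ "\<lambda>b. \<rho> b - \<rho>' b"])
  qed
  have "c \<in> rels" if c: "c \<in> carrier (tensor_free L)" "tensor_eval c = 0" for c
  proof -
    obtain \<rho> where \<rho>: "c - (\<Sum>b\<in>E. frag_of (\<rho> b, b)) \<in> rels"
      using red[of c] c by (auto simp: tensor_free_def)
    have ev: "tensor_eval d = 0" if "d \<in> rels" for d
    proof -
      have "rels #>\<^bsub>tensor_free L\<^esub> d = rels #>\<^bsub>tensor_free L\<^esub> 0"
        using subgroup.mem_carrier[OF subgroup_rels that] that
        by (subst rcos_eq_iff) (auto simp: tensor_free_def)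
      then show ?thesis
        using natural_map_coset[OF fg real_subring, of d] natural_map_coset[OF fg real_subring, of 0]
        by (simp add: tensor_eval_zero)
    qed
    \<comment> \<open>Evaluation to 0 and real independence of \<open>E\<close> kill all
      coefficients of the normal form.\<close>
    have "(\<Sum>b\<in>E. \<rho> b *\<^sub>R b) = 0"
      using ev[OF \<rho>] c by (simp add: tensor_eval_diff tensor_eval_sum tensor_eval_frag_of)
    then have "\<forall>b\<in>E. \<rho> b = 0" using ind by blast
    then have "(\<Sum>b\<in>E. frag_of (\<rho> b, b)) = (\<Sum>b\<in>E. frag_of (0, b))" by simp
    moreover have "(\<Sum>b\<in>E. frag_of (0, b)) \<in> rels"
    proof (rule rels_sum)
      fix b assume "b \<in> E"
      then have "- (frag_of (0 + 0, b) - frag_of (0, b) - frag_of (0, b)) \<in> rels"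
        using EL by (intro rels_uminus rels_add_left) auto
      then show "frag_of (0, b) \<in> rels" by simp
    qed
    ultimately show ?thesis using rels_add[OF \<rho>] by fastforce
  qed
  then show ?thesis using A_lattice_iff span by blast
qed

end

end

section \<open>Integrality of cyclic products\<close>

text \<open>The ideals generated by the first \<open>n\<close> of the elements \<open>q\<close>,
  \<open>q c\<close>, \<open>q c^2\<close>, ... form a chain, which becomes stationary in a
  Noetherian ring. Dividing the resulting expression of \<open>q c^n\<close> by \<open>q\<close>
  gives a monic equation for \<open>c\<close>.\<close>

lemma (in subring_of_reals) completely_integrally_closed:
  assumes noeth: "noetherian_subring A" and ic: "integrally_closed A"
    and q: "q \<noteq> 0" "\<And>m. q * c ^ m \<in> A"
  shows "c \<in> A"
proof -
  let ?R = "ring_of_type_algebra\<lparr>carrier := A\<rparr>"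
  interpret R: noetherian_ring ?R
    using noeth by (simp add: noetherian_subring_def)
  define J where "J n = {\<Sum>i<n. a i * (q * c ^ i) | a. \<forall>i. a i \<in> A}" for n :: nat
  have JA: "J n \<subseteq> A" for n
    by (auto simp: J_def intro!: sum_mem mult_mem q(2))
  have J0: "0 \<in> J n" for n
    by (auto simp: J_def zero_mem intro!: exI[of _ "\<lambda>_. 0"])
  have Jadd: "x + y \<in> J n" if xy: "x \<in> J n" "y \<in> J n" for x y n
  proof -
    obtain a b where "\<forall>i. a i \<in> A" "x = (\<Sum>i<n. a i * (q * c ^ i))"
      "\<forall>i. b i \<in> A" "y = (\<Sum>i<n. b i * (q * c ^ i))"
      using xy unfolding J_def by blast
    then show ?thesis unfolding J_def
      by (auto intro!: exI[of _ "\<lambda>i. a i + b i"] simp: add_mem distrib_right sum.distrib)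
  qed
  have Jmult: "r * x \<in> J n" if r: "r \<in> A" and x: "x \<in> J n" for r x n
  proof -
    obtain a where "\<forall>i. a i \<in> A" "x = (\<Sum>i<n. a i * (q * c ^ i))"
      using x unfolding J_def by blast
    then show ?thesis unfolding J_def
      by (auto intro!: exI[of _ "\<lambda>i. r * a i"] simp: r mult_mem sum_distrib_left mult.assoc)
  qed
  have mem: "q * c ^ i \<in> J n" if "i < n" for i n
  proof -
    have "(\<Sum>j<n. (if j = i then 1 else 0) * (q * c ^ j)) = (\<Sum>j<n. if j = i then q * c ^ j else 0)"
      by (rule sum.cong) auto
    also have "\<dots> = q * c ^ i" using that by simp
    finally have "q * c ^ i = (\<Sum>j<n. (if j = i then 1 else 0) * (q * c ^ j))" ..
    moreover have "\<forall>j. (if j = i then 1 else 0) \<in> A" by (simp add: zero_mem one_mem)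
    ultimately show ?thesis unfolding J_def by (intro CollectI exI conjI)
  qed
  have mono: "J m \<subseteq> J n" if "m \<le> n" for m n
  proof
    fix x assume "x \<in> J m"
    then obtain a where a: "\<forall>i. a i \<in> A" "x = (\<Sum>i<m. a i * (q * c ^ i))"
      unfolding J_def by blast
    have "x = (\<Sum>i<n. (if i < m then a i else 0) * (q * c ^ i))"
      unfolding a(2) using that by (intro sum.mono_neutral_cong_left) auto
    moreover have "\<forall>i. (if i < m then a i else 0) \<in> A" using a(1) zero_mem by simp
    ultimately show "x \<in> J n" unfolding J_def by (intro CollectI exI conjI)
  qed
  have ideal: "ideal (J n) ?R" for n
  proof (rule idealI)
    show "ring ?R" by (rule R.ring_axioms)
    show "subgroup (J n) (add_monoid ?R)"
    proof (rule group.subgroupI)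
      show "group (add_monoid ?R)" by (rule R.add.is_group)
      show "J n \<subseteq> carrier (add_monoid ?R)" using JA by simp
      show "J n \<noteq> {}" using J0 by auto
      show "a \<otimes>\<^bsub>add_monoid ?R\<^esub> b \<in> J n" if "a \<in> J n" "b \<in> J n" for a b
        using Jadd[OF that] by (simp add: ring_of_type_algebra_def)
      show "inv\<^bsub>add_monoid ?R\<^esub> a \<in> J n" if a: "a \<in> J n" for a
      proof -
        have "- a \<in> J n" using Jmult[OF uminus_mem[OF one_mem] a] by simp
        moreover have "inv\<^bsub>add_monoid ?R\<^esub> a = - a"
          using JA a uminus_mem
          by (intro group.inv_equality R.add.is_group) (auto simp: ring_of_type_algebra_def)
        ultimately show ?thesis by simp
      qed
    qed
    show "r \<otimes>\<^bsub>?R\<^esub> a \<in> J n" "a \<otimes>\<^bsub>?R\<^esub> r \<in> J n" if "a \<in> J n" "r \<in> carrier ?R" for a r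
      using Jmult[of r a n] that by (simp_all add: ring_of_type_algebra_def mult.commute)
  qed
  have "J m \<subseteq> J n \<or> J n \<subseteq> J m" for m n
    using mono linorder_linear[of m n] by blast
  then have "subset.chain {I. ideal I ?R} (range J)"
    by (auto simp only: subset.chain_def ideal)
  \<comment> \<open>The chain contains its own union, so some \<open>J n\<close> contains all the
    others, in particular the next one.\<close>
  then have "\<Union>(range J) \<in> range J"
    by (intro R.ideal_chain_is_trivial) simp_all
  then obtain n where "J (Suc n) \<subseteq> J n" by blast
  then obtain a where a: "\<forall>i. a i \<in> A" "q * c ^ n = (\<Sum>i<n. a i * (q * c ^ i))"
    using mem[of n "Suc n"] unfolding J_def by blast
  have "q * c ^ n = q * (\<Sum>i<n. a i * c ^ i)"
    unfolding a(2) by (simp add: sum_distrib_left mult.left_commute)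
  then have cn: "c ^ n = (\<Sum>i<n. a i * c ^ i)" using q(1) by simp
  define p where "p = monom 1 n - (\<Sum>i<n. monom (a i) i)"
  have coeff: "poly.coeff p k = (if k = n then 1 else if k < n then - a k else 0)" for k
    by (auto simp: p_def coeff_sum coeff_diff)
  have "degree p = n"
    by (intro antisym degree_le le_degree) (auto simp: coeff)
  then have "lead_coeff p = 1" by (simp add: coeff)
  moreover have "\<forall>i. poly.coeff p i \<in> A"
    using a(1) by (auto simp: coeff zero_mem one_mem uminus_mem)
  moreover have "poly p c = 0"
    by (simp add: p_def poly_monom poly_sum cn)
  ultimately have "integral_over A c" by (auto simp: integral_over_def)
  \<comment> \<open>Integral closedness concerns fractions only; the exponents 1 and 0 exhibit
    \<open>c\<close> as one.\<close>
  moreover have "c = (q * c ^ 1) / (q * c ^ 0)" using q(1) by simp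
  ultimately show ?thesis
    using ic q(1) q(2)[of 1] q(2)[of 0] unfolding integrally_closed_def by (metis mult_cancel_left2 power_0)
qed

text \<open>A common denominator for the values on finitely many generators serves for all of
  \<open>L\<close>.\<close>

lemma (in subring_of_reals) A_lattice_coordinates:
  fixes L :: "'v::real_vector set"
  assumes "A_lattice A L" "linear g" "\<And>x. x \<in> L \<Longrightarrow> g x \<in> fractions A"
  obtains d where "d \<in> A" "d \<noteq> 0" "\<And>x. x \<in> L \<Longrightarrow> d * g x \<in> A"
proof -
  obtain B where B: "finite B" "L = span_over A B"
    using assms(1) fin_gen_submodule_iff by (auto simp: A_lattice_def)
  obtain d where d: "d \<in> A" "d \<noteq> 0" "\<And>b. b \<in> B \<Longrightarrow> d * g b \<in> A"
    using common_denominator[OF B(1), of g] assms(3) B(2) span_over_base by metis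
  have "submodule_over A {x. d * g x \<in> A}"
    using assms(2) by (auto simp: submodule_over_def linear_0 linear_add linear_scale zero_mem
        add_mem distrib_left mult_mem mult.left_commute)
  then have "L \<subseteq> {x. d * g x \<in> A}"
    unfolding B(2) by (rule span_over_minimal) (use d in auto)
  then show ?thesis using that d by blast
qed

lemma linear_representation:
  assumes "independent E" "span E = UNIV"
  shows "linear (\<lambda>x. representation E x e)"
  by (rule linearI)
     (simp_all add: real_vector.representation_add real_vector.representation_scale assms)

text \<open>If \<open>u = f u0 *\<^sub>R w\<close> then \<open>f w\<close> is an eigenvalue for \<open>u\<close> of the rank one map \<open>x \<mapsto> f x *\<^sub>R w\<close>.\<close>

lemma (in subring_of_reals) rank_one_trace_mem:
  fixes L :: "'v::real_vector set"
  assumes noeth: "noetherian_subring A" and ic: "integrally_closed A"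
    and L: "A_lattice A L" and f: "linear f" "\<And>x. x \<in> L \<Longrightarrow> f x *\<^sub>R w \<in> L"
  shows "f w \<in> A"
\<comment> \<open>In the degenerate case either \<open>w\<close> is zero or \<open>f\<close>
  vanishes on the spanning set \<open>L\<close>, so \<open>f w = 0\<close>.\<close>
proof (cases "w = 0 \<or> (\<forall>x\<in>L. f x = 0)")
  case True
  have fg: "fin_gen_submodule A L" using L by (simp add: A_lattice_def)
  have "f w = 0"
  proof (cases "w = 0")
    case False
    then have "\<forall>x\<in>L. f x = 0" using True by blast
    moreover have "w \<in> span L" using L A_lattice_iff[OF fg] by auto
    ultimately show ?thesis using linear_eq_0_on_span[OF f(1)] by blast
  qed (use f(1) linear_0 in blast)
  then show ?thesis using zero_mem by simp
next
  case False
  then obtain u0 where u0: "u0 \<in> L" "f u0 \<noteq> 0" "w \<noteq> 0" by blast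
  have fg: "fin_gen_submodule A L" using L by (simp add: A_lattice_def)
  define u where "u = f u0 *\<^sub>R w"
  have u: "u \<noteq> 0" using u0 by (simp add: u_def)
  \<comment> \<open>Each application of the rank one map multiplies \<open>u\<close> by
    \<open>f w\<close> without leaving \<open>L\<close>.\<close>
  have pow: "(f w ^ m) *\<^sub>R u \<in> L" for m
  proof (induction m)
    case 0
    then show ?case using f(2)[OF u0(1)] by (simp add: u_def)
  next
    case (Suc m)
    from f(2)[OF this] show ?case
      by (simp add: u_def linear_scale[OF f(1)] mult_ac)
  qed
  obtain E where E: "E \<subseteq> L" "finite E" "independent E" "span E = UNIV"
    "L \<subseteq> span_over (fractions A) E"
    by (rule A_lattice_basis[OF fg L]) (rule that; assumption)
  \<comment> \<open>A nonzero coordinate of \<open>u\<close>, times a denominator \<open>d\<close>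
    for this coordinate on \<open>L\<close>, is the \<open>q\<close> whose products with all powers
    of \<open>f w\<close> lie in \<open>A\<close>.\<close>
  have "\<exists>e\<in>E. representation E u e \<noteq> 0"
  proof (rule ccontr)
    assume "\<not> ?thesis"
    then have "(\<Sum>e\<in>E. representation E u e *\<^sub>R e) = 0" by simp
    then show False
      using real_vector.sum_representation_eq[OF E(3), of u E] E(2,4) u by simp
  qed
  then obtain e where e: "representation E u e \<noteq> 0" by blast
  have lin: "linear (\<lambda>x. representation E x e)" using E linear_representation by blast
  obtain d where d: "d \<in> A" "d \<noteq> 0" "\<And>x. x \<in> L \<Longrightarrow> d * representation E x e \<in> A"
    using A_lattice_coordinates[OF L lin] frac.representation_mem[OF E(3)] E(5) by blast
  show ?thesis
  proof (rule completely_integrally_closed[OF noeth ic])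
    show "d * representation E u e \<noteq> 0" using d e by simp
    show "d * representation E u e * f w ^ m \<in> A" for m
      using d(3)[OF pow[of m]] linear_scale[OF lin, of "f w ^ m" u] by (simp add: mult_ac)
  qed
qed

section \<open>Products along walks and the splitting of closed walks\<close>

fun walk :: "('i \<Rightarrow> 'i \<Rightarrow> real) \<Rightarrow> 'i list \<Rightarrow> real" where
  "walk c (i # j # js) = c i j * walk c (j # js)"
| "walk c _ = 1"

lemma walk_append: "walk c (xs @ y # zs) = walk c (xs @ [y]) * walk c (y # zs)"
proof (induction xs)
  case (Cons x xs)
  then show ?case by (cases xs) (simp_all add: mult.assoc)
qed simp

lemma walk_conv_prod: "walk c is = (\<Prod>j<length is - 1. c (is ! j) (is ! Suc j))"
proof (induction c "is" rule: walk.induct)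
  case (1 c i j js)
  then show ?case by (simp add: prod.lessThan_Suc_shift del: prod.lessThan_Suc)
qed simp_all

lemma cyclic_product_eq_walk:
  assumes "is \<noteq> []"
  shows "cyclic_product c is = walk c (is @ [hd is])"
  unfolding cyclic_product_def walk_conv_prod
proof (rule prod.cong)
  fix j assume "j \<in> {..<length (is @ [hd is]) - 1}"
  then have j: "j < length is" by simp
  show "c (is ! j) (is ! (Suc j mod length is)) = c ((is @ [hd is]) ! j) ((is @ [hd is]) ! Suc j)"
  \<comment> \<open>Only the last index wraps around; the appended head takes its place.\<close>
  proof (cases "Suc j = length is")
    case True
    then show ?thesis using assms j by (simp add: nth_append hd_conv_nth)
  next
    case False
    then have "Suc j < length is" using j by simp
    then show ?thesis using j by (simp add: nth_append)
  qed
qed simp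

text \<open>Cutting out the loop between two visits to \<open>y\<close> splits off its cyclic
  product.\<close>

lemma walk_repeat:
  "walk c (xs @ y # ys @ y # zs) = cyclic_product c (y # ys) * walk c (xs @ y # zs)"
  using walk_append[of c xs y "ys @ y # zs"] walk_append[of c "y # ys" y zs] walk_append[of c xs y zs]
  by (simp add: cyclic_product_eq_walk)

text \<open>A closed walk with a repeated index splits into two shorter closed walks, so every
  cyclic product is a product of simple ones.\<close>

lemma (in real_ring) cyclic_product_mem:
  assumes "simple_cyclic_products S c \<subseteq> A"
  shows "is \<noteq> [] \<Longrightarrow> set is \<subseteq> S \<Longrightarrow> cyclic_product c is \<in> A"
proof (induction "is" rule: length_induct)
  case (1 "is")
  show ?case
  proof (cases "distinct is")
    case True
    then show ?thesis using assms 1 unfolding simple_cyclic_products_def by blast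
  next
    case False
    then obtain xs ys zs y where d: "is = xs @ [y] @ ys @ [y] @ zs"
      using not_distinct_decomp by blast
    have "cyclic_product c is = cyclic_product c (y # ys) * cyclic_product c (xs @ y # zs)"
      using walk_repeat[of c xs y ys "zs @ [hd is]"]
      by (subst (1 3) cyclic_product_eq_walk) (auto simp: d hd_append)
    moreover have "cyclic_product c (y # ys) \<in> A" "cyclic_product c (xs @ y # zs) \<in> A"
      using 1 by (auto simp: d)
    ultimately show ?thesis using mult_mem by simp
  qed
qed

section \<open>Lattices invariant under reflections\<close>

locale reflections =
  fixes S :: "'i set" and \<alpha> :: "'i \<Rightarrow> 'v::euclidean_space \<Rightarrow> real" and v :: "'i \<Rightarrow> 'v"
  assumes finite_S: "finite S" and linear_\<alpha>: "s \<in> S \<Longrightarrow> linear (\<alpha> s)"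
    and \<alpha>_v: "s \<in> S \<Longrightarrow> \<alpha> s (v s) = 2"
begin

definition refl_map :: "'i \<Rightarrow> 'v \<Rightarrow> 'v" where
  "refl_map s x = x - \<alpha> s x *\<^sub>R v s"

lemma linear_refl_map: "s \<in> S \<Longrightarrow> linear (refl_map s)"
  unfolding refl_map_def
  by (rule linearI) (simp_all add: linear_\<alpha> linear_add linear_scale algebra_simps)

lemma refl_map_refl_map: "s \<in> S \<Longrightarrow> refl_map s (refl_map s x) = x"
  by (simp add: refl_map_def linear_diff[OF linear_\<alpha>] linear_scale[OF linear_\<alpha>] \<alpha>_v algebra_simps
      flip: scaleR_add_left)

text \<open>The identity minus a reflection preserves \<open>L\<close>. Composed along a cycle, such
  maps give a rank one map whose trace is the cyclic product, so \<open>rank_one_trace_mem\<close>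
  applies.\<close>

lemma simple_cyclic_products_mem:
  assumes A: "subring_of_reals A" "noetherian_subring A" "integrally_closed A"
    and L: "A_lattice A L" "\<And>s x. s \<in> S \<Longrightarrow> x \<in> L \<Longrightarrow> refl_map s x \<in> L"
  shows "simple_cyclic_products S (cartan_matrix \<alpha> v) \<subseteq> A"
proof
  interpret subring_of_reals A by fact
  let ?c = "cartan_matrix \<alpha> v"
  obtain B where B: "L = span_over A B"
    using L(1) fin_gen_submodule_iff by (auto simp: A_lattice_def)
  have diff: "x - y \<in> L" if "x \<in> L" "y \<in> L" for x y
    using that submodule_over_diff[OF submodule_over_span_over] B by blast
  \<comment> \<open>The composite of the maps \<open>x \<mapsto> x - refl_map i x\<close> along the
    list, the last index acting first.\<close>
  have rank_one: "(walk ?c is * \<alpha> (last is) x) *\<^sub>R v (hd is) \<in> L"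
    if "is \<noteq> []" "set is \<subseteq> S" "x \<in> L" for "is" x
    using that
  proof (induction "is")
    case (Cons i js)
    have step: "\<alpha> i y *\<^sub>R v i \<in> L" if "y \<in> L" for y
      using diff[OF that L(2)[OF _ that, of i]] Cons.prems by (simp add: refl_map_def)
    show ?case
    proof (cases js)
      case Nil
      then show ?thesis using step Cons.prems by simp
    next
      case (Cons j ks)
      then have "(walk ?c js * \<alpha> (last js) x) *\<^sub>R v (hd js) \<in> L"
        using Cons.IH Cons.prems by simp
      moreover have "walk ?c (i # js) = \<alpha> i (v (hd js)) * walk ?c js" "last (i # js) = last js"
        using Cons by (simp_all add: cartan_matrix_def)
      moreover have "linear (\<alpha> i)" using Cons.prems linear_\<alpha> by simp
      ultimately show ?thesis
        using step[of "(walk ?c js * \<alpha> (last js) x) *\<^sub>R v (hd js)"]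
        by (simp add: linear_scale mult_ac del: walk.simps last.simps)
    qed
  qed simp
  fix r assume "r \<in> simple_cyclic_products S ?c"
  then obtain "is" where "is": "r = cyclic_product ?c is" "is \<noteq> []" "set is \<subseteq> S"
    by (auto simp: simple_cyclic_products_def)
  have last: "last is \<in> S" using "is" by auto
  define f where "f x = walk ?c is * \<alpha> (last is) x" for x
  have "linear f"
    unfolding f_def using last
    by (intro linearI) (simp_all add: linear_\<alpha> linear_add linear_scale distrib_left)
  then have "f (v (hd is)) \<in> A"
    by (rule rank_one_trace_mem[OF A(2,3) L(1)]) (use rank_one "is" f_def in auto)
  \<comment> \<open>The trace adds the factor from the last index back to the first, which closes
    the walk.\<close>
  also have "f (v (hd is)) = r"
  proof -
    have "is @ [hd is] = butlast is @ last is # [hd is]" using "is" by simp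
    then have "walk ?c (is @ [hd is]) = walk ?c (butlast is @ [last is]) * ?c (last is) (hd is)"
      by (metis walk_append walk.simps(1,3) mult.right_neutral)
    then show ?thesis using "is" by (simp add: f_def cyclic_product_eq_walk cartan_matrix_def)
  qed
  finally show "r \<in> A" .
qed

text \<open>Vectors attached to paths ending in \<open>i0\<close> generate \<open>L\<close>, and
  functionals attached to paths starting in \<open>i0\<close> separate points. Paired with each
  other they close up to cyclic products, which lie in \<open>A\<close>.\<close>

lemma invariant_lattice_exists:
  assumes A: "subring_of_reals A" and irr: "\<And>W. subspace W \<Longrightarrow> (\<And>s x. s \<in> S \<Longrightarrow> x \<in> W \<Longrightarrow> refl_map s x \<in> W)
      \<Longrightarrow> W = {0} \<or> W = UNIV"
    and cyc: "simple_cyclic_products S (cartan_matrix \<alpha> v) \<subseteq> A" and i0: "i0 \<in> S"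
  obtains L where "A_lattice A L" "\<And>s x. s \<in> S \<Longrightarrow> x \<in> L \<Longrightarrow> refl_map s x \<in> L"
proof -
  interpret subring_of_reals A by fact
  let ?c = "cartan_matrix \<alpha> v"
  define w where "w is = walk ?c is *\<^sub>R v (hd is)" for "is"
  define paths where "paths = {is. is \<noteq> [] \<and> set is \<subseteq> S \<and> last is = i0}"
  \<comment> \<open>Paths without repetition suffice, which keeps the generating set finite.\<close>
  define B where "B = w ` {is \<in> paths. distinct is}"
  define L where "L = span_over A B"
  have L: "submodule_over A L" unfolding L_def by (rule submodule_over_span_over)
  have "{is \<in> paths. distinct is} \<subseteq> {is. set is \<subseteq> S \<and> length is \<le> card S}"
    by (auto simp: paths_def) (metis distinct_card card_mono finite_S)
  then have "finite B"
    unfolding B_def using finite_lists_length_le[OF finite_S] finite_subset by blast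
  then have fg: "fin_gen_submodule A L" using fin_gen_submodule_iff L_def by blast
  \<comment> \<open>A loop in the path is removed at the cost of a scalar, its cyclic
    product.\<close>
  have w_mem: "w is \<in> L" if "is \<in> paths" for "is"
    using that
  proof (induction "is" rule: length_induct)
    case (1 "is")
    show ?case
    proof (cases "distinct is")
      case True
      then have "w is \<in> B" using "1.prems" unfolding B_def by blast
      then show ?thesis unfolding L_def by (rule span_over_base)
    next
      case False
      then obtain xs ys zs y where d: "is = xs @ [y] @ ys @ [y] @ zs"
        using not_distinct_decomp by blast
      then have "w is = cyclic_product ?c (y # ys) *\<^sub>R w (xs @ y # zs)"
        using walk_repeat[of ?c xs y ys zs] by (auto simp: w_def hd_append)
      moreover have "cyclic_product ?c (y # ys) \<in> A"
        using 1 by (intro cyclic_product_mem[OF cyc]) (auto simp: d paths_def)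
      moreover have "w (xs @ y # zs) \<in> L"
        using 1 by (auto simp: d paths_def)
      ultimately show ?thesis using submodule_over_scale[OF L] by simp
    qed
  qed
  \<comment> \<open>The reflection in \<open>s\<close> changes the vector of a path by that of the
    path with \<open>s\<close> put in front, which again ends in \<open>i0\<close>.\<close>
  have refl_w: "refl_map s (w is) = w is - w (s # is)" if "s \<in> S" "is \<in> paths" for s "is"
    using that by (cases "is")
      (auto simp: paths_def refl_map_def w_def cartan_matrix_def linear_scale[OF linear_\<alpha>] mult_ac)
  have cons: "s # is \<in> paths" if "s \<in> S" "is \<in> paths" for s "is"
    using that by (auto simp: paths_def)
  have inv: "refl_map s x \<in> L" if s: "s \<in> S" and x: "x \<in> L" for s x
    using x unfolding L_def
  proof (rule span_over_linear_image[OF linear_refl_map[OF s], rotated])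
    fix b assume "b \<in> B"
    then obtain "is" where "is": "is \<in> paths" "b = w is" by (auto simp: B_def)
    show "refl_map s b \<in> span_over A B"
      using refl_w[OF s "is"(1)] submodule_over_diff[OF L w_mem w_mem] cons[OF s] "is"
      by (simp add: L_def)
  qed
  have i0p: "[i0] \<in> paths" using i0 by (simp add: paths_def)
  have vi0: "v i0 \<noteq> 0" using \<alpha>_v[OF i0] linear_0[OF linear_\<alpha>[OF i0]] by auto
  \<comment> \<open>The real span is invariant and contains the nonzero vector \<open>v i0\<close>,
    so irreducibility applies.\<close>
  have "span L = UNIV"
  proof -
    have "refl_map s x \<in> span L" if "s \<in> S" "x \<in> span L" for s x
    proof -
      have "refl_map s x \<in> refl_map s ` span L" using that by blast
      also have "\<dots> = span (refl_map s ` L)"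
        by (rule linear_span_image[OF linear_refl_map[OF that(1)], symmetric])
      also have "\<dots> \<subseteq> span L" using inv[OF that(1)] by (intro span_mono) auto
      finally show ?thesis .
    qed
    then have "span L = {0} \<or> span L = UNIV" by (intro irr) auto
    moreover have "v i0 \<in> span L" using w_mem[OF i0p] by (simp add: w_def span_base)
    ultimately show ?thesis using vi0 by auto
  qed
  define rpaths where "rpaths = {is. is \<noteq> [] \<and> set is \<subseteq> S \<and> hd is = i0}"
  define g where "g is x = walk ?c is * \<alpha> (last is) x" for "is" x
  have lin_g: "linear (g is)" if "is \<in> rpaths" for "is"
  proof -
    have "last is \<in> S" using that by (auto simp: rpaths_def)
    then show ?thesis unfolding g_def
      by (intro linearI) (simp_all add: linear_\<alpha> linear_add linear_scale distrib_left)
  qed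
  have walk_snoc: "walk ?c (is @ js) = walk ?c is * ?c (last is) (hd js) * walk ?c js"
    if "is \<noteq> []" "js \<noteq> []" for "is" js
  proof -
    have "is @ js = butlast is @ last is # js" using that(1) by simp
    also have "walk ?c \<dots> = walk ?c (butlast is @ [last is]) * walk ?c (last is # js)"
      by (rule walk_append)
    finally have "walk ?c (is @ js) = walk ?c is * walk ?c (last is # js)"
      using that(1) by simp
    then show ?thesis using that(2) by (cases js) simp_all
  qed
  have gw: "g is (w js) \<in> A" if "is \<in> rpaths" "js \<in> paths" for "is" js
  proof -
    have ne: "is \<noteq> []" "js \<noteq> []" "last is \<in> S" using that by (auto simp: paths_def rpaths_def)
    have "g is (w js) = walk ?c (is @ js)"
      by (simp add: g_def w_def walk_snoc ne linear_scale[OF linear_\<alpha>] cartan_matrix_def mult_ac)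
    \<comment> \<open>Both ends of the concatenation are \<open>i0\<close>; dropping the final one
      leaves a cycle.\<close>
    also have "is @ js = (is @ butlast js) @ [hd (is @ butlast js)]"
      using that ne by (auto simp: paths_def rpaths_def hd_append)
         (metis append_butlast_last_id)
    finally have "g is (w js) = cyclic_product ?c (is @ butlast js)"
      using ne by (simp add: cyclic_product_eq_walk)
    also have "\<dots> \<in> A"
      using that ne by (intro cyclic_product_mem[OF cyc])
        (auto simp: paths_def rpaths_def dest: in_set_butlastD)
    finally show ?thesis .
  qed
  have gL: "g is x \<in> A" if "is \<in> rpaths" "x \<in> L" for "is" x
  proof -
    have "submodule_over A (g is -` A)"
      by (rule submodule_over_vimage[OF lin_g[OF that(1)]])
         (auto simp: submodule_over_def zero_mem add_mem mult_mem)
    then have "L \<subseteq> g is -` A"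
      unfolding L_def by (rule span_over_minimal) (auto simp: B_def gw that)
    then show ?thesis using that by blast
  qed
  \<comment> \<open>Composing a functional with a reflection prolongs its path at the end, so the
    common kernel is invariant. It misses \<open>v i0\<close>, where \<open>g [i0]\<close> takes the
    value 2.\<close>
  have inj: "x = 0" if x: "\<And>is. is \<in> rpaths \<Longrightarrow> g is x = 0" for x
  proof -
    let ?N = "{x. \<forall>is\<in>rpaths. g is x = 0}"
    have "subspace ?N"
      by (auto simp: subspace_def linear_0[OF lin_g] linear_add[OF lin_g] linear_scale[OF lin_g])
    moreover have "refl_map s y \<in> ?N" if "s \<in> S" "y \<in> ?N" for s y
    proof -
      have "g is (refl_map s y) = 0" if "is": "is \<in> rpaths" for "is"
      proof -
        have "is @ [s] \<in> rpaths" using "is" \<open>s \<in> S\<close> by (auto simp: rpaths_def)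
        then have "g (is @ [s]) y = 0" using \<open>y \<in> ?N\<close> by blast
        moreover have "g is (refl_map s y) = g is y - g (is @ [s]) y"
          using "is" walk_snoc[of "is" "[s]"] linear_\<alpha>[of "last is"]
          by (auto simp: refl_map_def g_def rpaths_def cartan_matrix_def linear_diff linear_scale
              algebra_simps subset_iff)
        ultimately show ?thesis using \<open>y \<in> ?N\<close> "is" by simp
      qed
      then show ?thesis by blast
    qed
    ultimately have "?N = {0} \<or> ?N = UNIV" by (rule irr)
    moreover have "v i0 \<notin> ?N"
    proof -
      have "[i0] \<in> rpaths" "g [i0] (v i0) = 2" using i0 \<alpha>_v by (auto simp: rpaths_def g_def)
      then show ?thesis by force
    qed
    ultimately have "?N = {0}" by blast
    moreover have "x \<in> ?N" using x by blast
    ultimately show ?thesis by blast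
  qed
  have "A_lattice A L"
    by (rule A_latticeI[OF fg \<open>span L = UNIV\<close>, of rpaths g])
       (use lin_g gL subset_fractions inj in auto)
  then show ?thesis using that inv by blast
qed

end

section \<open>Descent from a subgroup of finite index\<close>

lemma (in real_field) semilinear_sum:
  assumes l: "\<And>u v. l (u + v) = l u + (l v :: real)" "\<And>k u. k \<in> A \<Longrightarrow> l (k *\<^sub>R u) = k * l u"
    and k: "\<And>i. i \<in> I \<Longrightarrow> k i \<in> A"
  shows "l (\<Sum>i\<in>I. k i *\<^sub>R x i) = (\<Sum>i\<in>I. k i * l (x i))"
  using k
proof (induction I rule: infinite_finite_induct)
  case (infinite I)
  have "l 0 = 0" using l(1)[of 0 0] by simp
  then show ?case using infinite by simp
next
  case empty
  have "l 0 = 0" using l(1)[of 0 0] by simp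
  then show ?case by simp
qed (simp_all add: l)

lemma representation_sum_scale:
  assumes "independent E" "span E = UNIV"
  shows "representation E (\<Sum>i\<in>I. k i *\<^sub>R x i) e = (\<Sum>i\<in>I. k i * representation E (x i) e)"
  using linear_sum[OF linear_representation[OF assms], of "\<lambda>i. k i *\<^sub>R x i" I e]
    linear_scale[OF linear_representation[OF assms]]
  by simp

lemma sum_representation:
  assumes "independent E" "finite E" "span E = UNIV"
  shows "(\<Sum>e\<in>E. representation E x e *\<^sub>R e) = x"
  using real_vector.sum_representation_eq[OF assms(1), of x E] assms by simp

lemma linear_eq_sum_representation:
  assumes "independent E" "finite E" "span E = UNIV" "linear f"
  shows "f x = (\<Sum>e\<in>E. representation E x e *\<^sub>R f e)"
  by (subst sum_representation[OF assms(1-3), of x, symmetric])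
     (simp add: linear_sum[OF assms(4)] linear_scale[OF assms(4)])

text \<open>Applying a \<open>K\<close>-linear map \<open>\<real> \<Rightarrow> K\<close> to coordinates turns \<open>\<sigma>\<close> into a map defined over \<open>K\<close> that
  intertwines the same actions of \<open>D\<close>, hence equals \<open>\<sigma>\<close> up to a scalar by Schur's lemma.\<close>

lemma (in real_field) normalizer_preserves_form_up_to_scalar:
  fixes D :: "('v::real_vector \<Rightarrow> 'v) set"
  assumes E: "independent E" "finite E" "span E = UNIV"
    and \<sigma>: "linear \<sigma>" "\<And>x. \<sigma> (\<sigma> x) = x"
    and D: "\<And>\<delta>. \<delta> \<in> D \<Longrightarrow> linear \<delta>" "\<And>\<delta> e. \<delta> \<in> D \<Longrightarrow> e \<in> E \<Longrightarrow> \<delta> e \<in> span_over A E"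
    and norm: "\<And>\<delta>. \<delta> \<in> D \<Longrightarrow> \<exists>\<delta>'\<in>D. \<forall>x. \<sigma> (\<delta> x) = \<delta>' (\<sigma> x)"
    and schur: "\<And>f. linear f \<Longrightarrow> (\<And>\<delta> x. \<delta> \<in> D \<Longrightarrow> f (\<delta> x) = \<delta> (f x)) \<Longrightarrow> \<exists>c. \<forall>x. f x = c *\<^sub>R x"
  obtains c where "c \<noteq> 0" "\<And>e. e \<in> E \<Longrightarrow> c *\<^sub>R \<sigma> e \<in> span_over A E"
proof (cases "E = {}")
  case True
  then show ?thesis using that[of 1] by simp
next
  case False
  then obtain e0 where e0: "e0 \<in> E" by blast
  let ?r = "representation E"
  note sumr = sum_representation[OF E] and linr = linear_representation[OF E(1,3)]
  have "\<sigma> e0 \<noteq> 0"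
  proof
    assume "\<sigma> e0 = 0"
    then have "e0 = 0" using \<sigma>(2)[of e0] linear_0[OF \<sigma>(1)] by simp
    then show False using e0 E(1) dependent_zero by blast
  qed
  then obtain e1 where e1: "?r (\<sigma> e0) e1 \<noteq> 0" using sumr[of "\<sigma> e0"] by force
  then have e1': "?r (\<sigma> e0) e1 \<notin> {0}" by simp
  \<comment> \<open>Normalising \<open>l\<close> at a nonzero coordinate of
    \<open>\<sigma> e0\<close> will exclude \<open>c = 0\<close>.\<close>
  obtain l :: "real \<Rightarrow> real" where l: "\<And>u v. l (u + v) = l u + l v"
    "\<And>k u. k \<in> A \<Longrightarrow> l (k *\<^sub>R u) = k * l u" "\<And>u. l u \<in> A" "l (?r (\<sigma> e0) e1) = 1"
    by (rule functional_exists[OF submodule_over_zero e1'])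
       (rule that; (assumption | blast))
  \<comment> \<open>Coordinatewise \<open>l\<close>: a map that is linear over \<open>A\<close> and
    takes values in the \<open>A\<close>-span of \<open>E\<close>.\<close>
  define \<Phi> where "\<Phi> x = (\<Sum>e\<in>E. l (?r x e) *\<^sub>R e)" for x
  have r\<Phi>: "?r (\<Phi> x) e = (if e \<in> E then l (?r x e) else 0)" for x e
  proof -
    have "?r (\<Phi> x) e = (\<Sum>e'\<in>E. l (?r x e') * (if e' = e then 1 else 0))"
      unfolding \<Phi>_def representation_sum_scale[OF E(1,3)]
      by (rule sum.cong) (auto simp: real_vector.representation_basis[OF E(1)])
    also have "\<dots> = (\<Sum>e'\<in>E. if e' = e then l (?r x e') else 0)"
      by (rule sum.cong) auto
    finally show ?thesis using E(2) by simp
  qed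
  have \<Phi>_mem: "\<Phi> x \<in> span_over A E" for x
    unfolding \<Phi>_def
    by (intro submodule_over_sum[OF submodule_over_span_over]
        submodule_over_scale[OF submodule_over_span_over] span_over_base l(3))
  have \<Phi>_sum: "\<Phi> (\<Sum>i\<in>I. k i *\<^sub>R x i) = (\<Sum>i\<in>I. k i *\<^sub>R \<Phi> (x i))"
    if k: "\<And>i. i \<in> I \<Longrightarrow> k i \<in> A" for I k and x :: "'v \<Rightarrow> 'v"
  proof -
    have "l (?r (\<Sum>i\<in>I. k i *\<^sub>R x i) e) = (\<Sum>i\<in>I. k i * l (?r (x i) e))" for e
      using semilinear_sum[where l = l and k = k and I = I and x = "\<lambda>i. ?r (x i) e", OF l(1,2) k]
      by (simp add: representation_sum_scale[OF E(1,3)])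
    then have "\<Phi> (\<Sum>i\<in>I. k i *\<^sub>R x i) = (\<Sum>e\<in>E. \<Sum>i\<in>I. (k i * l (?r (x i) e)) *\<^sub>R e)"
      unfolding \<Phi>_def by (simp add: scaleR_sum_left)
    also have "\<dots> = (\<Sum>i\<in>I. \<Sum>e\<in>E. (k i * l (?r (x i) e)) *\<^sub>R e)" by (rule sum.swap)
    finally show ?thesis by (simp add: \<Phi>_def scaleR_sum_right)
  qed
  \<comment> \<open>The matrices of \<open>D\<close> in the basis \<open>E\<close> have entries in
    \<open>A\<close>, so coordinatewise \<open>l\<close> commutes with them.\<close>
  have \<Phi>\<delta>: "\<Phi> (\<delta> x) = \<delta> (\<Phi> x)" if \<delta>: "\<delta> \<in> D" for \<delta> x
  proof -
    have k: "?r (\<delta> e) e' \<in> A" if "e \<in> E" for e e'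
      using representation_mem[OF E(1) D(2)[OF \<delta> that]] .
    have "l (?r (\<delta> x) e) = ?r (\<delta> (\<Phi> x)) e" if "e \<in> E" for e
    proof -
      have "l (?r (\<delta> x) e) = l (\<Sum>e'\<in>E. ?r (\<delta> e') e *\<^sub>R ?r x e')"
        by (subst linear_eq_sum_representation[OF E D(1)[OF \<delta>]])
           (simp add: representation_sum_scale[OF E(1,3)] mult.commute)
      also have "\<dots> = (\<Sum>e'\<in>E. ?r (\<delta> e') e * l (?r x e'))"
        by (rule semilinear_sum[where l = l, OF l(1,2)]) (use k in auto)
      also have "\<dots> = ?r (\<delta> (\<Phi> x)) e"
        unfolding \<Phi>_def linear_sum[OF D(1)[OF \<delta>]] linear_scale[OF D(1)[OF \<delta>]]
          representation_sum_scale[OF E(1,3)]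
        by (simp add: mult.commute)
      finally show ?thesis .
    qed
    then have "\<Phi> (\<delta> x) = (\<Sum>e\<in>E. ?r (\<delta> (\<Phi> x)) e *\<^sub>R e)" unfolding \<Phi>_def[of "\<delta> x"] by simp
    then show ?thesis using sumr by simp
  qed
  \<comment> \<open>The real linear map agreeing with \<open>\<Phi> \<circ> \<sigma>\<close> on
    \<open>E\<close>; real linearity brings it within reach of Schur's lemma.\<close>
  define f where "f x = (\<Sum>e\<in>E. ?r x e *\<^sub>R \<Phi> (\<sigma> e))" for x
  have lf: "linear f"
    unfolding f_def
    by (rule linearI)
       (simp_all add: linear_add[OF linr] linear_scale[OF linr] scaleR_add_left sum.distrib scaleR_sum_right)
  have fE: "f e = \<Phi> (\<sigma> e)" if "e \<in> E" for e
  proof -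
    have "f e = (\<Sum>e'\<in>E. if e' = e then \<Phi> (\<sigma> e') else 0)"
      unfolding f_def using that
      by (intro sum.cong) (auto simp: real_vector.representation_basis[OF E(1)])
    then show ?thesis using E(2) that by simp
  qed
  have f\<delta>: "f (\<delta> x) = \<delta>' (f x)" if \<delta>: "\<delta> \<in> D" "\<delta>' \<in> D" "\<forall>x. \<sigma> (\<delta> x) = \<delta>' (\<sigma> x)" for \<delta> \<delta>' x
  proof -
    have "f (\<delta> e) = \<delta>' (f e)" if e: "e \<in> E" for e
    proof -
      have "f (\<delta> e) = (\<Sum>e'\<in>E. ?r (\<delta> e) e' *\<^sub>R \<Phi> (\<sigma> e'))" by (simp add: f_def)
      also have "\<dots> = \<Phi> (\<Sum>e'\<in>E. ?r (\<delta> e) e' *\<^sub>R \<sigma> e')"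
        by (rule \<Phi>_sum[symmetric]) (rule representation_mem[OF E(1) D(2)[OF \<delta>(1) e]])
      also have "(\<Sum>e'\<in>E. ?r (\<delta> e) e' *\<^sub>R \<sigma> e') = \<sigma> (\<delta> e)"
        by (rule linear_eq_sum_representation[OF E \<sigma>(1), symmetric])
      finally show ?thesis using \<delta> fE[OF e] \<Phi>\<delta> by simp
    qed
    then show ?thesis
      using linear_eq_on_span[OF linear_compose[OF D(1)[OF \<delta>(1)] lf]
          linear_compose[OF lf D(1)[OF \<delta>(2)]], of E x] E(3) by simp
  qed
  have "linear (\<lambda>x. \<sigma> (f x))" using linear_compose[OF lf \<sigma>(1)] by (simp add: o_def)
  \<comment> \<open>The map \<open>f\<close> carries \<open>\<delta>\<close> to
    \<open>\<delta>'\<close>, and the involution \<open>\<sigma>\<close> carries it back.\<close>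
  moreover have "\<sigma> (f (\<delta> x)) = \<delta> (\<sigma> (f x))" if \<delta>: "\<delta> \<in> D" for \<delta> x
  proof -
    obtain \<delta>' where \<delta>': "\<delta>' \<in> D" "\<forall>x. \<sigma> (\<delta> x) = \<delta>' (\<sigma> x)" using norm[OF \<delta>] by blast
    have "\<delta> (\<sigma> (f x)) = \<sigma> (\<sigma> (\<delta> (\<sigma> (f x))))" using \<sigma>(2) by simp
    also have "\<dots> = \<sigma> (\<delta>' (f x))" using \<delta>'(2) \<sigma>(2) by simp
    finally show ?thesis using f\<delta>[OF \<delta> \<delta>'] by simp
  qed
  ultimately obtain c where c: "\<And>x. \<sigma> (f x) = c *\<^sub>R x" using schur by meson
  have f_eq: "f x = c *\<^sub>R \<sigma> x" for x
    using \<sigma>(2)[of "f x"] c[of x] linear_scale[OF \<sigma>(1)] by simp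
  show ?thesis
  proof
    show "c *\<^sub>R \<sigma> e \<in> span_over A E" if "e \<in> E" for e
      using f_eq[of e] fE[OF that] \<Phi>_mem[of "\<sigma> e"] by simp
    have "e1 \<in> E" using e1 real_vector.representation_ne_zero by blast
    then have "?r (c *\<^sub>R \<sigma> e0) e1 = 1" using f_eq[of e0] fE[OF e0] r\<Phi>[of "\<sigma> e0" e1] l(4) by simp
    then show "c \<noteq> 0" by (auto simp: real_vector.representation_zero)
  qed
qed

text \<open>Computed in the basis \<open>E\<close>, the trace of \<open>c\<close> times the
  reflection lies in \<open>A\<close> and equals \<open>c\<close> times the dimension minus 2. That
  integer is nonzero, so \<open>c\<close> and its inverse lie in the field \<open>A\<close>.\<close>

lemma (in real_field) reflection_preserves_form:
  fixes a :: "'v::euclidean_space \<Rightarrow> real"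
  assumes E: "independent E" "finite E" "span E = UNIV"
    and a: "linear a" "a v = 2" and dim: "DIM('v) \<ge> 3"
    and c: "c \<noteq> 0" "\<And>e. e \<in> E \<Longrightarrow> c *\<^sub>R (e - a e *\<^sub>R v) \<in> span_over A E"
    and e: "e \<in> E"
  shows "e - a e *\<^sub>R v \<in> span_over A E"
proof -
  let ?r = "representation E"
  note linr = linear_representation[OF E(1,3)]
  have card: "card E = DIM('v)"
    using real_vector.dim_eq_card[of E UNIV] E by (simp add: dim_UNIV)
  have "(\<Sum>e\<in>E. ?r (c *\<^sub>R (e - a e *\<^sub>R v)) e) = c * (\<Sum>e\<in>E. 1 - a e * ?r v e)"
    unfolding sum_distrib_left
    by (intro sum.cong)
       (simp_all add: linear_scale[OF linr] linear_diff[OF linr] real_vector.representation_basis[OF E(1)])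
  also have "(\<Sum>e\<in>E. 1 - a e * ?r v e) = DIM('v) - (\<Sum>e\<in>E. ?r v e * a e)"
    by (simp add: sum_subtractf card mult.commute)
  also have "(\<Sum>e\<in>E. ?r v e * a e) = a v"
    using linear_eq_sum_representation[OF E a(1), of v] by simp
  finally have tr: "(\<Sum>e\<in>E. ?r (c *\<^sub>R (e - a e *\<^sub>R v)) e) = c * (real DIM('v) - 2)" using a(2) by simp
  have "(\<Sum>e\<in>E. ?r (c *\<^sub>R (e - a e *\<^sub>R v)) e) \<in> A"
    by (intro sum_mem representation_mem[OF E(1)] c(2))
  then have "c * (real DIM('v) - 2) / (of_nat (DIM('v) - 2)) \<in> A"
    unfolding tr using of_nat_mem by (intro divide_mem) auto
  also have "c * (real DIM('v) - 2) / (of_nat (DIM('v) - 2)) = c" using dim by (simp add: of_nat_diff)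
  finally have "inverse c \<in> A" by (rule inverse_mem)
  from submodule_over_scale[OF submodule_over_span_over this c(2)[OF e]]
  show ?thesis using c(1) by simp
qed

text \<open>The sum of the translates of \<open>L\<close>: only finitely many are distinct, so it is
  finitely generated. It stays in the \<open>K\<close>-span of \<open>E\<close>, so the coordinates
  in \<open>E\<close> are the functionals that \<open>A_latticeI\<close> asks for.\<close>

lemma (in subring_of_reals) A_lattice_translates:
  fixes L :: "'v::real_vector set"
  assumes L: "A_lattice A L" "L \<subseteq> span_over (fractions A) E"
    and E: "independent E" "finite E" "span E = UNIV"
    and G: "id \<in> G" "\<And>g h. g \<in> G \<Longrightarrow> h \<in> G \<Longrightarrow> g \<circ> h \<in> G" "\<And>g. g \<in> G \<Longrightarrow> linear g"
      "\<And>g e. g \<in> G \<Longrightarrow> e \<in> E \<Longrightarrow> g e \<in> span_over (fractions A) E"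
    and fin: "finite ((\<lambda>g. g ` L) ` G)"
  obtains L' where "A_lattice A L'" "\<And>g. g \<in> G \<Longrightarrow> g ` L' \<subseteq> L'"
proof -
  obtain B where B: "finite B" "L = span_over A B"
    using L(1) fin_gen_submodule_iff by (auto simp: A_lattice_def)
  obtain R where R: "finite R" "R \<subseteq> G" "(\<lambda>g. g ` L) ` G = (\<lambda>g. g ` L) ` R"
    using finite_subset_image[OF fin order_refl] by blast
  define L' where "L' = span_over A (\<Union>r\<in>R. r ` B)"
  have fg: "fin_gen_submodule A L'"
    unfolding fin_gen_submodule_iff L'_def using R(1) B(1)
    by (intro exI[of _ "\<Union>r\<in>R. r ` B"]) simp
  have gL: "g x \<in> L'" if g: "g \<in> G" and x: "x \<in> L" for g x
  proof -
    have "g ` L \<in> (\<lambda>g. g ` L) ` R" unfolding R(3)[symmetric] using g by (rule imageI)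
    then obtain r where r: "r \<in> R" "g ` L = r ` L" by (rule imageE)
    have "g x \<in> r ` L" unfolding r(2)[symmetric] using x by (rule imageI)
    then obtain y where y: "y \<in> L" "g x = r y" by blast
    have "r y \<in> L'"
      unfolding L'_def
    proof (rule span_over_linear_image[where f = r and x = y and B = B])
      show "linear r" using G(3) R(2) r by blast
      show "y \<in> span_over A B" using y B by simp
      show "r b \<in> span_over A (\<Union>r\<in>R. r ` B)" if "b \<in> B" for b
        using that r by (intro span_over_base) blast
    qed
    then show ?thesis using y by simp
  qed
  have inv: "g ` L' \<subseteq> L'" if g: "g \<in> G" for g
  proof -
    have "g x \<in> L'" if "x \<in> L'" for x
      unfolding L'_def
    proof (rule span_over_linear_image[OF G(3)[OF g]])
      show "x \<in> span_over A (\<Union>r\<in>R. r ` B)" using that by (simp add: L'_def)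
      fix b assume "b \<in> (\<Union>r\<in>R. r ` B)"
      then obtain r b' where r: "r \<in> R" "b' \<in> B" "b = r b'" by blast
      then have "b' \<in> L" using B(2) span_over_base by simp
      moreover have "g \<circ> r \<in> G" using G(2)[OF g] R(2) r by blast
      ultimately show "g b \<in> span_over A (\<Union>r\<in>R. r ` B)"
        using gL[of "g \<circ> r" b'] r by (simp add: L'_def)
    qed
    then show ?thesis by blast
  qed
  have "L \<subseteq> L'" using gL[OF G(1)] by auto
  moreover have "span L = UNIV" using L(1) A_lattice_iff by (auto simp: A_lattice_def)
  ultimately have "span L' = UNIV" using span_mono by blast
  have L'E: "L' \<subseteq> span_over (fractions A) E"
  proof -
    have "r b \<in> span_over (fractions A) E" if "r \<in> R" "b \<in> B" for r b
    proof (rule span_over_linear_image[where f = r and x = b and B = E])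
      show "linear r" using G(3) R(2) that by blast
      show "r e \<in> span_over (fractions A) E" if "e \<in> E" for e
        using G(4) R(2) \<open>r \<in> R\<close> that by blast
      show "b \<in> span_over (fractions A) E"
        using L(2) B(2) span_over_base[OF that(2), of A] by blast
    qed
    then have "span_over (fractions A) (\<Union>r\<in>R. r ` B) \<subseteq> span_over (fractions A) E"
      by (intro span_over_minimal submodule_over_span_over) blast
    then show ?thesis unfolding L'_def using span_over_le_fractions by blast
  qed
  have "A_lattice A L'"
  proof (rule A_latticeI[OF fg \<open>span L' = UNIV\<close>])
    show "linear (\<lambda>x. representation E x e)" for e by (rule linear_representation[OF E(1,3)])
    show "representation E x e \<in> fractions A" if "x \<in> L'" for x e
      using frac.representation_mem[OF E(1)] L'E that by blast
    show "x = 0" if "\<And>e. e \<in> UNIV \<Longrightarrow> representation E x e = 0" for x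
      using sum_representation[OF E, of x] that by simp
  qed
  then show ?thesis using that inv by blast
qed

section \<open>Groups dividing a strictly convex cone\<close>

text \<open>Linear counterpart of a divided strictly convex domain: \<open>sharp\<close> says that
  the closed cone contains no line, \<open>strict\<close> that nonzero vectors of it on different
  rays have an interior sum, and \<open>cocompact\<close> is compactness modulo \<open>G\<close> and
  positive scaling.\<close>

locale divided_cone =
  fixes C :: "(real ^ 'd::finite) set" and G :: "(real ^ 'd ^ 'd) set"
  assumes open_C: "open C" and C_ne: "C \<noteq> {}" and zero_notin: "0 \<notin> C"
    and scale: "x \<in> C \<Longrightarrow> r > 0 \<Longrightarrow> r *\<^sub>R x \<in> C"
    and sharp: "x \<in> closure C \<Longrightarrow> - x \<in> closure C \<Longrightarrow> x = 0"
    and strict: "x \<in> closure C \<Longrightarrow> y \<in> closure C \<Longrightarrow> x \<noteq> 0 \<Longrightarrow> y \<noteq> 0 \<Longrightarrow> x + y \<notin> C \<Longrightarrow>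
      \<exists>r>0. y = r *\<^sub>R x"
    and inverse: "g \<in> G \<Longrightarrow> \<exists>h\<in>G. g ** h = mat 1 \<and> h ** g = mat 1"
    and preserves: "g \<in> G \<Longrightarrow> x \<in> C \<Longrightarrow> g *v x \<in> C"
    and cocompact: "\<exists>K. compact K \<and> K \<subseteq> C \<and> (\<forall>x\<in>C. \<exists>g\<in>G. \<exists>k\<in>K. \<exists>r>0. x = r *\<^sub>R (g *v k))"
    and dim: "CARD('d) \<ge> 3"
begin

section \<open>The closed cone and limits of rescaled group elements\<close>

lemma closure_scale: "x \<in> closure C \<Longrightarrow> r > 0 \<Longrightarrow> r *\<^sub>R x \<in> closure C"
proof -
  assume x: "x \<in> closure C" and r: "r > 0"
  have "(*\<^sub>R) r ` closure C \<subseteq> closure C"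
    by (rule image_closure_subset)
       (use r scale closure_subset in \<open>auto intro!: continuous_intros\<close>)
  then show ?thesis using x by blast
qed

lemma preserves_closure:
  assumes "\<And>x. x \<in> C \<Longrightarrow> g *v x \<in> C" "x \<in> closure C"
  shows "g *v x \<in> closure C"
proof -
  have "(*v) g ` closure C \<subseteq> closure C"
    by (rule image_closure_subset)
       (use assms(1) closure_subset in \<open>auto intro!: linear_continuous_on matrix_vector_mul_bounded_linear\<close>)
  then show ?thesis using assms(2) by blast
qed

text \<open>The scaling factors may tend to 0, so 0 belongs to this closure and is excluded
  separately below.\<close>

definition rays :: "(real ^ 'd ^ 'd) set" where
  "rays = closure {c *\<^sub>R g | c g. c > 0 \<and> g \<in> G}"

lemma continuous_on_mult_vec: "continuous_on S (\<lambda>g :: real ^ 'd ^ 'd. g *v x)"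
proof -
  have "linear (\<lambda>g :: real ^ 'd ^ 'd. g *v x)"
    by (rule linearI) (simp_all add: matrix_vector_mult_add_rdistrib scaleR_matrix_vector_assoc)
  then show ?thesis by (rule linear_continuous_on[OF linear_conv_bounded_linear[THEN iffD1]])
qed

text \<open>Closed conditions on the value at \<open>x\<close> pass to limits, as evaluation at
  \<open>x\<close> is continuous.\<close>

lemma rays_induct:
  assumes g: "g \<in> rays" and S: "closed S"
    and sub: "\<And>c h. c > 0 \<Longrightarrow> h \<in> G \<Longrightarrow> (c *\<^sub>R h) *v x \<in> S"
  shows "g *v x \<in> S"
proof -
  have "(\<lambda>g. g *v x) ` rays \<subseteq> S"
    unfolding rays_def
    by (rule image_closure_subset) (use S sub in \<open>auto intro: continuous_on_mult_vec\<close>)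
  then show ?thesis using g by blast
qed

lemma rays_closure: "g \<in> rays \<Longrightarrow> x \<in> closure C \<Longrightarrow> g *v x \<in> closure C"
  by (erule rays_induct)
     (auto simp: scaleR_matrix_vector_assoc[symmetric] intro!: closure_scale preserves_closure preserves)

lemma rays_subspace:
  assumes "g \<in> rays" "subspace W" "\<And>h x. h \<in> G \<Longrightarrow> x \<in> W \<Longrightarrow> h *v x \<in> W" "x \<in> W"
  shows "g *v x \<in> W"
  using assms(1)
  by (rule rays_induct)
     (use assms closed_subspace in \<open>auto simp: scaleR_matrix_vector_assoc[symmetric] subspace_scale\<close>)

lemma perturb:
  assumes "k \<in> C"
  obtains e where "e > 0" "k + e *\<^sub>R u \<in> C" "k - e *\<^sub>R u \<in> C"
proof -
  obtain d where d: "d > 0" "ball k d \<subseteq> C" using open_C assms open_contains_ball by blast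
  \<comment> \<open>The summand 1 keeps the denominator positive for \<open>u = 0\<close>.\<close>
  define e where "e = d / (2 * (norm u + 1))"
  have e: "e > 0" using d by (simp add: e_def add_nonneg_pos)
  have "norm (e *\<^sub>R u) = d / 2 * (norm u / (norm u + 1))"
    using e by (simp add: e_def abs_of_pos add_nonneg_pos d)
  also have "\<dots> \<le> d / 2 * 1"
    using d by (intro mult_left_mono) (auto simp: divide_le_eq_1 add_nonneg_pos)
  finally have "norm (e *\<^sub>R u) < d" using d by simp
  then have "k + e *\<^sub>R u \<in> ball k d" "k - e *\<^sub>R u \<in> ball k d" by (auto simp: dist_norm)
  then show ?thesis using that e d by blast
qed

text \<open>Were an interior vector killed, perturbing it by \<open>u\<close> in both directions
  would give opposite images in the closed cone, so sharpness would kill every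
  \<open>u\<close>.\<close>

lemma rays_nonzero:
  assumes g: "g \<in> rays" "g \<noteq> 0" and k: "k \<in> C"
  shows "g *v k \<noteq> 0"
proof
  assume 0: "g *v k = 0"
  have "g *v u = 0" for u
  proof -
    obtain e where e: "e > 0" "k + e *\<^sub>R u \<in> C" "k - e *\<^sub>R u \<in> C" by (rule perturb[OF k])
    have "g *v (k + e *\<^sub>R u) \<in> closure C" "g *v (k - e *\<^sub>R u) \<in> closure C"
      using rays_closure[OF g(1)] e closure_subset by blast+
    then have "e *\<^sub>R (g *v u) \<in> closure C" "- (e *\<^sub>R (g *v u)) \<in> closure C"
      by (simp_all add: matrix_vector_right_distrib matrix_vector_mult_diff_distrib
          matrix_vector_mult_scaleR 0)
    then show ?thesis using sharp[of "e *\<^sub>R (g *v u)"] e by simp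
  qed
  then have "g = 0" by (simp add: matrix_eq)
  then show False using g by simp
qed

text \<open>The boundary vector \<open>g *v k\<close> is the midpoint of the images of two points of
  the cone on opposite sides of \<open>k\<close>. Strict convexity puts these images on one ray, so
  every \<open>g *v u\<close> lies on the line of \<open>g *v k\<close>.\<close>

lemma rank_one:
  assumes g: "g \<in> rays" "g \<noteq> 0" and k: "k \<in> C" "g *v k \<notin> C"
  obtains \<phi> where "linear \<phi>" "\<And>u. g *v u = \<phi> u *\<^sub>R (g *v k)" "\<And>u. u \<in> C \<Longrightarrow> \<phi> u > 0"
proof -
  let ?x = "g *v k"
  have x: "?x \<noteq> 0" "?x \<in> closure C"
    using rays_nonzero[OF g k(1)] rays_closure[OF g(1)] k closure_subset by auto
  have ex: "\<exists>r. g *v u = r *\<^sub>R ?x" for u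
  proof -
    obtain e where e: "e > 0" "k + e *\<^sub>R u \<in> C" "k - e *\<^sub>R u \<in> C" by (rule perturb[OF k(1)])
    define a b where "a = g *v (k + e *\<^sub>R u)" and "b = g *v (k - e *\<^sub>R u)"
    have ab: "a \<in> closure C" "b \<in> closure C" "a \<noteq> 0" "b \<noteq> 0"
      using rays_closure[OF g(1)] rays_nonzero[OF g] e closure_subset by (auto simp: a_def b_def)
    have sum: "a + b = 2 *\<^sub>R ?x"
      by (simp add: a_def b_def matrix_vector_right_distrib matrix_vector_mult_diff_distrib scaleR_2)
    have "a + b \<notin> C"
    proof
      assume "a + b \<in> C"
      then have "(1/2) *\<^sub>R (a + b) \<in> C" by (intro scale) auto
      then show False using k(2) by (simp add: sum)
    qed
    then obtain r where r: "r > 0" "b = r *\<^sub>R a" using strict ab by blast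
    then have "(1 + r) *\<^sub>R a = 2 *\<^sub>R ?x" using sum by (simp add: scaleR_add_left)
    then have "a = inverse (1 + r) *\<^sub>R 2 *\<^sub>R ?x"
      using r(1) by (metis add_pos_pos less_numeral_extra(1,3) real_vector.scale_left_imp_eq
          real_vector.scale_scale right_inverse scaleR_one)
    moreover have "a = ?x + e *\<^sub>R (g *v u)"
      by (simp add: a_def matrix_vector_right_distrib matrix_vector_mult_scaleR)
    ultimately have "e *\<^sub>R (g *v u) = (inverse (1 + r) * 2 - 1) *\<^sub>R ?x"
      by (simp add: algebra_simps)
    then have "g *v u = (inverse e * (inverse (1 + r) * 2 - 1)) *\<^sub>R ?x"
      using e(1) by (metis less_irrefl left_inverse scaleR_one scaleR_scaleR)
    then show ?thesis by blast
  qed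
  define \<phi> where "\<phi> u = (g *v u) \<bullet> ?x / (?x \<bullet> ?x)" for u
  have eq: "g *v u = \<phi> u *\<^sub>R ?x" for u
    using ex[of u] x by (auto simp: \<phi>_def)
  have lin: "linear \<phi>"
    unfolding \<phi>_def
    by (rule linearI) (simp_all add: matrix_vector_right_distrib matrix_vector_mult_scaleR
        inner_add_left add_divide_distrib)
  \<comment> \<open>A negative value would put the opposite of \<open>?x\<close> into the closed
    cone.\<close>
  have "\<phi> u > 0" if u: "u \<in> C" for u
  proof (rule ccontr)
    assume "\<not> \<phi> u > 0"
    moreover have "\<phi> u \<noteq> 0" using rays_nonzero[OF g u] eq[of u] by auto
    ultimately have neg: "- \<phi> u > 0" by linarith
    have "\<phi> u *\<^sub>R ?x \<in> closure C" using rays_closure[OF g(1), of u] u closure_subset eq[of u] by auto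
    then have "inverse (- \<phi> u) *\<^sub>R \<phi> u *\<^sub>R ?x \<in> closure C"
      by (rule closure_scale) (use neg in auto)
    moreover have "inverse (- \<phi> u) * \<phi> u = - 1" using neg by (simp add: field_simps)
    ultimately have "- ?x \<in> closure C" by (simp only: scaleR_scaleR scaleR_minus1_left)
    then show False using sharp x by blast
  qed
  then show ?thesis using that lin eq by blast
qed

lemma G_norm_pos: "g \<in> G \<Longrightarrow> norm g > 0"
proof -
  assume "g \<in> G"
  then obtain h where "g ** h = mat 1" using inverse by blast
  moreover have "(mat 1 :: real ^ 'd ^ 'd) \<noteq> 0" by (simp add: mat_def vec_eq_iff)
  ultimately show "norm g > 0" by auto
qed

lemma convergent_subsequence:
  fixes h :: "nat \<Rightarrow> real ^ 'd ^ 'd"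
  assumes "\<And>t. h t \<in> G"
  obtains g r where "g \<in> rays" "g \<noteq> 0" "strict_mono r"
    "(\<lambda>t. h (r t) /\<^sub>R norm (h (r t))) \<longlonglongrightarrow> g"
proof -
  have sp: "\<forall>t. h t /\<^sub>R norm (h t) \<in> sphere 0 1"
    using G_norm_pos[OF assms] by (auto simp: less_imp_neq[symmetric])
  have sc: "seq_compact (sphere (0 :: real ^ 'd ^ 'd) 1)"
    by (intro compact_imp_seq_compact compact_sphere)
  obtain g r where g: "g \<in> sphere 0 1" "strict_mono r" "((\<lambda>t. h t /\<^sub>R norm (h t)) \<circ> r) \<longlonglongrightarrow> g"
    by (rule seq_compactE[OF sc sp]) (rule that; assumption)
  have "h t /\<^sub>R norm (h t) \<in> {c *\<^sub>R g | c g. c > 0 \<and> g \<in> G}" for t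
  proof -
    have "inverse (norm (h t)) > 0" using G_norm_pos[OF assms] by (rule positive_imp_inverse_positive)
    then show ?thesis using assms by blast
  qed
  then have "g \<in> rays"
    unfolding rays_def closure_sequential using g(3)
    by (intro exI[of _ "(\<lambda>t. h t /\<^sub>R norm (h t)) \<circ> r"] conjI allI) (simp_all only: o_def)
  moreover have "g \<noteq> 0" using g(1) by auto
  ultimately show ?thesis using that[of g r] g by (auto simp: o_def)
qed

lemma tendsto_matrix_vector:
  assumes "(M \<longlongrightarrow> (g :: real ^ 'd ^ 'd)) F" "(x \<longlongrightarrow> y) F"
  shows "((\<lambda>t. M t *v x t) \<longlongrightarrow> g *v y) F"
  unfolding matrix_vector_mult_def using assms
  by (intro tendsto_vec_lambda tendsto_sum tendsto_mult tendsto_vec_nth)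

text \<open>Points of the cone tending to \<open>x\<close> are scaled images of points of a compact
  set. The group elements involved, normalised, have a limit \<open>g\<close>, and \<open>g\<close>
  sends a limit of the compact points to the ray of \<open>x\<close>.\<close>

lemma boundary_sequence:
  assumes x: "x \<in> closure C" "x \<notin> C" "x \<noteq> 0"
  obtains h g k where "\<And>t :: nat. h t \<in> G" "(\<lambda>t. h t /\<^sub>R norm (h t)) \<longlonglongrightarrow> g" "g \<in> rays" "g \<noteq> 0"
    "k \<in> C" "\<exists>s>0. g *v k = s *\<^sub>R x"
proof -
  obtain K where K: "compact K" "K \<subseteq> C" "\<And>x. x \<in> C \<Longrightarrow> \<exists>g\<in>G. \<exists>k\<in>K. \<exists>r>0. x = r *\<^sub>R (g *v k)"
    using cocompact by blast
  obtain y where y: "\<And>t. y t \<in> C" "y \<longlonglongrightarrow> x" using x(1) closure_sequential by blast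
  have "\<forall>t. \<exists>g k r. g \<in> G \<and> k \<in> K \<and> r > 0 \<and> y t = r *\<^sub>R (g *v k)" using K(3) y(1) by blast
  then obtain h k r where hkr: "\<And>t. h t \<in> G" "\<And>t. k t \<in> K" "\<And>t. r t > 0" "\<And>t. y t = r t *\<^sub>R (h t *v k t)"
    by metis
  obtain \<kappa> \<rho> where \<kappa>: "\<kappa> \<in> K" "strict_mono \<rho>" "(k \<circ> \<rho>) \<longlonglongrightarrow> \<kappa>"
    using K(1) hkr(2) unfolding compact_def by blast
  obtain g q where g: "g \<in> rays" "g \<noteq> 0" "strict_mono q"
    "(\<lambda>t. h (\<rho> (q t)) /\<^sub>R norm (h (\<rho> (q t)))) \<longlonglongrightarrow> g"
    using convergent_subsequence[of "h \<circ> \<rho>"] hkr(1) by (auto simp: o_def)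
  define p where "p = \<rho> \<circ> q"
  have p: "strict_mono p" unfolding p_def by (rule strict_mono_o[OF \<kappa>(2) g(3)])
  have kp: "(\<lambda>t. k (p t)) \<longlonglongrightarrow> \<kappa>"
    using LIMSEQ_subseq_LIMSEQ[OF \<kappa>(3) g(3)] by (simp add: p_def o_def)
  have hp: "(\<lambda>t. h (p t) /\<^sub>R norm (h (p t))) \<longlonglongrightarrow> g" using g(4) by (simp add: p_def)
  have yp: "(\<lambda>t. y (p t)) \<longlonglongrightarrow> x" using LIMSEQ_subseq_LIMSEQ[OF y(2) p] by (simp add: o_def)
  have \<kappa>C: "\<kappa> \<in> C" using \<kappa> K by blast
  have lim: "(\<lambda>t. (h (p t) /\<^sub>R norm (h (p t))) *v k (p t)) \<longlonglongrightarrow> g *v \<kappa>"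
    by (rule tendsto_matrix_vector[OF hp kp])
  define s where "s t = inverse (r (p t)) * inverse (norm (h (p t)))" for t
  have s: "s t > 0" for t using hkr(3) G_norm_pos[OF hkr(1)] by (simp add: s_def)
  have eq: "(h (p t) /\<^sub>R norm (h (p t))) *v k (p t) = s t *\<^sub>R y (p t)" for t
    using hkr(3)[of "p t"] unfolding hkr(4)[of "p t"]
    by (simp add: s_def scaleR_matrix_vector_assoc[symmetric])
  have yn: "y t \<noteq> 0" for t using y(1) zero_notin by metis
  have "(\<lambda>t. norm (s t *\<^sub>R y (p t)) / norm (y (p t))) \<longlonglongrightarrow> norm (g *v \<kappa>) / norm x"
    using lim[unfolded eq] yp x(3) by (intro tendsto_intros) auto
  then have "s \<longlonglongrightarrow> norm (g *v \<kappa>) / norm x" using yn s by (simp add: less_imp_le)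
  then have "(\<lambda>t. s t *\<^sub>R y (p t)) \<longlonglongrightarrow> (norm (g *v \<kappa>) / norm x) *\<^sub>R x"
    using yp by (rule tendsto_scaleR)
  then have "g *v \<kappa> = (norm (g *v \<kappa>) / norm x) *\<^sub>R x"
    using LIMSEQ_unique lim[unfolded eq] by blast
  moreover have "norm (g *v \<kappa>) / norm x > 0" using rays_nonzero[OF g(1,2) \<kappa>C] x(3) by simp
  ultimately show ?thesis using that[of "\<lambda>t. h (p t)" g \<kappa>] hkr(1) hp g(1,2) \<kappa>C by blast
qed

text \<open>Combines \<open>boundary_sequence\<close> with \<open>rank_one\<close>; the positive
  factor is absorbed into the functional, so that the image vector is \<open>x\<close>
  itself.\<close>

lemma attracting:
  assumes x: "x \<in> closure C" "x \<notin> C" "x \<noteq> 0"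
  obtains h g \<phi> where "\<And>t :: nat. h t \<in> G" "(\<lambda>t. h t /\<^sub>R norm (h t)) \<longlonglongrightarrow> g" "g \<in> rays" "g \<noteq> 0"
    "linear \<phi>" "\<And>u. g *v u = \<phi> u *\<^sub>R x" "\<And>u. u \<in> C \<Longrightarrow> \<phi> u > 0"
proof -
  obtain h g k s where h: "\<And>t :: nat. h t \<in> G" "(\<lambda>t. h t /\<^sub>R norm (h t)) \<longlonglongrightarrow> g" "g \<in> rays" "g \<noteq> 0"
    "k \<in> C" and s: "s > 0" "g *v k = s *\<^sub>R x"
    by (rule boundary_sequence[OF x]) blast
  have "g *v k \<notin> C"
  proof
    assume "g *v k \<in> C"
    then have "inverse s *\<^sub>R (g *v k) \<in> C" using s by (intro scale) auto
    then show False using s x(2) by simp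
  qed
  then obtain \<psi> where \<psi>: "linear \<psi>" "\<And>u. g *v u = \<psi> u *\<^sub>R (g *v k)" "\<And>u. u \<in> C \<Longrightarrow> \<psi> u > 0"
    using rank_one[OF h(3-5)] by metis
  show ?thesis
  proof (rule that[OF h(1-4), of "\<lambda>u. \<psi> u * s"])
    show "linear (\<lambda>u. \<psi> u * s)"
      using \<psi>(1) by (intro linearI) (simp_all add: linear_add linear_scale algebra_simps)
    show "g *v u = (\<psi> u * s) *\<^sub>R x" for u using \<psi>(2)[of u] s by simp
    show "\<psi> u * s > 0" if "u \<in> C" for u using \<psi>(3)[OF that] s by simp
  qed
qed

text \<open>The inverses of group elements attracting to \<open>y\<close> have a normalised limit
  \<open>g\<close>. Its product with the attracting limit is scalar in either order, yet of rank at
  most one, hence zero; so \<open>g\<close> kills \<open>y\<close>.\<close>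

lemma repelling:
  assumes y: "y \<in> closure C" "y \<notin> C" "y \<noteq> 0"
  obtains g x \<phi> where "g \<in> rays" "x \<in> closure C" "x \<notin> C" "x \<noteq> 0"
    "linear \<phi>" "\<And>u. g *v u = \<phi> u *\<^sub>R x" "\<And>u. u \<in> C \<Longrightarrow> \<phi> u > 0" "\<phi> y = 0"
proof -
  obtain d h \<psi> where d: "\<And>t :: nat. d t \<in> G" "(\<lambda>t. d t /\<^sub>R norm (d t)) \<longlonglongrightarrow> h" "h \<in> rays" "h \<noteq> 0"
    and \<psi>: "linear \<psi>" "\<And>u. h *v u = \<psi> u *\<^sub>R y" "\<And>u. u \<in> C \<Longrightarrow> \<psi> u > 0"
    by (rule attracting[OF y]) (rule that; (assumption | blast))
  obtain c where c: "\<And>t. c t \<in> G" "\<And>t. d t ** c t = mat 1" "\<And>t. c t ** d t = mat 1"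
    using bchoice[of UNIV "\<lambda>t c. c \<in> G \<and> d t ** c = mat 1 \<and> c ** d t = mat 1"] inverse[OF d(1)]
    by auto
  obtain g r where g: "g \<in> rays" "g \<noteq> 0" "strict_mono r"
    "(\<lambda>t. c (r t) /\<^sub>R norm (c (r t))) \<longlonglongrightarrow> g"
    by (rule convergent_subsequence[OF c(1)]) (rule that; (assumption | blast))
  have hr: "(\<lambda>t. d (r t) /\<^sub>R norm (d (r t))) \<longlonglongrightarrow> h"
    using LIMSEQ_subseq_LIMSEQ[OF d(2) g(3)] by (simp add: o_def)
  \<comment> \<open>The normalised element times its normalised inverse is this scalar.\<close>
  define n where "n t = inverse (norm (c (r t))) * inverse (norm (d (r t)))" for t
  have lim: "(\<lambda>t. n t *\<^sub>R u) \<longlonglongrightarrow> g *v (h *v u)" "(\<lambda>t. n t *\<^sub>R u) \<longlonglongrightarrow> h *v (g *v u)" for u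
  proof -
    have "(c (r t) /\<^sub>R norm (c (r t))) *v ((d (r t) /\<^sub>R norm (d (r t))) *v u) = n t *\<^sub>R u"
      "(d (r t) /\<^sub>R norm (d (r t))) *v ((c (r t) /\<^sub>R norm (c (r t))) *v u) = n t *\<^sub>R u" for t
    proof -
      have "c (r t) *v (d (r t) *v u) = u" "d (r t) *v (c (r t) *v u) = u"
        using c(2,3)[of "r t"] by (simp_all add: matrix_vector_mul_assoc)
      then show "(c (r t) /\<^sub>R norm (c (r t))) *v ((d (r t) /\<^sub>R norm (d (r t))) *v u) = n t *\<^sub>R u"
        "(d (r t) /\<^sub>R norm (d (r t))) *v ((c (r t) /\<^sub>R norm (c (r t))) *v u) = n t *\<^sub>R u"
        by (simp_all add: n_def scaleR_matrix_vector_assoc[symmetric] matrix_vector_mult_scaleR mult.commute)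
    qed
    moreover have "(\<lambda>t. (c (r t) /\<^sub>R norm (c (r t))) *v ((d (r t) /\<^sub>R norm (d (r t))) *v u)) \<longlonglongrightarrow> g *v (h *v u)"
      "(\<lambda>t. (d (r t) /\<^sub>R norm (d (r t))) *v ((c (r t) /\<^sub>R norm (c (r t))) *v u)) \<longlonglongrightarrow> h *v (g *v u)"
      by (intro tendsto_matrix_vector g(4) hr tendsto_const)+
    ultimately show "(\<lambda>t. n t *\<^sub>R u) \<longlonglongrightarrow> g *v (h *v u)" "(\<lambda>t. n t *\<^sub>R u) \<longlonglongrightarrow> h *v (g *v u)"
      by simp_all
  qed
  have gh: "g *v (h *v u) = \<psi> u *\<^sub>R (g *v y)" for u
    by (simp add: \<psi>(2) matrix_vector_mult_scaleR)
  \<comment> \<open>The product is a multiple of the identity with image in the line of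
    \<open>g *v y\<close>, which is not the whole space; so the multiple is 0.\<close>
  have zero: "g *v (h *v u) = 0" for u
  proof -
    have "\<exists>w. w \<notin> span {g *v y}"
    proof (rule ccontr)
      assume "\<not> ?thesis"
      then have "span {g *v y} = UNIV" by auto
      then have "dim (UNIV :: (real ^ 'd) set) = dim {g *v y}" by (metis dim_span)
      also have "\<dots> \<le> card {g *v y}" by (rule dim_le_card) (auto simp: span_superset)
      finally show False using dim by (simp add: dim_UNIV)
    qed
    then obtain w where w: "w \<notin> span {g *v y}" by blast
    then have "w \<noteq> 0" using span_0 by blast
    have "(\<lambda>t. (n t *\<^sub>R w) \<bullet> w / (w \<bullet> w)) \<longlonglongrightarrow> (g *v (h *v w)) \<bullet> w / (w \<bullet> w)"
      using lim(1)[of w] \<open>w \<noteq> 0\<close> by (intro tendsto_intros) auto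
    then have n: "n \<longlonglongrightarrow> (g *v (h *v w)) \<bullet> w / (w \<bullet> w)" (is "_ \<longlonglongrightarrow> ?c") using \<open>w \<noteq> 0\<close> by simp
    have eq: "g *v (h *v u) = ?c *\<^sub>R u" for u
      by (rule LIMSEQ_unique[OF lim(1) tendsto_scaleR[OF n tendsto_const]])
    have "?c = 0"
    proof (rule ccontr)
      assume "?c \<noteq> 0"
      then have "w = inverse ?c *\<^sub>R \<psi> w *\<^sub>R (g *v y)" using eq[of w] gh[of w] by simp
      also have "\<dots> \<in> span {g *v y}" by (intro span_scale span_base) auto
      finally show False using w by blast
    qed
    then show ?thesis using eq[of u] by simp
  qed
  then have hg: "h *v (g *v u) = 0" for u
    using LIMSEQ_unique[OF lim(1)[of u] lim(2)[of u]] by simp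
  obtain k where k: "k \<in> C" using C_ne by blast
  have gy: "g *v y = 0" using zero[of k] gh[of k] \<psi>(3)[OF k] by simp
  \<comment> \<open>The limit \<open>h\<close> kills the image of \<open>g\<close> but no vector of
    the cone. Hence \<open>g *v k\<close> is on the boundary and \<open>rank_one\<close> applies to
    \<open>g\<close>.\<close>
  have "g *v k \<notin> C"
  proof
    assume "g *v k \<in> C"
    then have "\<psi> (g *v k) > 0" by (rule \<psi>(3))
    then show False using hg[of k] \<psi>(2) y(3) by simp
  qed
  then obtain \<phi> where \<phi>: "linear \<phi>" "\<And>u. g *v u = \<phi> u *\<^sub>R (g *v k)" "\<And>u. u \<in> C \<Longrightarrow> \<phi> u > 0"
    using rank_one[OF g(1,2) k] by metis
  have x: "g *v k \<noteq> 0" by (rule rays_nonzero[OF g(1,2) k])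
  show ?thesis
  proof (rule that[OF g(1) _ \<open>g *v k \<notin> C\<close> x \<phi>])
    show "g *v k \<in> closure C" using rays_closure[OF g(1)] k closure_subset by blast
    show "\<phi> y = 0" using \<phi>(2)[of y] gy x by simp
  qed
qed

section \<open>Invariant subspaces, invariant rays and the commutant\<close>

lemma line_exits:
  assumes c: "c \<in> C" and z: "z \<noteq> 0"
  obtains t where "t \<noteq> 0" "c + t *\<^sub>R z \<in> closure C" "c + t *\<^sub>R z \<notin> C"
proof -
  \<comment> \<open>A line inside the cone, shrunk towards the origin, would put all multiples of
    \<open>z\<close> into the closed cone.\<close>
  have "\<exists>t. c + t *\<^sub>R z \<notin> C"
  proof (rule ccontr)
    assume "\<not> ?thesis"
    then have all: "c + t *\<^sub>R z \<in> C" for t by blast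
    have cl: "s *\<^sub>R z \<in> closure C" for s
    proof -
      have "inverse (real (Suc n)) *\<^sub>R c + s *\<^sub>R z \<in> C" for n
      proof -
        have "inverse (real (Suc n)) *\<^sub>R (c + (real (Suc n) * s) *\<^sub>R z) \<in> C" by (intro scale all) auto
        moreover have "inverse (real (Suc n)) * (real (Suc n) * s) = s"
          by (simp only: mult.assoc[symmetric]) simp
        ultimately show ?thesis by (simp only: scaleR_add_right scaleR_scaleR)
      qed
      moreover have "(\<lambda>n. inverse (real (Suc n)) *\<^sub>R c + s *\<^sub>R z) \<longlonglongrightarrow> 0 *\<^sub>R c + s *\<^sub>R z"
        by (intro tendsto_intros LIMSEQ_inverse_real_of_nat)
      ultimately show ?thesis
        unfolding closure_sequential
        by (intro exI[of _ "\<lambda>n. inverse (real (Suc n)) *\<^sub>R c + s *\<^sub>R z"]) simp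
    qed
    then show False using sharp[of z] cl[of 1] cl[of "- 1"] z by simp
  qed
  then obtain t0 where t0: "c + t0 *\<^sub>R z \<notin> C" by blast
  let ?S = "closed_segment c (c + t0 *\<^sub>R z)"
  have "?S \<inter> frontier C \<noteq> {}"
    by (rule connected_Int_frontier) (use c t0 in auto)
  then obtain p u where p: "p = (1 - u) *\<^sub>R c + u *\<^sub>R (c + t0 *\<^sub>R z)" "p \<in> frontier C"
    by (auto simp: closed_segment_def)
  then have "p = c + (u * t0) *\<^sub>R z" by (simp add: algebra_simps)
  moreover have "p \<in> closure C" "p \<notin> C"
    using p(2) open_C by (auto simp: frontier_def interior_open)
  ultimately show ?thesis using that[of "u * t0"] c by (cases "u * t0 = 0") auto
qed

text \<open>The line from \<open>w\<close> in any direction \<open>z\<close> leaves the cone at a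
  boundary point. If nonzero, this point spans the image of a rank one limit that does not kill
  \<open>w\<close>; so it lies in \<open>W\<close>, and \<open>z\<close> with it.\<close>

lemma invariant_meets_cone:
  assumes W: "subspace W" "\<And>g x. g \<in> G \<Longrightarrow> x \<in> W \<Longrightarrow> g *v x \<in> W" and w: "w \<in> W" "w \<in> C"
  shows "W = UNIV"
proof -
  have "z \<in> W" for z
  proof (cases "z = 0")
    case True
    then show ?thesis using W(1) subspace_0 by blast
  next
    case False
    then obtain t where t: "t \<noteq> 0" "w + t *\<^sub>R z \<in> closure C" "w + t *\<^sub>R z \<notin> C"
      using line_exits[OF w(2)] by blast
    have "w + t *\<^sub>R z \<in> W"
    proof (cases "w + t *\<^sub>R z = 0")
      case False
      then obtain g \<phi> where g: "g \<in> rays" "g *v w = \<phi> w *\<^sub>R (w + t *\<^sub>R z)" "\<phi> w > (0::real)"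
        using attracting[OF t(2,3)] w(2) by metis
      then have "inverse (\<phi> w) *\<^sub>R (g *v w) \<in> W"
        using rays_subspace[OF g(1) W w(1)] W(1) subspace_scale by blast
      then show ?thesis using g by simp
    qed (use W(1) subspace_0 in simp)
    then have "inverse t *\<^sub>R ((w + t *\<^sub>R z) - w) \<in> W"
      using W(1) w(1) by (intro subspace_scale subspace_diff)
    then show ?thesis using t(1) by simp
  qed
  then show ?thesis by blast
qed

text \<open>\<open>W\<close> misses the cone. A rank one limit vanishing at a boundary point
  \<open>c + t w\<close> does not vanish at \<open>w\<close>, so its image vector \<open>x\<close>
  is in \<open>W\<close>. The sums \<open>x + h x\<close> are in \<open>W\<close> too, hence outside
  the cone, and \<open>strict\<close> makes the ray of \<open>x\<close> invariant.\<close>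

lemma invariant_boundary_ray:
  assumes W: "subspace W" "\<And>g x. g \<in> G \<Longrightarrow> x \<in> W \<Longrightarrow> g *v x \<in> W" and ne: "W \<noteq> {0}" "W \<noteq> UNIV"
  obtains x where "x \<noteq> 0" "x \<in> closure C" "\<And>g. g \<in> G \<Longrightarrow> \<exists>r>0. g *v x = r *\<^sub>R x"
proof -
  have disj: "w \<notin> C" if "w \<in> W" for w using invariant_meets_cone[OF W that] ne by blast
  obtain w where w: "w \<in> W" "w \<noteq> 0" using ne W(1) subspace_0 by blast
  obtain c where c: "c \<in> C" using C_ne by blast
  obtain t where t: "t \<noteq> 0" "c + t *\<^sub>R w \<in> closure C" "c + t *\<^sub>R w \<notin> C"
    using line_exits[OF c w(2)] by blast
  have "c + t *\<^sub>R w \<noteq> 0"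
  proof
    assume "c + t *\<^sub>R w = 0"
    then have "c = (- t) *\<^sub>R w" by (simp add: eq_neg_iff_add_eq_0)
    then have "c \<in> W" using W(1) w(1) subspace_scale by blast
    then show False using disj c by blast
  qed
  then obtain g x \<phi> where g: "g \<in> rays" "x \<in> closure C" "x \<notin> C" "x \<noteq> 0"
    and \<phi>: "linear \<phi>" "\<And>u. g *v u = \<phi> u *\<^sub>R x" "\<And>u. u \<in> C \<Longrightarrow> \<phi> u > 0" "\<phi> (c + t *\<^sub>R w) = 0"
    using repelling[OF t(2,3)] by metis
  have "\<phi> w \<noteq> 0"
    using \<phi>(3)[OF c] \<phi>(4) by (auto simp: linear_add[OF \<phi>(1)] linear_scale[OF \<phi>(1)])
  then have "x = inverse (\<phi> w) *\<^sub>R (g *v w)" by (simp add: \<phi>(2))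
  then have xW: "x \<in> W" using rays_subspace[OF g(1) W w(1)] W(1) subspace_scale by blast
  have "\<exists>r>0. h *v x = r *\<^sub>R x" if h: "h \<in> G" for h
  proof (rule strict)
    show "h *v x \<in> closure C" using preserves_closure[OF preserves[OF h]] g(2) by blast
    show "x + h *v x \<notin> C" using disj W xW h subspace_add by blast
    show "h *v x \<noteq> 0"
    proof
      assume "h *v x = 0"
      moreover obtain h' where "h' ** h = mat 1" using inverse[OF h] by blast
      ultimately show False
        using g(4) by (metis matrix_vector_mul_assoc matrix_vector_mul_lid matrix_vector_mult_0_right)
    qed
  qed (use g in auto)
  then show ?thesis using that g by blast
qed

text \<open>If the rays differed, \<open>x + y\<close> would be in the cone, and the invariant span
  of \<open>x\<close> and \<open>y\<close>, of dimension at most 2, would be the whole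
  space.\<close>

lemma invariant_ray_unique:
  assumes x: "x \<noteq> 0" "x \<in> closure C" "\<And>g. g \<in> G \<Longrightarrow> \<exists>r>0. g *v x = r *\<^sub>R x"
    and y: "y \<noteq> 0" "y \<in> closure C" "\<And>g. g \<in> G \<Longrightarrow> \<exists>r>0. g *v y = r *\<^sub>R y"
  shows "\<exists>r>0. y = r *\<^sub>R x"
proof (rule strict)
  show "x + y \<notin> C"
  proof
    assume xy: "x + y \<in> C"
    have "g *v z \<in> span {x, y}" if g: "g \<in> G" and z: "z \<in> span {x, y}" for g z
    proof -
      have "g *v z \<in> (*v) g ` span {x, y}" using z by blast
      also have "\<dots> = span ((*v) g ` {x, y})" by (rule linear_span_image[symmetric]) simp
      also have "\<dots> \<subseteq> span {x, y}"
      proof (rule span_minimal)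
        obtain r s where "g *v x = r *\<^sub>R x" "g *v y = s *\<^sub>R y" using x(3)[OF g] y(3)[OF g] by blast
        moreover have "r *\<^sub>R x \<in> span {x, y}" "s *\<^sub>R y \<in> span {x, y}"
          by (intro span_scale span_base; simp)+
        ultimately show "(*v) g ` {x, y} \<subseteq> span {x, y}" by simp
      qed simp
      finally show ?thesis .
    qed
    moreover have "x + y \<in> span {x, y}" by (intro span_add span_base) auto
    ultimately have "span {x, y} = UNIV" using xy by (intro invariant_meets_cone) auto
    then have "dim (UNIV :: (real ^ 'd) set) = dim {x, y}" by (metis dim_span)
    also have "\<dots> \<le> card {x, y}" by (rule dim_le_card) (auto simp: span_superset)
    also have "\<dots> \<le> 2" by (simp add: card_insert_if)
    finally show False using dim by (simp add: dim_UNIV)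
  qed
qed (use assms in auto)

text \<open>\<open>H\<close> normalises \<open>G\<close>, so it maps the \<open>G\<close>-invariant
  ray in the closed cone to another such ray; by uniqueness the ray is fixed by
  \<open>H\<close>.\<close>

lemma irreducible:
  assumes H: "\<And>\<gamma> x. \<gamma> \<in> H \<Longrightarrow> x \<in> C \<Longrightarrow> \<gamma> *v x \<in> C" "\<And>\<gamma>. \<gamma> \<in> H \<Longrightarrow> invertible \<gamma>"
    and norm: "\<And>\<gamma> g. \<gamma> \<in> H \<Longrightarrow> g \<in> G \<Longrightarrow> \<exists>g'\<in>G. g ** \<gamma> = \<gamma> ** g'"
    and no_fix: "\<And>x. x \<noteq> 0 \<Longrightarrow> (\<And>\<gamma>. \<gamma> \<in> H \<Longrightarrow> \<exists>r>0. \<gamma> *v x = r *\<^sub>R x) \<Longrightarrow> False"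
    and W: "subspace W" "\<And>g x. g \<in> G \<Longrightarrow> x \<in> W \<Longrightarrow> g *v x \<in> W"
  shows "W = {0} \<or> W = UNIV"
proof (rule ccontr)
  assume "\<not> ?thesis"
  then obtain x where x: "x \<noteq> 0" "x \<in> closure C" "\<And>g. g \<in> G \<Longrightarrow> \<exists>r>0. g *v x = r *\<^sub>R x"
    using invariant_boundary_ray[OF W] by metis
  have "\<exists>r>0. \<gamma> *v x = r *\<^sub>R x" if \<gamma>: "\<gamma> \<in> H" for \<gamma>
  proof (rule invariant_ray_unique[OF x])
    show "\<gamma> *v x \<noteq> 0"
      using H(2)[OF \<gamma>] x(1) inj_matrix_vector_mult[of \<gamma>]
      by (metis injD matrix_vector_mult_0_right)
    show "\<gamma> *v x \<in> closure C" using preserves_closure[OF H(1)[OF \<gamma>]] x(2) by blast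
    fix g assume "g \<in> G"
    then obtain g' where g': "g' \<in> G" "g ** \<gamma> = \<gamma> ** g'" using norm[OF \<gamma>] by blast
    obtain r where r: "r > 0" "g' *v x = r *\<^sub>R x" using x(3)[OF g'(1)] by blast
    have "g *v (\<gamma> *v x) = \<gamma> *v (g' *v x)" using g'(2) by (simp add: matrix_vector_mul_assoc)
    then show "\<exists>r>0. g *v (\<gamma> *v x) = r *\<^sub>R (\<gamma> *v x)"
      using r by (auto simp: matrix_vector_mult_scaleR)
  qed
  then show False using no_fix x(1) by blast
qed

text \<open>\<open>f\<close> also commutes with limits of rescaled group elements. A boundary vector
  spanning the image of a rank one limit is therefore an eigenvector, with real eigenvalue, and
  irreducibility makes its eigenspace everything.\<close>

lemma schur:
  assumes irr: "\<And>W. subspace W \<Longrightarrow> (\<And>g x. g \<in> G \<Longrightarrow> x \<in> W \<Longrightarrow> g *v x \<in> W) \<Longrightarrow> W = {0} \<or> W = UNIV"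
    and f: "linear f" "\<And>g x. g \<in> G \<Longrightarrow> f (g *v x) = g *v f x"
  obtains c where "\<And>x. f x = c *\<^sub>R x"
proof -
  obtain k where k: "k \<in> C" using C_ne by blast
  \<comment> \<open>A direction off the line of \<open>k\<close> makes the exit point
    nonzero.\<close>
  have "\<exists>z. z \<notin> span {k}"
  proof (rule ccontr)
    assume "\<not> ?thesis"
    then have "span {k} = UNIV" by auto
    then have "dim (UNIV :: (real ^ 'd) set) = dim {k}" by (metis dim_span)
    also have "\<dots> \<le> card {k}" by (rule dim_le_card) (auto simp: span_superset)
    finally show False using dim by (simp add: dim_UNIV)
  qed
  then obtain z where z: "z \<notin> span {k}" by blast
  then have "z \<noteq> 0" using span_0 by blast
  then obtain t where t: "t \<noteq> 0" "k + t *\<^sub>R z \<in> closure C" "k + t *\<^sub>R z \<notin> C"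
    by (rule line_exits[OF k])
  let ?x = "k + t *\<^sub>R z"
  have "?x \<noteq> 0"
  proof
    assume "?x = 0"
    then have "t *\<^sub>R z = - k" by (simp add: eq_neg_iff_add_eq_0 add.commute)
    then have "z = inverse t *\<^sub>R (- k)" using t(1) by (metis left_inverse scaleR_one scaleR_scaleR)
    also have "\<dots> \<in> span {k}" by (intro span_scale span_neg span_base) auto
    finally show False using z by blast
  qed
  then obtain g \<phi> where g: "g \<in> rays" "\<And>u. g *v u = \<phi> u *\<^sub>R ?x" "\<phi> k > 0"
    using attracting[OF t(2,3)] k by metis
  have comm: "f (g *v u) = g *v f u" for u
  proof -
    have cont: "continuous_on UNIV f"
      using f(1) by (simp add: linear_continuous_on linear_conv_bounded_linear)
    have "closed {h. f (h *v u) = h *v f u}"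
      by (intro closed_Collect_eq continuous_on_mult_vec
          continuous_on_compose2[OF cont continuous_on_mult_vec]) auto
    moreover have "{c *\<^sub>R h | c h. c > 0 \<and> h \<in> G} \<subseteq> {h. f (h *v u) = h *v f u}"
      by (auto simp: scaleR_matrix_vector_assoc[symmetric] linear_scale[OF f(1)] f(2))
    ultimately have "rays \<subseteq> {h. f (h *v u) = h *v f u}"
      unfolding rays_def by (rule closure_minimal[rotated])
    then show ?thesis using g(1) by blast
  qed
  define c where "c = \<phi> (f k) / \<phi> k"
  have "\<phi> k *\<^sub>R f ?x = \<phi> (f k) *\<^sub>R ?x"
    using comm[of k] by (simp only: g(2) linear_scale[OF f(1)])
  then have fx: "f ?x = c *\<^sub>R ?x"
    using g(3) unfolding c_def by (metis divide_inverse_commute left_inverse less_irrefl scaleR_one scaleR_scaleR)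
  let ?W = "{x. f x = c *\<^sub>R x}"
  have "?W = {0} \<or> ?W = UNIV"
  proof (rule irr)
    show "subspace ?W"
      using f(1) by (auto simp: subspace_def linear_0 linear_add linear_scale scaleR_add_right)
    show "h *v x \<in> ?W" if "h \<in> G" "x \<in> ?W" for h x
      using that f(2) by (simp add: matrix_vector_mult_scaleR)
  qed
  then have "?W = UNIV" using fx \<open>?x \<noteq> 0\<close> by blast
  then show ?thesis using that by blast
qed

end

section \<open>The cone over a divided strictly convex domain\<close>

text \<open>Unlike \<open>cone_over\<close> it omits the origin, so that it is open exactly when
  \<open>\<Omega>\<close> is.\<close>

definition ray_cone :: "'d::finite psphere set \<Rightarrow> (real ^ 'd) set" where
  "ray_cone \<Omega> = {v. v \<noteq> 0 \<and> ray v \<in> \<Omega>}"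

lemma ray_scale: "v \<noteq> 0 \<Longrightarrow> r > 0 \<Longrightarrow> ray (r *\<^sub>R v) = ray v"
  by (subst ray_eq_iff) auto

lemma antipode_ray:
  assumes "v \<noteq> 0"
  shows "antipode (ray v) = ray (- v)"
proof -
  have "ray (rep_ray (ray v)) = ray v" by (rule ray_rep_ray)
  then obtain r where r: "r > 0" "rep_ray (ray v) = r *\<^sub>R v"
    using assms by (auto simp: ray_eq_iff rep_ray_nonzero)
  show ?thesis
    unfolding antipode_def r(2) using ray_scale[of "- v" r] assms r(1) by simp
qed

lemma open_ray_cone_iff: "open (ray_cone U) \<longleftrightarrow> open U"
  by (simp add: open_psphere_def ray_cone_def)

lemma continuous_on_ray: "continuous_on (- {0}) ray"
proof (subst continuous_on_open_vimage)
  show "\<forall>B. open B \<longrightarrow> open (ray -` B \<inter> - {0} :: (real ^ 'd) set)"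
  proof (intro allI impI)
    fix B :: "'d psphere set" assume "open B"
    moreover have "ray -` B \<inter> - {0} = {v. v \<noteq> 0 \<and> ray v \<in> B}" by auto
    ultimately show "open (ray -` B \<inter> - {0} :: (real ^ 'd) set)"
      by (simp only: open_psphere_def)
  qed
qed auto

lemma ray_cone_scale: "x \<in> ray_cone \<Omega> \<Longrightarrow> r > 0 \<Longrightarrow> r *\<^sub>R x \<in> ray_cone \<Omega>"
  by (auto simp: ray_cone_def ray_scale)

lemma ray_in_closure:
  assumes "x \<in> closure (ray_cone \<Omega>)" "x \<noteq> 0"
  shows "ray x \<in> closure \<Omega>"
proof (rule ccontr)
  assume "ray x \<notin> closure \<Omega>"
  moreover have "open (ray_cone (- closure \<Omega>))" by (subst open_ray_cone_iff) auto
  ultimately have "ray_cone (- closure \<Omega>) \<inter> ray_cone \<Omega> \<noteq> {}"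
    using assms open_Int_closure_eq_empty[of "ray_cone (- closure \<Omega>)" "ray_cone \<Omega>"]
    by (auto simp: ray_cone_def)
  then show False using closure_subset[of \<Omega>] by (auto simp: ray_cone_def)
qed

lemma sphere_image_memD:
  assumes "subspace W" "v \<noteq> 0" "ray v \<in> sphere_image W"
  shows "v \<in> W"
proof -
  obtain u where u: "u \<in> W" "u \<noteq> 0" "ray v = ray u"
    using assms(3) by (auto simp: sphere_image_def)
  then obtain r where "v = r *\<^sub>R u" using assms(2) by (auto simp: ray_eq_iff)
  then show ?thesis using u assms(1) subspace_scale by blast
qed

lemma open_ray_image:
  assumes "open U" "0 \<notin> U" "\<And>x r. x \<in> U \<Longrightarrow> r > 0 \<Longrightarrow> r *\<^sub>R x \<in> U"
  shows "open (ray ` U)"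
proof -
  have "ray_cone (ray ` U) = U"
  proof
    show "ray_cone (ray ` U) \<subseteq> U"
    proof
      fix v assume "v \<in> ray_cone (ray ` U)"
      then obtain u where u: "v \<noteq> 0" "u \<in> U" "ray v = ray u" by (auto simp: ray_cone_def)
      then obtain r where "r > 0" "v = r *\<^sub>R u" using assms(2) by (metis ray_eq_iff)
      then show "v \<in> U" using assms(3) u by blast
    qed
  qed (use assms(2) in \<open>auto simp: ray_cone_def\<close>)
  then show ?thesis using assms(1) by (metis open_ray_cone_iff)
qed

section \<open>Convexity of the cone, from arcs of great circles\<close>

lemma independent_pair:
  fixes v w :: "'a::real_vector"
  assumes "v \<noteq> 0" "w \<noteq> 0" "\<And>r. r > 0 \<Longrightarrow> w \<noteq> r *\<^sub>R v" "\<And>r. r > 0 \<Longrightarrow> w \<noteq> (- r) *\<^sub>R v"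
  shows "v \<noteq> w" "independent {v, w}"
proof -
  have "w \<notin> span {v}"
  proof
    assume "w \<in> span {v}"
    then obtain r where r: "w = r *\<^sub>R v" by (auto simp: span_singleton)
    then show False using assms(2) assms(3,4)[of "\<bar>r\<bar>"] by (cases "r > 0") (auto simp: not_less le_less)
  qed
  then show "v \<noteq> w" using span_base[of v "{v}"] by auto
  have "independent (insert w {v})"
    using \<open>w \<notin> span {v}\<close> assms(1) real_vector.independent_empty by (intro independent_insertI) auto
  then show "independent {v, w}" by (simp add: insert_commute)
qed

text \<open>Convexity supplies a connected arc in a great circle. Two open sets separate the rays of
  \<open>v\<close> and \<open>w\<close> and omit, within that circle, just the rays of
  \<open>v + w\<close> and \<open>- v\<close>. The latter is excluded by proper convexity, so the
  arc passes through \<open>v + w\<close>.\<close>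

lemma ray_cone_add:
  assumes \<Omega>: "properly_convex \<Omega>" and v: "v \<in> ray_cone \<Omega>" and w: "w \<in> ray_cone \<Omega>"
  shows "v + w \<in> ray_cone \<Omega>"
proof -
  have nz: "v \<noteq> 0" "w \<noteq> 0" and mem: "ray v \<in> \<Omega>" "ray w \<in> \<Omega>"
    using v w by (auto simp: ray_cone_def)
  have anti: "ray (- v) \<notin> \<Omega>"
    using \<Omega> mem(1) closure_subset[of \<Omega>] antipode_ray[OF nz(1)] by (force simp: properly_convex_def)
  have neg: "w \<noteq> (- r) *\<^sub>R v" if "r > 0" for r
    using anti mem(2) ray_scale[of "- v" r] nz(1) that by auto
  show ?thesis
  proof (cases "\<exists>r>0. w = r *\<^sub>R v")
    case True
    then obtain r where "r > 0" "w = r *\<^sub>R v" by blast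
    then have "v + w = (1 + r) *\<^sub>R v" "1 + r > 0" by (simp_all add: scaleR_add_left)
    then show ?thesis using ray_cone_scale[OF v] by simp
  next
    case False
    then have ind: "v \<noteq> w" "independent {v, w}"
      using independent_pair[OF nz _ neg] by blast+
    obtain D T where T: "convex_segment_of D T" "T \<subseteq> \<Omega>" "{ray v, ray w} \<subseteq> T"
      using \<Omega> mem unfolding properly_convex_def sphere_convex_def by blast
    then obtain W where W: "subspace W" "dim W = 2" "D = sphere_image W" and conn: "connected T"
      and TD: "T \<subseteq> D"
      by (auto simp: convex_segment_of_def segment_of_def great_circle_def)
    have "v \<in> W" "w \<in> W"
      using sphere_image_memD[OF W(1)] nz T(3) TD W(3) by auto
    then have Wspan: "W \<subseteq> span {v, w}"
      using card_eq_dim[of "{v, w}" W] W(2) ind by auto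
    \<comment> \<open>On \<open>a v + b w\<close> the functional \<open>f\<close> is
      \<open>b\<close>, and \<open>g\<close> below is \<open>b - a\<close>.\<close>
    obtain f where f: "linear f" "f v = (0 :: real)" "f w = 1"
      using linear_independent_extend[OF ind(2), of "\<lambda>x. if x = v then 0 else 1"] ind(1) by auto
    obtain g where g: "linear g" "g v = (- 1 :: real)" "g w = 1"
      using linear_independent_extend[OF ind(2), of "\<lambda>x. if x = v then - 1 else 1"] ind(1) by auto
    have cont: "continuous_on UNIV f" "continuous_on UNIV g"
      using f(1) g(1) by (simp_all add: linear_continuous_on linear_conv_bounded_linear)
    define U1 where "U1 = {x. f x > 0 \<and> g x > 0}"
    define U2 where "U2 = {x. f x < 0 \<or> g x < 0}"
    have op: "open (ray ` U1)" "open (ray ` U2)"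
    proof -
      have "open U1" "open U2"
        unfolding U1_def U2_def
        by (intro open_Collect_conj open_Collect_disj open_Collect_less cont continuous_on_const)+
      then show "open (ray ` U1)" "open (ray ` U2)"
        by (auto intro!: open_ray_image simp: U1_def U2_def linear_0 linear_scale f(1) g(1) mult_less_0_iff)
    qed
    have disj: "ray ` U1 \<inter> ray ` U2 = {}"
    proof (rule ccontr)
      assume "ray ` U1 \<inter> ray ` U2 \<noteq> {}"
      then obtain x y where xy: "x \<in> U1" "y \<in> U2" "ray x = ray y" by blast
      moreover have "x \<noteq> 0" "y \<noteq> 0"
        using xy f(1) g(1) by (auto simp: U1_def U2_def linear_0)
      ultimately obtain r where "r > 0" "x = r *\<^sub>R y" by (auto simp: ray_eq_iff)
      then show False
        using xy f(1) g(1) by (auto simp: U1_def U2_def linear_scale zero_less_mult_iff)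
    qed
    have "w \<in> U1" "v \<in> U2" using f g by (auto simp: U1_def U2_def)
    then have "\<not> T \<subseteq> ray ` U1 \<union> ray ` U2"
      using connectedD[OF conn op] disj T(3) by blast
    then obtain p where p: "p \<in> T" "p \<notin> ray ` U1" "p \<notin> ray ` U2" by blast
    then obtain x where x: "x \<in> W" "x \<noteq> 0" "p = ray x" using TD W(3) unfolding sphere_image_def by blast
    then have "x \<in> span {v, w}" using Wspan by blast
    then obtain a b where ab: "x = a *\<^sub>R v + b *\<^sub>R w" by (auto simp: span_insert span_singleton algebra_simps)
    have fg: "f x = b" "g x = b - a"
      using f g by (simp_all add: ab linear_add linear_scale)
    have "x \<notin> U1" "x \<notin> U2" using p x by auto
    then have "\<not> (b > 0 \<and> b - a > 0)" "\<not> (b < 0 \<or> b - a < 0)"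
      by (simp_all add: U1_def U2_def fg)
    then have cases: "b \<ge> 0" "b \<ge> a" "b = 0 \<or> b = a" by auto
    have "b \<noteq> 0"
    proof
      assume "b = 0"
      then have "x = (- a) *\<^sub>R (- v)" "- a > 0" using ab cases x(2) by auto
      then have "p = ray (- v)" using x(3) ray_scale[of "- v" "- a"] nz(1) by auto
      then show False using anti p(1) T(2) by blast
    qed
    then have "x = b *\<^sub>R (v + w)" "b > 0" using ab cases by (auto simp: scaleR_add_right)
    then have "p = ray (v + w)" "v + w \<noteq> 0" using x ray_scale[of "v + w" b] by auto
    then show ?thesis using p(1) T(2) by (auto simp: ray_cone_def)
  qed
qed

text \<open>The arc is the continuous image of an open quadrant, hence connected, and it is a proper
  subset because it misses the ray of \<open>- x\<close>.\<close>

lemma open_arc_segment: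
  assumes nz: "x \<noteq> 0" "y \<noteq> 0" and ind: "x \<noteq> y" "independent {x, y}"
  shows "segment_of (sphere_image (span {x, y})) (ray ` {s *\<^sub>R x + t *\<^sub>R y | s t. 0 < s \<and> 0 < t})"
    (is "segment_of ?D (ray ` ?S)")
proof -
  have sub: "?S \<subseteq> span {x, y} - {0}" and inj: "a = s \<and> b = t" if
    "a *\<^sub>R x + b *\<^sub>R y = s *\<^sub>R x + t *\<^sub>R y" for a b s t
  proof -
    obtain f where f: "linear f" "f x = (0 :: real)" "f y = 1"
      using linear_independent_extend[OF ind(2), of "\<lambda>z. if z = x then 0 else 1"] ind(1) by auto
    obtain g where g: "linear g" "g x = (1 :: real)" "g y = 0"
      using linear_independent_extend[OF ind(2), of "\<lambda>z. if z = x then 1 else 0"] ind(1) by auto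
    show "a = s \<and> b = t"
      using arg_cong[OF that, of f] arg_cong[OF that, of g] f g by (simp add: linear_add linear_scale)
    show "?S \<subseteq> span {x, y} - {0}"
    proof clarify
      fix s t :: real assume st: "0 < s" "0 < t"
      have "s *\<^sub>R x + t *\<^sub>R y \<in> span {x, y}"
        by (intro span_add span_scale span_base) auto
      moreover have "f (s *\<^sub>R x + t *\<^sub>R y) \<noteq> 0" using f st by (simp add: linear_add linear_scale)
      ultimately show "s *\<^sub>R x + t *\<^sub>R y \<in> span {x, y} - {0}" using linear_0[OF f(1)] by auto
    qed
  qed
  \<comment> \<open>The premise, meant for \<open>inj\<close>, is discharged by a trivial
    instance.\<close>
  note sub = sub[OF refl]
  have "connected ?S"
  proof -
    have "?S = (\<lambda>p. fst p *\<^sub>R x + snd p *\<^sub>R y) ` ({0<..} \<times> {0<..})" by force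
    moreover have "connected ((\<lambda>p. fst p *\<^sub>R x + snd p *\<^sub>R y) ` ({0<..} \<times> {0<..} :: (real \<times> real) set))"
      by (intro connected_continuous_image continuous_intros connected_Times) auto
    ultimately show ?thesis by simp
  qed
  then have "connected (ray ` ?S)"
    using sub by (intro connected_continuous_image continuous_on_subset[OF continuous_on_ray]) auto
  moreover have "ray ` ?S \<subseteq> ?D" using sub by (auto simp: sphere_image_def)
  moreover have "- x \<in> span {x, y} - {0}"
    using nz span_neg[OF span_base[of x "{x, y}"]] by simp
  then have "ray (- x) \<in> ?D" unfolding sphere_image_def by (rule imageI)
  moreover have "ray (- x) \<notin> ray ` ?S"
  proof
    assume "ray (- x) \<in> ray ` ?S"
    then obtain s t where st: "0 < s" "0 < t" "ray (- x) = ray (s *\<^sub>R x + t *\<^sub>R y)" by blast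
    moreover have "s *\<^sub>R x + t *\<^sub>R y \<noteq> 0" using sub st by blast
    ultimately obtain r where r: "r > 0" "- x = r *\<^sub>R (s *\<^sub>R x + t *\<^sub>R y)"
      using nz by (metis neg_equal_0_iff_equal ray_eq_iff)
    then have "(- 1) *\<^sub>R x + 0 *\<^sub>R y = (r * s) *\<^sub>R x + (r * t) *\<^sub>R y" by (simp add: scaleR_add_right)
    then have "- 1 = r * s" using inj by blast
    then show False using r(1) st(1) mult_pos_pos[of r s] by linarith
  qed
  ultimately have "ray ` ?S \<subset> ?D" "connected (ray ` ?S)" by blast+
  moreover have "great_circle ?D"
    unfolding great_circle_def
    using ind dim_eq_card_independent[OF ind(2)] by (intro exI[of _ "span {x, y}"]) simp
  ultimately show ?thesis by (simp add: segment_of_def)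
qed

locale strictly_convex =
  fixes \<Omega> :: "'d::finite psphere set"
  assumes strictly_convex: "strictly_convex_domain \<Omega>"
begin

abbreviation "C \<equiv> ray_cone \<Omega>"

lemma properly_convex_\<Omega>: "properly_convex \<Omega>" and open_\<Omega>: "open \<Omega>" and \<Omega>_ne: "\<Omega> \<noteq> {}"
  using strictly_convex by (auto simp: strictly_convex_domain_def properly_convex_domain_def)

lemma open_cone: "open C"
  using open_\<Omega> open_ray_cone_iff by blast

lemma cone_ne: "C \<noteq> {}"
proof -
  obtain p where "p \<in> \<Omega>" using \<Omega>_ne by blast
  then have "rep_ray p \<in> C" by (simp add: ray_cone_def rep_ray_nonzero ray_rep_ray)
  then show ?thesis by blast
qed

lemma cone_sharp: "x \<in> closure C \<Longrightarrow> - x \<in> closure C \<Longrightarrow> x = 0"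
  using ray_in_closure[of x \<Omega>] ray_in_closure[of "- x" \<Omega>] antipode_ray[of x] properly_convex_\<Omega>
  by (force simp: properly_convex_def)

text \<open>The interior point \<open>c\<close> absorbs the small difference between
  \<open>y\<close> and a nearby point of the cone.\<close>

lemma cone_add_closure:
  assumes "c \<in> C" "y \<in> closure C"
  shows "c + y \<in> C"
proof -
  obtain e where e: "e > 0" "ball c e \<subseteq> C" using open_cone assms(1) open_contains_ball by blast
  obtain y' where y': "y' \<in> C" "dist y' y < e" using assms(2) e(1) closure_approachable by blast
  have "c + (y - y') \<in> C" using e(2) y'(2) by (auto simp: dist_norm norm_minus_commute subset_iff)
  from ray_cone_add[OF properly_convex_\<Omega> this y'(1)] show ?thesis by simp
qed

lemma closure_cone_add:
  assumes x: "x \<in> closure C" and y: "y \<in> closure C"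
  shows "x + y \<in> closure C"
proof -
  have "(\<lambda>c. c + y) ` closure C \<subseteq> closure C"
    by (rule image_closure_subset)
       (use cone_add_closure[OF _ y] closure_subset in \<open>auto intro!: continuous_intros\<close>)
  then show ?thesis using x by blast
qed

lemma closure_cone_scale:
  assumes x: "x \<in> closure C" and r: "r > 0"
  shows "r *\<^sub>R x \<in> closure C"
proof -
  have "(*\<^sub>R) r ` closure C \<subseteq> closure C"
    by (rule image_closure_subset)
       (use r ray_cone_scale in \<open>auto intro!: continuous_intros closure_subset[THEN subsetD]\<close>)
  then show ?thesis using x by blast
qed

text \<open>If \<open>x\<close> and \<open>y\<close> lay on different rays, the open arc between
  them would miss the cone and be a nontrivial segment in the boundary.\<close>

lemma cone_strict:
  assumes xy: "x \<in> closure C" "y \<in> closure C" and nz: "x \<noteq> 0" "y \<noteq> 0" and sum: "x + y \<notin> C"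
  shows "\<exists>r>0. y = r *\<^sub>R x"
proof (rule ccontr)
  assume neg: "\<not> ?thesis"
  have "y \<noteq> (- r) *\<^sub>R x" if r: "r > 0" for r
  proof
    assume y: "y = (- r) *\<^sub>R x"
    have "inverse r *\<^sub>R y \<in> closure C" using closure_cone_scale[OF xy(2)] r by simp
    then show False using cone_sharp[OF xy(1)] nz(1) r by (simp add: y)
  qed
  then have ind: "x \<noteq> y" "independent {x, y}" using neg independent_pair[OF nz] by blast+
  let ?S = "{s *\<^sub>R x + t *\<^sub>R y | s t. 0 < s \<and> 0 < t}"
  have seg: "segment_of (sphere_image (span {x, y})) (ray ` ?S)"
    by (rule open_arc_segment[OF nz ind])
  have notin: "s *\<^sub>R x + t *\<^sub>R y \<notin> C" if st: "0 < s" "0 < t" for s t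
  proof
    assume c: "s *\<^sub>R x + t *\<^sub>R y \<in> C"
    \<comment> \<open>Scaled by \<open>e\<close>, the point of the arc needs only suitable positive
      multiples of \<open>x\<close> and \<open>y\<close> to become \<open>x + y\<close>, contrary to
      \<open>sum\<close>.\<close>
    define e where "e = inverse (s + t)"
    have e: "e > 0" "e * s + e * t = 1"
      using st by (simp_all add: e_def flip: distrib_left)
    have "e *\<^sub>R (s *\<^sub>R x + t *\<^sub>R y) + ((e * t) *\<^sub>R x + (e * s) *\<^sub>R y) \<in> C"
      using e(1) st xy by (intro cone_add_closure ray_cone_scale[OF c] closure_cone_add closure_cone_scale) auto
    also have "e *\<^sub>R (s *\<^sub>R x + t *\<^sub>R y) + ((e * t) *\<^sub>R x + (e * s) *\<^sub>R y) = (e * s + e * t) *\<^sub>R (x + y)"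
      by (simp add: algebra_simps)
    also have "\<dots> = x + y" by (simp add: e(2))
    finally show False using sum by simp
  qed
  obtain f where f: "linear f" "f x = (0 :: real)" "f y = 1"
    using linear_independent_extend[OF ind(2), of "\<lambda>z. if z = x then 0 else 1"] ind(1) by auto
  obtain g where g: "linear g" "g x = (1 :: real)" "g y = 0"
    using linear_independent_extend[OF ind(2), of "\<lambda>z. if z = x then 1 else 0"] ind(1) by auto
  have "ray ` ?S \<subseteq> frontier \<Omega>"
  proof clarify
    fix s t :: real assume st: "0 < s" "0 < t"
    let ?z = "s *\<^sub>R x + t *\<^sub>R y"
    have "f ?z \<noteq> 0" using f st by (simp add: linear_add linear_scale)
    then have "?z \<noteq> 0" using linear_0[OF f(1)] by auto
    moreover have "?z \<in> closure C" using st xy by (intro closure_cone_add closure_cone_scale)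
    moreover have "?z \<notin> C" using notin st by blast
    ultimately show "ray ?z \<in> frontier \<Omega>"
      using ray_in_closure open_\<Omega> by (auto simp: frontier_def interior_open ray_cone_def)
  qed
  moreover have "ray (1 *\<^sub>R x + 1 *\<^sub>R y) \<noteq> ray (1 *\<^sub>R x + 2 *\<^sub>R y)"
  proof
    assume eq: "ray (1 *\<^sub>R x + 1 *\<^sub>R y) = ray (1 *\<^sub>R x + 2 *\<^sub>R y)"
    have "g (1 *\<^sub>R x + 1 *\<^sub>R y) = 1" "g (1 *\<^sub>R x + 2 *\<^sub>R y) = 1"
      using g by (simp_all add: linear_add linear_scale)
    then have "1 *\<^sub>R x + 1 *\<^sub>R y \<noteq> 0" "1 *\<^sub>R x + 2 *\<^sub>R y \<noteq> 0" using linear_0[OF g(1)] by auto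
    then obtain r where r: "1 *\<^sub>R x + 1 *\<^sub>R y = r *\<^sub>R (1 *\<^sub>R x + 2 *\<^sub>R y)" using eq by (metis ray_eq_iff)
    show False
      using arg_cong[OF r, of f] arg_cong[OF r, of g] f g
      by (simp add: linear_add[OF f(1)] linear_add[OF g(1)] linear_scale[OF f(1)] linear_scale[OF g(1)])
  qed
  moreover have in_arc: "ray (s *\<^sub>R x + t *\<^sub>R y) \<in> ray ` ?S" if "0 < s" "0 < t" for s t
    using that by blast
  moreover have "ray (1 *\<^sub>R x + 1 *\<^sub>R y) \<in> ray ` ?S" by (rule in_arc) auto
  moreover have "ray (1 *\<^sub>R x + 2 *\<^sub>R y) \<in> ray ` ?S" by (rule in_arc) auto
  ultimately show False
    using strictly_convex seg unfolding strictly_convex_domain_def by blast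
qed

end

section \<open>The action on the sphere and a compact fundamental set\<close>

lemma SLpm_nonzero: "g \<in> carrier SLpm \<Longrightarrow> v \<noteq> 0 \<Longrightarrow> g *v v \<noteq> 0"
proof -
  assume g: "g \<in> carrier SLpm" and v: "v \<noteq> 0"
  have inj: "inj ((*v) g)"
    using g by (auto simp: SLpm_def inj_matrix_vector_mult invertible_det_nz)
  show ?thesis using injD[OF inj, of v 0] v by auto
qed

lemma act_mult:
  assumes "A \<in> carrier SLpm" "B \<in> carrier SLpm"
  shows "act (A ** B) p = act A (act B p)"
proof -
  have nz: "B *v rep_ray p \<noteq> 0" by (rule SLpm_nonzero[OF assms(2) rep_ray_nonzero])
  show ?thesis
    using act_ray[OF assms(1) nz] by (simp add: act_def matrix_vector_mul_assoc)
qed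

lemma act_one: "act (mat 1) p = p"
  by (simp add: act_def ray_rep_ray)

lemma SLpm_subgroupD:
  assumes "subgroup \<Gamma> SLpm"
  shows "g \<in> \<Gamma> \<Longrightarrow> g \<in> carrier SLpm" "mat 1 \<in> \<Gamma>" "g \<in> \<Gamma> \<Longrightarrow> h \<in> \<Gamma> \<Longrightarrow> g ** h \<in> \<Gamma>"
    "g \<in> \<Gamma> \<Longrightarrow> \<exists>h\<in>\<Gamma>. g ** h = mat 1 \<and> h ** g = mat 1"
proof -
  interpret S: group "SLpm :: (real ^ 'd ^ 'd) monoid" by (rule group_SLpm)
  show car: "g \<in> carrier SLpm" if "g \<in> \<Gamma>" for g using subgroup.mem_carrier[OF assms that] .
  show "mat 1 \<in> \<Gamma>" using subgroup.one_closed[OF assms] by (simp add: SLpm_def)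
  show "g ** h \<in> \<Gamma>" if "g \<in> \<Gamma>" "h \<in> \<Gamma>"
    using subgroup.m_closed[OF assms that] by (simp add: SLpm_def)
  show "\<exists>h\<in>\<Gamma>. g ** h = mat 1 \<and> h ** g = mat 1" if g: "g \<in> \<Gamma>"
    using subgroup.m_inv_closed[OF assms g] S.r_inv[OF car[OF g]] S.l_inv[OF car[OF g]]
    by (intro bexI[of _ "inv\<^bsub>SLpm\<^esub> g"]) (auto simp: SLpm_def)
qed

lemma orbit_of_act:
  assumes \<Gamma>: "subgroup \<Gamma> SLpm" and g: "g \<in> \<Gamma>"
  shows "orbit_of \<Gamma> (act g p) = orbit_of \<Gamma> p"
proof
  note G = SLpm_subgroupD[OF \<Gamma>]
  show "orbit_of \<Gamma> (act g p) \<subseteq> orbit_of \<Gamma> p"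
  proof
    fix q assume "q \<in> orbit_of \<Gamma> (act g p)"
    then obtain k where k: "k \<in> \<Gamma>" "q = act k (act g p)" by (auto simp: orbit_of_def)
    then have "q = act (k ** g) p" using act_mult[OF G(1)[OF k(1)] G(1)[OF g]] by simp
    then show "q \<in> orbit_of \<Gamma> p" using G(3)[OF k(1) g] by (auto simp: orbit_of_def)
  qed
  obtain h where h: "h \<in> \<Gamma>" "h ** g = mat 1" using G(4)[OF g] by blast
  have "act k p = act (k ** h) (act g p)" if "k \<in> \<Gamma>" for k
    using act_mult[OF G(1)[OF G(3)[OF that h(1)]] G(1)[OF g], of p] h(2)
    by (simp add: matrix_mul_assoc[symmetric])
  then show "orbit_of \<Gamma> p \<subseteq> orbit_of \<Gamma> (act g p)"
    unfolding orbit_of_def using G(3)[OF _ h(1)] by blast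
qed

lemma topspace_orbit_space: "open \<Omega> \<Longrightarrow> topspace (orbit_space \<Gamma> \<Omega>) = orbit_of \<Gamma> ` \<Omega>"
  and openin_orbit_space: "openin (orbit_space \<Gamma> \<Omega>) = orbit_space_open \<Gamma> \<Omega>"
proof -
  show op: "openin (orbit_space \<Gamma> \<Omega>) = orbit_space_open \<Gamma> \<Omega>"
    unfolding orbit_space_def by (rule topology_inverse'[OF istopology_orbit_space_open])
  have "orbit_space_open \<Gamma> \<Omega> (orbit_of \<Gamma> ` \<Omega>)"
  proof -
    have "{p \<in> \<Omega>. orbit_of \<Gamma> p \<in> orbit_of \<Gamma> ` \<Omega>} = \<Omega>" by auto
    then show ?thesis by (simp add: orbit_space_open_def)
  qed
  then show "topspace (orbit_space \<Gamma> \<Omega>) = orbit_of \<Gamma> ` \<Omega>"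
    unfolding topspace_def op by (auto simp: orbit_space_open_def)
qed

text \<open>The orbits of the rays through small balls in the cone form an open cover of the compact
  orbit space; the closed balls of a finite subcover make up \<open>K\<close>.\<close>

lemma compact_fundamental_set:
  fixes \<Omega> :: "'d::finite psphere set"
  assumes \<Omega>: "open \<Omega>" and div: "divides_domain \<Gamma> \<Omega>"
  obtains K where "compact K" "K \<subseteq> ray_cone \<Omega>"
    "\<And>x. x \<in> ray_cone \<Omega> \<Longrightarrow> \<exists>g\<in>\<Gamma>. \<exists>k\<in>K. \<exists>r>0. x = r *\<^sub>R (g *v k)"
proof -
  let ?C = "ray_cone \<Omega>"
  have \<Gamma>: "subgroup \<Gamma> SLpm" and inv: "\<And>g. g \<in> \<Gamma> \<Longrightarrow> act g ` \<Omega> = \<Omega>"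
    and cpt: "compact_space (orbit_space \<Gamma> \<Omega>)"
    using div by (auto simp: divides_domain_def)
  note G = SLpm_subgroupD[OF \<Gamma>]
  \<comment> \<open>The closed balls must fit into the cone, so that a finite union of them is a
    compact subset; the open balls do the covering.\<close>
  have "\<forall>c. \<exists>e. c \<in> ?C \<longrightarrow> e > 0 \<and> cball c e \<subseteq> ?C"
    using \<Omega> open_ray_cone_iff open_contains_cball by metis
  then obtain e where e: "\<And>c. c \<in> ?C \<Longrightarrow> e c > 0" "\<And>c. c \<in> ?C \<Longrightarrow> cball c (e c) \<subseteq> ?C" by metis
  define U where "U c = orbit_of \<Gamma> ` ray ` ball c (e c)" for c
  have bC: "ball c (e c) \<subseteq> ?C" if "c \<in> ?C" for c using e(2)[OF that] ball_subset_cball by blast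
  have orb: "orbit_of \<Gamma> (ray v) \<in> U c \<longleftrightarrow> (\<exists>g\<in>\<Gamma>. \<exists>r>0. r *\<^sub>R (g *v v) \<in> ball c (e c))"
    if c: "c \<in> ?C" and v: "v \<noteq> 0" for c v
  proof
    assume "orbit_of \<Gamma> (ray v) \<in> U c"
    then obtain x where x: "x \<in> ball c (e c)" "orbit_of \<Gamma> (ray v) = orbit_of \<Gamma> (ray x)"
      by (auto simp: U_def)
    have "ray x \<in> orbit_of \<Gamma> (ray x)"
      unfolding orbit_of_def using G(2) act_one by (metis image_eqI)
    then obtain g where g: "g \<in> \<Gamma>" "ray x = act g (ray v)"
      unfolding x(2)[symmetric] by (auto simp: orbit_of_def)
    then have "ray x = ray (g *v v)" using act_ray[OF G(1)[OF g(1)] v] by simp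
    moreover have "x \<noteq> 0" using x(1) bC[OF c] unfolding ray_cone_def by blast
    moreover have "g *v v \<noteq> 0" using SLpm_nonzero[OF G(1)[OF g(1)] v] .
    ultimately obtain r where "r > 0" "x = r *\<^sub>R (g *v v)" by (auto simp: ray_eq_iff)
    then show "\<exists>g\<in>\<Gamma>. \<exists>r>0. r *\<^sub>R (g *v v) \<in> ball c (e c)" using g(1) x(1) by blast
  next
    assume "\<exists>g\<in>\<Gamma>. \<exists>r>0. r *\<^sub>R (g *v v) \<in> ball c (e c)"
    then obtain g r where g: "g \<in> \<Gamma>" "r > 0" "r *\<^sub>R (g *v v) \<in> ball c (e c)" by blast
    have "ray (r *\<^sub>R (g *v v)) = act g (ray v)"
      using ray_scale[OF SLpm_nonzero[OF G(1)[OF g(1)] v] g(2)] act_ray[OF G(1)[OF g(1)] v] by simp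
    then have "orbit_of \<Gamma> (ray v) = orbit_of \<Gamma> (ray (r *\<^sub>R (g *v v)))"
      using orbit_of_act[OF \<Gamma> g(1)] by simp
    then show "orbit_of \<Gamma> (ray v) \<in> U c" using g(3) by (auto simp: U_def)
  qed
  have opn: "openin (orbit_space \<Gamma> \<Omega>) (U c)" if c: "c \<in> ?C" for c
  proof -
    have cont: "continuous_on UNIV (\<lambda>v. r *\<^sub>R (g *v v))" for r and g :: "real ^ 'd ^ 'd"
      by (rule continuous_on_scaleR[OF continuous_on_const
            linear_continuous_on[OF matrix_vector_mul_bounded_linear]])
    have sub: "U c \<subseteq> orbit_of \<Gamma> ` \<Omega>" using bC[OF c] by (auto simp: U_def ray_cone_def)
    \<comment> \<open>The cone over the preimage is a union of preimages of a ball under rescaled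
      group elements, hence open.\<close>
    have "ray_cone {p \<in> \<Omega>. orbit_of \<Gamma> p \<in> U c} =
        ?C \<inter> (\<Union>g\<in>\<Gamma>. \<Union>r\<in>{0<..}. (\<lambda>v. r *\<^sub>R (g *v v)) -` ball c (e c))"
      using orb[OF c] by (auto simp: ray_cone_def Bex_def simp del: mem_ball)
    also have "open \<dots>"
      using \<Omega> by (intro open_Int open_UN ballI open_vimage open_ball cont) (simp add: open_ray_cone_iff)
    finally have "open {p \<in> \<Omega>. orbit_of \<Gamma> p \<in> U c}" by (simp only: open_ray_cone_iff)
    then have "openin (top_of_set \<Omega>) {p \<in> \<Omega>. orbit_of \<Gamma> p \<in> U c}"
      using \<Omega> by (simp add: openin_open_eq)
    then show ?thesis unfolding openin_orbit_space orbit_space_open_def using sub by blast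
  qed
  have cov: "topspace (orbit_space \<Gamma> \<Omega>) \<subseteq> \<Union>(U ` ?C)"
  proof
    fix q assume "q \<in> topspace (orbit_space \<Gamma> \<Omega>)"
    then obtain p where p: "p \<in> \<Omega>" "q = orbit_of \<Gamma> p" using topspace_orbit_space[OF \<Omega>] by auto
    have c: "rep_ray p \<in> ?C" using p(1) by (simp add: ray_cone_def rep_ray_nonzero ray_rep_ray)
    then have "rep_ray p \<in> ball (rep_ray p) (e (rep_ray p))" using e(1) by simp
    then have "q \<in> U (rep_ray p)" using p(2) ray_rep_ray[of p] unfolding U_def by (metis image_eqI)
    then show "q \<in> \<Union>(U ` ?C)" using c by blast
  qed
  have "\<exists>F. finite F \<and> F \<subseteq> U ` ?C \<and> topspace (orbit_space \<Gamma> \<Omega>) \<subseteq> \<Union>F"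
    using cpt[unfolded compact_space_alt, THEN spec, of "U ` ?C"] cov opn by auto
  then obtain I where I: "I \<subseteq> ?C" "finite I" "topspace (orbit_space \<Gamma> \<Omega>) \<subseteq> \<Union>(U ` I)"
    using finite_subset_image by metis
  show ?thesis
  proof
    show "compact (\<Union>c\<in>I. cball c (e c))" using I(2) by (intro compact_UN) auto
    show "(\<Union>c\<in>I. cball c (e c)) \<subseteq> ?C" using e(2) I(1) by blast
    fix x assume x: "x \<in> ?C"
    then have "orbit_of \<Gamma> (ray x) \<in> \<Union>(U ` I)"
      using I(3) topspace_orbit_space[OF \<Omega>] by (auto simp: ray_cone_def)
    then obtain c where c: "c \<in> I" "orbit_of \<Gamma> (ray x) \<in> U c" by blast
    then obtain g r where g: "g \<in> \<Gamma>" "r > 0" "r *\<^sub>R (g *v x) \<in> ball c (e c)"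
      using orb[of c x] I(1) x by (auto simp: ray_cone_def)
    obtain h where h: "h \<in> \<Gamma>" "h ** g = mat 1" using G(4)[OF g(1)] by blast
    have "x = inverse r *\<^sub>R (h *v (r *\<^sub>R (g *v x)))"
      using g(2) h(2) by (simp add: matrix_vector_mult_scaleR matrix_vector_mul_assoc)
    moreover have "r *\<^sub>R (g *v x) \<in> (\<Union>c\<in>I. cball c (e c))" using g(3) c(1) ball_subset_cball by blast
    moreover have "inverse r > 0" using g(2) by simp
    ultimately show "\<exists>g\<in>\<Gamma>. \<exists>k\<in>\<Union>c\<in>I. cball c (e c). \<exists>r>0. x = r *\<^sub>R (g *v k)" using h(1) by blast
  qed
qed

section \<open>Polyhedral reflection groups\<close>

lemma (in group) finite_index_normal_core:
  assumes H: "subgroup H G" and fin: "finite (rcosets H)"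
  obtains N where "N \<lhd> G" "N \<subseteq> H" "finite (rcosets N)"
proof -
  \<comment> \<open>The intersection of all conjugates of \<open>H\<close>.\<close>
  define N where "N = {g \<in> carrier G. \<forall>x\<in>carrier G. x \<otimes> g \<otimes> inv x \<in> H}"
  have conj_mult: "x \<otimes> (a \<otimes> b) \<otimes> inv x = (x \<otimes> a \<otimes> inv x) \<otimes> (x \<otimes> b \<otimes> inv x)"
    if "a \<in> carrier G" "b \<in> carrier G" "x \<in> carrier G" for a b x
    using that by (simp add: m_assoc inv_solve_left)
  have conj_inv: "x \<otimes> inv a \<otimes> inv x = inv (x \<otimes> a \<otimes> inv x)"
    if "a \<in> carrier G" "x \<in> carrier G" for a x
    using that by (simp add: inv_mult_group m_assoc)
  have subN: "subgroup N G"
  proof (rule subgroupI)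
    show "N \<subseteq> carrier G" by (auto simp: N_def)
    have "\<one> \<in> N" using subgroup.one_closed[OF H] by (simp add: N_def)
    then show "N \<noteq> {}" by blast
    show "inv a \<in> N" if "a \<in> N" for a
      using that subgroup.m_inv_closed[OF H] by (auto simp: N_def conj_inv)
    show "a \<otimes> b \<in> N" if "a \<in> N" "b \<in> N" for a b
      using that subgroup.m_closed[OF H] by (auto simp: N_def conj_mult)
  qed
  have "N \<lhd> G"
  proof (rule normal_inv_iff[THEN iffD2], intro conjI subN ballI)
    fix x h assume x: "x \<in> carrier G" and h: "h \<in> N"
    then have hc: "h \<in> carrier G" by (simp add: N_def)
    have "y \<otimes> (x \<otimes> h \<otimes> inv x) \<otimes> inv y \<in> H" if y: "y \<in> carrier G" for y
    proof -
      have "(y \<otimes> x) \<otimes> h \<otimes> inv (y \<otimes> x) \<in> H" using h x y by (simp add: N_def)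
      then show ?thesis using x y hc by (simp add: inv_mult_group m_assoc)
    qed
    then show "x \<otimes> h \<otimes> inv x \<in> N" using x hc by (simp add: N_def)
  qed
  moreover have "N \<subseteq> H"
  proof
    fix g assume "g \<in> N"
    then have g: "g \<in> carrier G" "\<forall>x\<in>carrier G. x \<otimes> g \<otimes> inv x \<in> H" unfolding N_def by blast+
    show "g \<in> H" using bspec[OF g(2) one_closed] g(1) by simp
  qed
  moreover have "finite (rcosets N)"
  proof -
    \<comment> \<open>\<open>F a\<close> is the action of \<open>a\<close> on the cosets of
      \<open>H\<close> from the right. There are finitely many such maps, and \<open>F a\<close>
      determines the coset of \<open>a\<close> modulo \<open>N\<close>.\<close>
    define F where "F a = (\<lambda>Y\<in>rcosets H. Y #> a)" for a
    have HG: "H \<subseteq> carrier G" using subgroup.subset[OF H] .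
    have "F ` carrier G \<subseteq> (rcosets H) \<rightarrow>\<^sub>E (rcosets H)"
    proof clarify
      fix a assume a: "a \<in> carrier G"
      have "Y #> a \<in> rcosets H" if Y: "Y \<in> rcosets H" for Y
      proof -
        obtain x where x: "x \<in> carrier G" "Y = H #> x" using Y by (auto simp: RCOSETS_def)
        then have "Y #> a = H #> (x \<otimes> a)" using HG a by (simp add: coset_mult_assoc)
        then show ?thesis using x a by (auto simp: RCOSETS_def)
      qed
      then show "F a \<in> (rcosets H) \<rightarrow>\<^sub>E (rcosets H)" by (auto simp: F_def)
    qed
    then have finF: "finite (F ` carrier G)"
      using finite_PiE[OF fin, of "\<lambda>_. rcosets H"] fin finite_subset by blast
    have eq: "N #> a = N #> b" if a: "a \<in> carrier G" and b: "b \<in> carrier G" and ab: "F a = F b" for a b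
    proof -
      have "x \<otimes> (a \<otimes> inv b) \<otimes> inv x \<in> H" if x: "x \<in> carrier G" for x
      proof -
        have Hx: "H #> x \<in> rcosets H" using x by (auto simp: RCOSETS_def)
        have "F a (H #> x) = F b (H #> x)" using ab by simp
        then have "H #> (x \<otimes> a) = H #> (x \<otimes> b)"
          using Hx HG x a b by (simp add: F_def coset_mult_assoc)
        moreover have "x \<otimes> a \<in> H #> (x \<otimes> a)" using rcos_self[OF _ H] x a by simp
        ultimately have "x \<otimes> a \<in> H #> (x \<otimes> b)" by simp
        then obtain h where h: "h \<in> H" "x \<otimes> a = h \<otimes> (x \<otimes> b)" by (auto simp: r_coset_def)
        have "x \<otimes> (a \<otimes> inv b) \<otimes> inv x = (x \<otimes> a) \<otimes> inv (x \<otimes> b)"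
          using x a b by (simp add: inv_mult_group m_assoc)
        also have "\<dots> = h" using h HG x b by (auto simp: m_assoc subset_iff)
        finally show ?thesis using h by simp
      qed
      then have "a \<otimes> inv b \<in> N" using a b by (simp add: N_def)
      then have "a \<in> N #> b"
        using a b by (auto simp: r_coset_def m_assoc intro!: bexI[of _ "a \<otimes> inv b"])
      then show ?thesis using repr_independence[OF _ b subN] by simp
    qed
    have "(\<lambda>a. N #> a) ` carrier G \<subseteq>
        (\<lambda>f. N #> (SOME a. a \<in> carrier G \<and> F a = f)) ` (F ` carrier G)"
    proof
      fix Y assume "Y \<in> (\<lambda>a. N #> a) ` carrier G"
      then obtain a where a: "a \<in> carrier G" "Y = N #> a" by blast
      let ?b = "SOME b. b \<in> carrier G \<and> F b = F a"
      have "?b \<in> carrier G \<and> F ?b = F a" by (rule someI[of _ a]) (use a in simp)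
      then have "Y = N #> ?b" using a eq[of a ?b] by simp
      then show "Y \<in> (\<lambda>f. N #> (SOME a. a \<in> carrier G \<and> F a = f)) ` (F ` carrier G)"
        using a(1) by blast
    qed
    then have "finite ((\<lambda>a. N #> a) ` carrier G)" using finF finite_subset by blast
    then show ?thesis by (simp add: RCOSETS_def UNION_singleton_eq_range)
  qed
  ultimately show ?thesis using that by blast
qed

text \<open>Normality is recorded as commutation past elements of \<open>\<Gamma>\<close> on either
  side, finite index as a finite set \<open>R\<close> of coset representatives.\<close>

lemma SLpm_normal_core:
  assumes \<Gamma>: "subgroup \<Gamma> SLpm" and \<Delta>: "subgroup \<Delta> (SLpm\<lparr>carrier := \<Gamma>\<rparr>)"
    and fin: "finite (rcosets\<^bsub>SLpm\<lparr>carrier := \<Gamma>\<rparr>\<^esub> \<Delta>)"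
  obtains N R where "N \<subseteq> \<Delta>" "N \<subseteq> \<Gamma>" "subgroup N SLpm"
    "\<And>g x. g \<in> N \<Longrightarrow> x \<in> \<Gamma> \<Longrightarrow> \<exists>h\<in>N. g ** x = x ** h"
    "\<And>g x. g \<in> N \<Longrightarrow> x \<in> \<Gamma> \<Longrightarrow> \<exists>h\<in>N. x ** g = h ** x"
    "finite R" "R \<subseteq> \<Gamma>" "\<And>x. x \<in> \<Gamma> \<Longrightarrow> \<exists>g\<in>N. \<exists>r\<in>R. x = g ** r"
proof -
  let ?G = "SLpm\<lparr>carrier := \<Gamma>\<rparr>"
  interpret S: group "SLpm :: (real ^ 'a ^ 'a) monoid" by (rule group_SLpm)
  interpret G: group ?G by (rule S.subgroup_imp_group[OF \<Gamma>])
  have op: "x \<otimes>\<^bsub>?G\<^esub> y = x ** y" "x \<otimes>\<^bsub>SLpm\<^esub> y = x ** y" for x y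
    by (simp_all add: SLpm_def)
  obtain N where N: "N \<lhd> ?G" "N \<subseteq> \<Delta>" "finite (rcosets\<^bsub>?G\<^esub> N)"
    by (rule G.finite_index_normal_core[OF \<Delta> fin])
  interpret N: normal N ?G by (rule N(1))
  have sub: "N \<subseteq> \<Gamma>" using N.subset by simp
  have "finite ((\<lambda>a. N #>\<^bsub>?G\<^esub> a) ` \<Gamma>)"
    using N(3) by (simp add: RCOSETS_def UNION_singleton_eq_range)
  then obtain R where R: "R \<subseteq> \<Gamma>" "finite R" "(\<lambda>a. N #>\<^bsub>?G\<^esub> a) ` \<Gamma> = (\<lambda>a. N #>\<^bsub>?G\<^esub> a) ` R"
    using finite_subset_image[OF _ order_refl] by metis
  show ?thesis
  proof (rule that[OF N(2) sub _ _ _ R(2,1)])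
    show "subgroup N SLpm" by (rule S.incl_subgroup[OF \<Gamma> N.subgroup_axioms])
    show "\<exists>h\<in>N. g ** x = x ** h" if "g \<in> N" "x \<in> \<Gamma>" for g x
    proof -
      have "g ** x \<in> N #>\<^bsub>?G\<^esub> x" using that(1) by (auto simp: r_coset_def op)
      then show ?thesis using N.coset_eq that(2) by (auto simp: l_coset_def op)
    qed
    show "\<exists>h\<in>N. x ** g = h ** x" if "g \<in> N" "x \<in> \<Gamma>" for g x
    proof -
      have "x ** g \<in> x <#\<^bsub>?G\<^esub> N" using that(1) by (auto simp: l_coset_def op)
      then show ?thesis using N.coset_eq that(2) by (auto simp: r_coset_def op)
    qed
    show "\<exists>g\<in>N. \<exists>r\<in>R. x = g ** r" if x: "x \<in> \<Gamma>" for x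
    proof -
      have "N #>\<^bsub>?G\<^esub> x \<in> (\<lambda>a. N #>\<^bsub>?G\<^esub> a) ` R" unfolding R(3)[symmetric] using x by (rule imageI)
      then obtain r where r: "r \<in> R" "N #>\<^bsub>?G\<^esub> x = N #>\<^bsub>?G\<^esub> r" by (rule imageE)
      have "x \<in> N #>\<^bsub>?G\<^esub> x" using G.rcos_self[OF _ N.subgroup_axioms] x by simp
      then have "x \<in> N #>\<^bsub>?G\<^esub> r" by (simp only: r(2))
      then show ?thesis using r(1) by (auto simp: r_coset_def op)
    qed
  qed
qed

section \<open>Reflections, the cone over the polytope and fixed rays\<close>

lemma reflection_matrix_mult:
  assumes "linear \<alpha>"
  shows "reflection_matrix \<alpha> v *v x = x - \<alpha> x *\<^sub>R v"
proof -
  have "linear (\<lambda>x. x - \<alpha> x *\<^sub>R v)"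
    using assms by (intro linearI) (simp_all add: linear_add linear_scale algebra_simps)
  then show ?thesis
    unfolding reflection_matrix_def by (intro matrix_works) (simp add: linear_matrix_vector_mul_eq)
qed

lemma cone_over_sphere_image:
  assumes "0 \<in> K" "\<And>x r. x \<in> K \<Longrightarrow> r > 0 \<Longrightarrow> r *\<^sub>R x \<in> K"
  shows "cone_over (sphere_image K) = K"
proof
  show "cone_over (sphere_image K) \<subseteq> K"
  proof
    fix v assume v: "v \<in> cone_over (sphere_image K)"
    show "v \<in> K"
    proof (cases "v = 0")
      case False
      then obtain u where u: "u \<in> K" "u \<noteq> 0" "ray v = ray u"
        using v by (auto simp: cone_over_def sphere_image_def)
      then obtain r where "r > 0" "v = r *\<^sub>R u" using False by (auto simp: ray_eq_iff)
      then show ?thesis using assms(2) u by blast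
    qed (use assms(1) in simp)
  qed
  show "K \<subseteq> cone_over (sphere_image K)" by (auto simp: cone_over_def sphere_image_def)
qed

lemma finite_sides:
  assumes "convex_polytope P"
  shows "finite (sides P)"
proof -
  obtain K H where K: "finite H" "0 \<notin> H" "K = {x. \<forall>a\<in>H. a \<bullet> x \<le> 0}" "P = sphere_image K"
    using assms unfolding convex_polytope_def by blast
  have "cone_over P = K"
    unfolding K(4)
    by (rule cone_over_sphere_image) (auto simp: K(3) mult_nonneg_nonpos)
  moreover have "polyhedron K"
  proof -
    have "K = \<Inter>((\<lambda>a. {x. a \<bullet> x \<le> 0}) ` H)" using K(3) by auto
    moreover have "polyhedron (\<Inter>((\<lambda>a. {x. a \<bullet> x \<le> 0}) ` H))"
      using K(1) by (intro polyhedron_Inter) (auto simp: polyhedron_halfspace_le)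
    ultimately show ?thesis by simp
  qed
  ultimately have "finite {F. F facet_of cone_over P}" using finite_polyhedron_facets by simp
  moreover have "sides P = sphere_image ` {F. F facet_of cone_over P}" by (auto simp: sides_def)
  ultimately show ?thesis by simp
qed

locale reflection_group =
  fixes \<Gamma> :: "(real ^ 'd::finite ^ 'd) set" and P :: "'d psphere set"
    and \<alpha> :: "'d psphere set \<Rightarrow> real ^ 'd \<Rightarrow> real" and v :: "'d psphere set \<Rightarrow> real ^ 'd"
  assumes polyhedral: "polyhedral_reflection_group \<Gamma> P \<alpha> v"
begin

sublocale reflections "sides P" \<alpha> v
  using polyhedral finite_sides
  by (intro reflections.intro) (auto simp only: polyhedral_reflection_group_def)

abbreviation "\<sigma> s \<equiv> reflection_matrix (\<alpha> s) (v s)"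

lemma \<sigma>_mult: "s \<in> sides P \<Longrightarrow> \<sigma> s *v x = refl_map s x"
  by (simp add: reflection_matrix_mult linear_\<alpha> refl_map_def)

lemma \<Gamma>_generate: "\<Gamma> = generate SLpm (\<sigma> ` sides P)"
  using polyhedral by (simp add: polyhedral_reflection_group_def)

lemma \<sigma>_mem: "s \<in> sides P \<Longrightarrow> \<sigma> s \<in> \<Gamma>"
  unfolding \<Gamma>_generate by (intro generate.incl imageI)

lemma \<sigma>_inv: "s \<in> sides P \<Longrightarrow> inv\<^bsub>SLpm\<^esub> (\<sigma> s) = \<sigma> s"
proof -
  assume s: "s \<in> sides P"
  then have "\<sigma> s \<in> carrier SLpm" "\<sigma> s ** \<sigma> s = mat 1"
    using polyhedral by (auto simp: polyhedral_reflection_group_def reflection_def)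
  then show ?thesis
    by (intro group.inv_equality[OF group_SLpm]) (simp_all add: SLpm_def)
qed

text \<open>The generators are their own inverses. \<open>W\<close> may be any set, so this serves
  lattices, \<open>K\<close>-forms and subspaces alike.\<close>

lemma invariant_if_reflections:
  assumes "\<And>s x. s \<in> sides P \<Longrightarrow> x \<in> W \<Longrightarrow> refl_map s x \<in> W" "g \<in> \<Gamma>" "x \<in> W"
  shows "g *v x \<in> W"
  using assms(2,3) unfolding \<Gamma>_generate
proof (induction arbitrary: x rule: generate.induct)
  case one
  then show ?case by (simp add: SLpm_def)
next
  case (incl h)
  then show ?case using assms(1) \<sigma>_mult by auto
next
  case (inv h)
  then show ?case using assms(1) \<sigma>_mult \<sigma>_inv by auto
next
  case (eng h1 h2)
  then show ?case by (simp add: SLpm_def matrix_vector_mul_assoc[symmetric])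
qed

text \<open>A nonzero common zero of the forms would put an antipodal pair into
  \<open>P\<close>.\<close>

lemma common_kernel_zero:
  assumes "\<And>s. s \<in> sides P \<Longrightarrow> \<alpha> s x = 0"
  shows "x = 0"
proof (rule ccontr)
  assume x: "x \<noteq> 0"
  have P: "P = sphere_image {x. \<forall>s\<in>sides P. \<alpha> s x \<le> 0}" "properly_convex P"
    using polyhedral by (auto simp: polyhedral_reflection_group_def convex_polytope_def)
  have "\<alpha> s (- x) = 0" if "s \<in> sides P" for s
    using assms[OF that] linear_neg[OF linear_\<alpha>[OF that]] by simp
  then have "ray x \<in> P" "ray (- x) \<in> P"
    using assms x by (subst P(1), auto simp: sphere_image_def)+
  then show False
    using P(2) closure_subset[of P] antipode_ray[OF x] by (force simp: properly_convex_def)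
qed

text \<open>A reflection negates its form \<open>\<alpha> s\<close>, so a positive eigenvalue at
  \<open>x\<close> forces \<open>\<alpha> s x = 0\<close> for every side.\<close>

lemma no_fixed_ray:
  assumes x: "x \<noteq> 0" and fixed: "\<And>g. g \<in> \<Gamma> \<Longrightarrow> \<exists>r>0. g *v x = r *\<^sub>R x"
  shows False
proof -
  have "\<alpha> s x = 0" if s: "s \<in> sides P" for s
  proof (rule ccontr)
    assume a: "\<alpha> s x \<noteq> 0"
    obtain r where r: "r > 0" "refl_map s x = r *\<^sub>R x" using fixed[OF \<sigma>_mem[OF s]] \<sigma>_mult[OF s] by auto
    have "\<alpha> s (refl_map s x) = - \<alpha> s x"
      by (simp add: refl_map_def linear_diff[OF linear_\<alpha>[OF s]] linear_scale[OF linear_\<alpha>[OF s]] \<alpha>_v[OF s])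
    then have "r * \<alpha> s x = - \<alpha> s x" by (simp add: r(2) linear_scale[OF linear_\<alpha>[OF s]])
    then have "(r + 1) * \<alpha> s x = 0" by (simp add: distrib_right)
    then show False using a r(1) by simp
  qed
  then show False using common_kernel_zero x by blast
qed

lemma sides_nonempty: "sides P \<noteq> {}"
  using common_kernel_zero[of 1] by fastforce

lemma image_eq_if_subset:
  assumes "subgroup \<Gamma> SLpm" "\<And>g x. g \<in> \<Gamma> \<Longrightarrow> x \<in> L \<Longrightarrow> g *v x \<in> L" "g \<in> \<Gamma>"
  shows "(*v) g ` L = L"
proof
  show "(*v) g ` L \<subseteq> L" using assms by blast
  obtain h where h: "h \<in> \<Gamma>" "g ** h = mat 1" using SLpm_subgroupD(4)[OF assms(1,3)] by blast
  have "x = g *v (h *v x)" for x by (simp add: matrix_vector_mul_assoc h)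
  then show "L \<subseteq> (*v) g ` L" using assms(2)[OF h(1)] by blast
qed

end

text \<open>The coset representatives move the compact set to finitely many compact sets, which
  together serve the subgroup.\<close>

lemma finite_index_cocompact:
  fixes C :: "(real ^ 'd::finite) set"
  assumes K: "compact K" "K \<subseteq> C" "\<And>x. x \<in> C \<Longrightarrow> \<exists>g\<in>\<Gamma>. \<exists>k\<in>K. \<exists>r>0. x = r *\<^sub>R (g *v k)"
    and R: "finite R" "R \<subseteq> \<Gamma>" "\<And>x. x \<in> \<Gamma> \<Longrightarrow> \<exists>g\<in>N. \<exists>r\<in>R. x = g ** r"
    and pres: "\<And>g x. g \<in> \<Gamma> \<Longrightarrow> x \<in> C \<Longrightarrow> g *v x \<in> C"
  shows "\<exists>K. compact K \<and> K \<subseteq> C \<and> (\<forall>x\<in>C. \<exists>g\<in>N. \<exists>k\<in>K. \<exists>r>0. x = r *\<^sub>R (g *v k))"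
proof (intro exI conjI ballI)
  show "compact (\<Union>r\<in>R. (*v) r ` K)"
    using R(1) K(1)
    by (intro compact_UN compact_continuous_image linear_continuous_on matrix_vector_mul_bounded_linear)
  show "(\<Union>r\<in>R. (*v) r ` K) \<subseteq> C" using pres R(2) K(2) by blast
  fix x assume "x \<in> C"
  then obtain g k r where g: "g \<in> \<Gamma>" "k \<in> K" "r > 0" "x = r *\<^sub>R (g *v k)" using K(3) by blast
  then obtain h q where h: "h \<in> N" "q \<in> R" "g = h ** q" using R(3) by blast
  have "x = r *\<^sub>R (h *v (q *v k))" by (simp add: g h matrix_vector_mul_assoc)
  moreover have "q *v k \<in> (\<Union>r\<in>R. (*v) r ` K)" using h g by blast
  ultimately show "\<exists>g\<in>N. \<exists>k\<in>\<Union>r\<in>R. (*v) r ` K. \<exists>r>0. x = r *\<^sub>R (g *v k)" using h g by blast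
qed

theorem theorem1p1:
  fixes n :: nat
    and \<Gamma> \<Delta> :: "(real ^ 'd ^ 'd::finite) set"
    and \<Omega> P :: "'d psphere set"
    and \<alpha> :: "'d psphere set \<Rightarrow> real ^ 'd \<Rightarrow> real"
    and v :: "'d psphere set \<Rightarrow> real ^ 'd"
    and A :: "real set"
  assumes "n \<ge> 2" and "CARD('d) = n + 1"
    and "polyhedral_reflection_group \<Gamma> P \<alpha> v"
    and "strictly_convex_domain \<Omega>"
    and "divides_domain \<Gamma> \<Omega>"
    and "subgroup \<Delta> (SLpm\<lparr>carrier := \<Gamma>\<rparr>)"
    and "finite (rcosets\<^bsub>SLpm\<lparr>carrier := \<Gamma>\<rparr>\<^esub> \<Delta>)"
    and "real_subring A" and "noetherian_subring A" and "integrally_closed A"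
  shows "(definable_over \<Gamma> A \<longleftrightarrow> simple_cyclic_products (sides P) (cartan_matrix \<alpha> v) \<subseteq> A)
    \<and> (definable_over \<Gamma> A \<longleftrightarrow> definable_over \<Delta> A)"
proof -
  interpret reflection_group \<Gamma> P \<alpha> v by unfold_locales fact
  interpret strictly_convex \<Omega> by unfold_locales fact
  interpret subring_of_reals A by unfold_locales fact
  have \<Gamma>: "subgroup \<Gamma> SLpm" using assms(5) by (simp add: divides_domain_def)
  note G = SLpm_subgroupD[OF \<Gamma>]
  have card3: "CARD('d) \<ge> 3" "DIM(real ^ 'd) \<ge> 3" using assms(1,2) by simp_all
  \<comment> \<open>Schur's lemma is wanted for a group inside \<open>\<Delta>\<close>, which
    preserves the lattices of \<open>\<Delta>\<close>, and the reflections must normalise it; hence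
    the normal core.\<close>
  obtain N R where N: "N \<subseteq> \<Delta>" "N \<subseteq> \<Gamma>" "subgroup N SLpm"
    and Nr: "\<And>g x. g \<in> N \<Longrightarrow> x \<in> \<Gamma> \<Longrightarrow> \<exists>h\<in>N. g ** x = x ** h"
    and Nl: "\<And>g x. g \<in> N \<Longrightarrow> x \<in> \<Gamma> \<Longrightarrow> \<exists>h\<in>N. x ** g = h ** x"
    and R: "finite R" "R \<subseteq> \<Gamma>" "\<And>x. x \<in> \<Gamma> \<Longrightarrow> \<exists>g\<in>N. \<exists>r\<in>R. x = g ** r"
    by (rule SLpm_normal_core[OF \<Gamma> assms(6,7)]) (rule that; (assumption | blast))
  have pres: "g *v x \<in> C" if g: "g \<in> \<Gamma>" and x: "x \<in> C" for g x
  proof -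
    have xnz: "x \<noteq> 0" "ray x \<in> \<Omega>" using x by (auto simp: ray_cone_def)
    have "act g (ray x) \<in> \<Omega>" using assms(5) g xnz(2) unfolding divides_domain_def by blast
    then show ?thesis
      using act_ray[OF G(1)[OF g] xnz(1)] SLpm_nonzero[OF G(1)[OF g] xnz(1)] by (simp add: ray_cone_def)
  qed
  obtain K where K: "compact K" "K \<subseteq> C" "\<And>x. x \<in> C \<Longrightarrow> \<exists>g\<in>\<Gamma>. \<exists>k\<in>K. \<exists>r>0. x = r *\<^sub>R (g *v k)"
    by (rule compact_fundamental_set[OF open_\<Omega> assms(5)]) (rule that; (assumption | blast))
  interpret divided_cone C N
  proof
    show "open C" by (rule open_cone)
    show "C \<noteq> {}" by (rule cone_ne)
    show "0 \<notin> C" by (simp add: ray_cone_def)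
    show "\<exists>K. compact K \<and> K \<subseteq> C \<and> (\<forall>x\<in>C. \<exists>g\<in>N. \<exists>k\<in>K. \<exists>r>0. x = r *\<^sub>R (g *v k))"
      by (rule finite_index_cocompact[OF K R pres])
    show "\<exists>h\<in>N. g ** h = mat 1 \<and> h ** g = mat 1" if "g \<in> N" for g
      by (rule SLpm_subgroupD(4)[OF N(3) that])
  qed (use ray_cone_scale cone_sharp cone_strict pres N(2) card3 in auto)
  \<comment> \<open>Irreducibility already of \<open>N\<close>: \<open>\<Gamma>\<close> normalises
    it and fixes no ray.\<close>
  have irr: "W = {0} \<or> W = UNIV" if "subspace W" "\<And>g x. g \<in> N \<Longrightarrow> x \<in> W \<Longrightarrow> g *v x \<in> W" for W
  proof (rule irreducible[where H = \<Gamma>])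
    show "invertible g" if "g \<in> \<Gamma>" for g
      using G(1)[OF that] by (auto simp: SLpm_def invertible_det_nz)
    show "\<exists>g'\<in>N. g ** \<gamma> = \<gamma> ** g'" if "\<gamma> \<in> \<Gamma>" "g \<in> N" for \<gamma> g
      by (rule Nr[OF that(2,1)])
  qed (use that pres no_fixed_ray in blast)+
  have definable_if: "definable_over \<Gamma> A" if "A_lattice A L"
    "\<And>s x. s \<in> sides P \<Longrightarrow> x \<in> L \<Longrightarrow> refl_map s x \<in> L" for L
  proof -
    have "\<forall>g\<in>\<Gamma>. (*v) g ` L = L"
      using image_eq_if_subset[OF \<Gamma> invariant_if_reflections[where W = L, OF that(2)]] by simp
    then show ?thesis unfolding definable_over_def using that(1) by (intro exI conjI)
  qed
  have a_imp_a': "simple_cyclic_products (sides P) (cartan_matrix \<alpha> v) \<subseteq> A" if a: "definable_over \<Gamma> A"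
  proof -
    obtain L where L: "A_lattice A L" "\<And>g. g \<in> \<Gamma> \<Longrightarrow> (*v) g ` L = L"
      using a unfolding definable_over_def by blast
    show ?thesis
    proof (rule simple_cyclic_products_mem[OF subring_of_reals_axioms assms(9,10) L(1)])
      show "refl_map s x \<in> L" if "s \<in> sides P" "x \<in> L" for s x
        using L(2)[OF \<sigma>_mem[OF that(1)]] that by (auto simp: \<sigma>_mult)
    qed
  qed
  have a'_imp_a: "definable_over \<Gamma> A" if cyc: "simple_cyclic_products (sides P) (cartan_matrix \<alpha> v) \<subseteq> A"
  proof -
    obtain i0 where i0: "i0 \<in> sides P" using sides_nonempty by blast
    \<comment> \<open>A subspace preserved by the reflections is preserved by
      \<open>\<Gamma>\<close>, hence by \<open>N\<close>.\<close>
    have "W = {0} \<or> W = UNIV" if "subspace W" "\<And>s x. s \<in> sides P \<Longrightarrow> x \<in> W \<Longrightarrow> refl_map s x \<in> W" for W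
      using that N(2) invariant_if_reflections[where W = W] by (intro irr) blast+
    then obtain L where "A_lattice A L" "\<And>s x. s \<in> sides P \<Longrightarrow> x \<in> L \<Longrightarrow> refl_map s x \<in> L"
      using invariant_lattice_exists[OF subring_of_reals_axioms _ cyc i0] by metis
    then show ?thesis by (rule definable_if)
  qed
  have a_imp_b: "definable_over \<Delta> A" if "definable_over \<Gamma> A"
    using that subgroup.subset[OF assms(6)] unfolding definable_over_def by fastforce
  have b_imp_a: "definable_over \<Gamma> A" if b: "definable_over \<Delta> A"
  proof -
    obtain L where L: "A_lattice A L" "\<And>g. g \<in> \<Delta> \<Longrightarrow> (*v) g ` L = L"
      using b unfolding definable_over_def by blast
    have fg: "fin_gen_submodule A L" using L(1) by (simp add: A_lattice_def)
    obtain E where E: "E \<subseteq> L" "finite E" "independent E" "span E = UNIV"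
      "L \<subseteq> span_over (fractions A) E"
      by (rule A_lattice_basis[OF fg L(1)]) (rule that; assumption)
    \<comment> \<open>The \<open>K\<close>-form attached to the lattice of
      \<open>\<Delta>\<close>.\<close>
    let ?M = "span_over (fractions A) E"
    have N_L: "(*v) g ` L = L" if "g \<in> N" for g using L(2) N(1) that by blast
    have refl_M: "refl_map s e \<in> ?M" if s: "s \<in> sides P" and e: "e \<in> E" for s e
    proof -
      \<comment> \<open>Schur's lemma for \<open>N\<close> shows that the reflection preserves the
        form up to a scalar, which the trace argument then removes.\<close>
      obtain c where c: "c \<noteq> 0" "\<And>e. e \<in> E \<Longrightarrow> c *\<^sub>R refl_map s e \<in> ?M"
      proof (rule frac.normalizer_preserves_form_up_to_scalar[OF E(3,2,4) linear_refl_map[OF s]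
            refl_map_refl_map[OF s], where D = "(*v) ` N"])
        show "linear \<delta>" if "\<delta> \<in> (*v) ` N" for \<delta> using that by auto
        show "\<delta> e \<in> ?M" if "\<delta> \<in> (*v) ` N" "e \<in> E" for \<delta> e
          using that N_L E(1,5) by blast
        show "\<exists>\<delta>'\<in>(*v) ` N. \<forall>x. refl_map s (\<delta> x) = \<delta>' (refl_map s x)" if \<delta>: "\<delta> \<in> (*v) ` N" for \<delta>
        proof -
          obtain g where g: "g \<in> N" "\<delta> = (*v) g" using \<delta> by blast
          obtain h where h: "h \<in> N" "\<sigma> s ** g = h ** \<sigma> s" using Nl[OF g(1) \<sigma>_mem[OF s]] by blast
          have "refl_map s (\<delta> x) = h *v refl_map s x" for x
            using arg_cong[OF h(2), of "\<lambda>M. M *v x"]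
            by (simp add: g(2) matrix_vector_mul_assoc[symmetric] \<sigma>_mult[OF s])
          then show ?thesis using h(1) by blast
        qed
        show "\<exists>c. \<forall>x. f x = c *\<^sub>R x" if "linear f" "\<And>\<delta> x. \<delta> \<in> (*v) ` N \<Longrightarrow> f (\<delta> x) = \<delta> (f x)" for f
          using schur[OF irr that(1)] that(2) by (metis imageI)
      qed blast
      show ?thesis
        using frac.reflection_preserves_form[OF E(3,2,4) linear_\<alpha>[OF s] \<alpha>_v[OF s] card3(2) c(1) _ e] c(2)
        by (simp add: refl_map_def)
    qed
    have \<Gamma>_M: "g *v x \<in> ?M" if "g \<in> \<Gamma>" "x \<in> ?M" for g x
    proof (rule invariant_if_reflections[OF _ that])
      show "refl_map s x \<in> ?M" if "s \<in> sides P" "x \<in> ?M" for s x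
        by (rule span_over_linear_image[OF linear_refl_map[OF that(1)] refl_M[OF that(1)] that(2)])
    qed
    \<comment> \<open>Writing \<open>g = r h'\<close> with \<open>h'\<close> in \<open>N\<close>
      shows that the translate of \<open>L\<close> by \<open>g\<close> depends only on the
      representative \<open>r\<close>.\<close>
    have "(\<lambda>g. g ` L) ` (*v) ` \<Gamma> \<subseteq> (\<lambda>r. (*v) r ` L) ` R"
    proof clarify
      fix g assume "g \<in> \<Gamma>"
      then obtain h r where h: "h \<in> N" "r \<in> R" "g = h ** r" using R(3) by blast
      then obtain h' where h': "h' \<in> N" "g = r ** h'" using Nr R(2) by blast
      have "(*v) g ` L = (*v) r ` (*v) h' ` L"
        by (simp add: h'(2) image_image matrix_vector_mul_assoc)
      also have "\<dots> = (*v) r ` L" using N_L[OF h'(1)] by simp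
      finally show "(*v) g ` L \<in> (\<lambda>r. (*v) r ` L) ` R" using h(2) by blast
    qed
    then have fin: "finite ((\<lambda>g. g ` L) ` (*v) ` \<Gamma>)"
      by (rule finite_subset) (simp add: R(1))
    obtain L' where L': "A_lattice A L'" "\<And>g. g \<in> (*v) ` \<Gamma> \<Longrightarrow> g ` L' \<subseteq> L'"
    proof (rule A_lattice_translates[OF L(1) E(5,3,2,4), where G = "(*v) ` \<Gamma>"])
      show "id \<in> (*v) ` \<Gamma>"
        using G(2) by (intro image_eqI[of _ _ "mat 1"]) (auto simp: fun_eq_iff)
      show "g \<circ> h \<in> (*v) ` \<Gamma>" if gh: "g \<in> (*v) ` \<Gamma>" "h \<in> (*v) ` \<Gamma>" for g h
      proof -
        obtain a b where "a \<in> \<Gamma>" "g = (*v) a" "b \<in> \<Gamma>" "h = (*v) b" using gh by blast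
        then show ?thesis
          using G(3) by (intro image_eqI[of _ _ "a ** b"]) (auto simp: fun_eq_iff matrix_vector_mul_assoc)
      qed
      show "linear g" if "g \<in> (*v) ` \<Gamma>" for g using that by auto
      show "g e \<in> ?M" if "g \<in> (*v) ` \<Gamma>" "e \<in> E" for g e
        using that \<Gamma>_M span_over_base by blast
    qed (use fin in blast)+
    show ?thesis
    proof (rule definable_if[OF L'(1)])
      show "refl_map s x \<in> L'" if "s \<in> sides P" "x \<in> L'" for s x
        using L'(2)[of "(*v) (\<sigma> s)"] \<sigma>_mem[OF that(1)] \<sigma>_mult[OF that(1)] that(2) by auto
    qed
  qed
  show ?thesis using a_imp_a' a'_imp_a a_imp_b b_imp_a by blast
qed

end
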